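(* Let $d\ge 2$ and $n\geq d+1$ be integers, and let $X_1,\dots,X_n$ be independent and identically distributed random points in $\mathbb{R}^d$ whose common distribution belongs to one of the classes $\mathbf{G}$, $\mathbf{H}$, $\mathbf{B}$ or $\mathbf{U}$. Let $P_{n-1}=\operatorname{conv}(X_1,\dots,X_{n-1})$ and $P_n=\operatorname{conv}(X_1,\dots,X_n)$. Then $$\mathbb{E} f_{d-1}(P_n) > \mathbb{E} f_{d-1}(P_{n-1}).$$
   Context: $\|\cdot\|$ is the Euclidean norm on $\mathbb{R}^d$ and $\operatorname{conv}$ denotes the convex hull. The four classes of probability measures on $\mathbb{R}^d$ are as follows. - $\mathbf{G}$: the centred Gaussian distributions with Lebesgue density on $\mathbb{R}^d$ proportional to $x\mapsto \exp\left(-\frac{\|x\|^2}{2\sigma^2}\right)$, with parameter $\sigma>0$. - $\mathbf{H}$: the distributions with Lebesgue density on $\mathbb{R}^d$ proportional to $x\mapsto\left(1+\frac{\|x\|^2}{\sigma^2}\right)^{-\beta}$, with parameters $\beta>d/2$ and $\sigma>0$. - $\mathbf{B}$: the distributions concentrated on the centred ball $\mathbb{B}^d_\sigma=\{x\in\mathbb{R}^d:\|x\|\le\sigma\}$ with Lebesgue density there proportional to $x\mapsto\left(1-\frac{\|x\|^2}{\sigma^2}\right)^{\beta}$, with parameters $\beta>-1$ and $\sigma>0$. - $\mathbf{U}$: the uniform distributions (normalized surface measure) on the centred spheres $\mathbb{S}^{d-1}_\sigma=\{x\in\mathbb{R}^d:\|x\|=\sigma\}$, with $\sigma>0$. For a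 polytope $P\subset\mathbb{R}^d$, $f_{d-1}(P)$ denotes the number of its facets, i.e. its $(d-1)$-dimensional faces. If $P$ itself has dimension $d-1$ (which is almost surely the case for $P_{n-1}$ when $n=d+1$), then $P$ is counted as its own single $(d-1)$-dimensional face, so $f_{d-1}(P)=1$. *)

theory Defs
  imports "HOL-Probability.Probability"
begin

definition face_number :: "nat \<Rightarrow> 'a::euclidean_space set \<Rightarrow> nat"
  where "face_number k P = card {F. F face_of P \<and> aff_dim F = int k}"

text \<open>The normalizing constant is not written out: it is determined by the requirement that
  the measure has total mass one.\<close>

definition prob_density_proportional ::
    "'a::euclidean_space measure \<Rightarrow> ('a \<Rightarrow> real) \<Rightarrow> bool"
  where "prob_density_proportional \<mu> g \<longleftrightarrow>
    prob_space \<mu> \<and> (\<exists>c>0. \<mu> = density lborel (\<lambda>x. ennreal (c * g x)))"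

definition class_G :: "'a::euclidean_space measure set"
  where "class_G = {\<mu>. \<exists>\<sigma>>0.
    prob_density_proportional \<mu> (\<lambda>x. exp (- ((norm x)\<^sup>2 / (2 * \<sigma>\<^sup>2))))}"

definition class_H :: "'a::euclidean_space measure set"
  where "class_H = {\<mu>. \<exists>\<beta> > real DIM('a) / 2. \<exists>\<sigma>>0.
    prob_density_proportional \<mu> (\<lambda>x. (1 + (norm x)\<^sup>2 / \<sigma>\<^sup>2) powr (- \<beta>))}"

definition class_B :: "'a::euclidean_space measure set"
  where "class_B = {\<mu>. \<exists>\<beta> > -1. \<exists>\<sigma>>0.
    prob_density_proportional \<mu>
      (\<lambda>x. indicator (cball 0 \<sigma>) x * (1 - (norm x)\<^sup>2 / \<sigma>\<^sup>2) powr \<beta>)}"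

text \<open>Surface measure on the sphere of radius \<open>\<sigma>\<close>, defined by polar coordinates: a
  Borel set \<open>A\<close> of that sphere gets \<open>d / \<sigma>\<close> times the volume of the cone
  \<open>{t *\<^sub>R x | t x. 0 < t \<and> t \<le> 1 \<and> x \<in> A}\<close>, whose volume is the integral of
  \<open>(r / \<sigma>) ^ (d - 1)\<close> times the area of \<open>A\<close> over \<open>0 < r \<le> \<sigma>\<close>. The radial projection sends
  the origin to itself (division by zero), which only affects a null set.\<close>

definition sphere_surface_measure :: "real \<Rightarrow> 'a::euclidean_space measure"
  where "sphere_surface_measure \<sigma> =
    scale_measure (ennreal (real DIM('a) / \<sigma>))
      (distr (restrict_space lborel (cball 0 \<sigma>)) borel (\<lambda>x. (\<sigma> / norm x) *\<^sub>R x))"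

definition uniform_sphere :: "real \<Rightarrow> 'a::euclidean_space measure"
  where "uniform_sphere \<sigma> = uniform_measure (sphere_surface_measure \<sigma>) (sphere 0 \<sigma>)"

lemma emeasure_sphere_surface_measure:
  fixes A :: "'a::euclidean_space set"
  assumes "\<sigma> > 0" "A \<in> sets borel" "A \<subseteq> sphere 0 \<sigma>"
  shows "emeasure (sphere_surface_measure \<sigma>) A =
    ennreal (real DIM('a) / \<sigma>) * emeasure lborel {t *\<^sub>R x | t x. 0 < t \<and> t \<le> 1 \<and> x \<in> A}"
proof -
  let ?f = "\<lambda>x::'a. (\<sigma> / norm x) *\<^sub>R x"
  have "{t *\<^sub>R x | t x. 0 < t \<and> t \<le> 1 \<and> x \<in> A} = ?f -` A \<inter> cball 0 \<sigma>" (is "?L = ?R")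
  proof (intro equalityI subsetI)
    fix y assume "y \<in> ?L"
    then obtain t x where "y = t *\<^sub>R x" "0 < t" "t \<le> 1" "x \<in> A" by auto
    moreover from this have "norm x = \<sigma>" using assms by auto
    ultimately show "y \<in> ?R" using assms(1) by (auto simp: mult_le_cancel_right1)
  next
    fix y assume y: "y \<in> ?R"
    then have "norm (?f y) = \<sigma>" using assms(3) by auto
    then have "y \<noteq> 0" using assms(1) by auto
    then have "y = (norm y / \<sigma>) *\<^sub>R ?f y" "0 < norm y / \<sigma>" "norm y / \<sigma> \<le> 1"
      using assms(1) y by auto
    then show "y \<in> ?L" using y by blast
  qed
  then show ?thesis
    using assms unfolding sphere_surface_measure_def
    by (simp add: emeasure_distr measurable_restrict_space1 emeasure_restrict_space
        space_restrict_space)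
qed

lemma prob_space_uniform_sphere:
  assumes "\<sigma> > 0"
  shows "prob_space (uniform_sphere \<sigma> :: 'a::euclidean_space measure)"
proof -
  let ?S = "sphere 0 \<sigma> :: 'a set"
  have "{t *\<^sub>R x | t x. 0 < t \<and> t \<le> 1 \<and> x \<in> ?S} = cball 0 \<sigma> - {0}" (is "?L = ?R")
  proof (intro equalityI subsetI)
    fix y assume "y \<in> ?L"
    then show "y \<in> ?R" using assms by (auto simp: mult_le_cancel_right1)
  next
    fix y assume y: "y \<in> ?R"
    then have "y = (norm y / \<sigma>) *\<^sub>R ((\<sigma> / norm y) *\<^sub>R y)" "0 < norm y / \<sigma>"
      "norm y / \<sigma> \<le> 1" "(\<sigma> / norm y) *\<^sub>R y \<in> ?S"
      using assms by auto
    then show "y \<in> ?L" by blast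
  qed
  then have "emeasure (sphere_surface_measure \<sigma>) ?S =
      ennreal (real DIM('a) / \<sigma>) * emeasure lborel (cball 0 \<sigma> - {0::'a})"
    using assms by (subst emeasure_sphere_surface_measure) auto
  also have "emeasure lborel (cball 0 \<sigma> - {0::'a}) = emeasure lborel (cball 0 \<sigma> :: 'a set)"
    using assms by (subst emeasure_Diff) auto
  also have "\<dots> = ennreal (measure lborel (cball 0 \<sigma> :: 'a set))"
    using emeasure_lborel_cball_finite[of "0::'a" \<sigma>] by (intro emeasure_eq_ennreal_measure) auto
  finally have "emeasure (sphere_surface_measure \<sigma>) ?S \<noteq> 0"
    "emeasure (sphere_surface_measure \<sigma>) ?S \<noteq> \<infinity>"
    using assms content_cball_pos[of \<sigma> "0::'a"] by (auto simp: ennreal_mult_eq_top_iff)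
  then show ?thesis
    unfolding uniform_sphere_def by (rule prob_space_uniform_measure)
qed

definition class_U :: "'a::euclidean_space measure set"
  where "class_U = {\<mu>. \<exists>\<sigma>>0. \<mu> = uniform_sphere \<sigma>}"

end

theory Submission
  imports Defs
begin

text \<open>In general position the expected number of facets is C(n,d) M(k), where k = n - d and
  M(k) = E(p^k + q^k), p and q being the masses of the two sides of the hyperplane through d of the
  points. As k C(n,d) = n C(n-1,d), growth for k > 1 means (d+k) M(k) > k M(k-1). Behind M stands
  the distance of that hyperplane from the origin: its signed version has a density proportional to
  F' L^(d-1), where F is the distribution function of a coordinate and L is concave as a function of
  F. Integrating the derivative of F^k (1-F) L^(d-1) gives the inequality. The obstacle is the
  uniform law on a sphere. It has no density and is reached as a limit of beta laws with exponent
  tending to -1, where a strict inequality may degenerate. So the difference is bounded below by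
  (d-1) ((1-M(2))/2)^k, which is continuous in the moments, and M(2) < 1 is verified on the sphere
  itself. Hyperplanes are described in d coordinates throughout, one of them a dummy confined to
  [0,1], so that no space of dimension d-1 has to be introduced.\<close>

section \<open>Linear changes of variables for Lebesgue measure\<close>

lemma nn_integral_lborel_translate:
  fixes f :: "'a::euclidean_space \<Rightarrow> ennreal"
  assumes [measurable]: "f \<in> borel_measurable borel"
  shows "(\<integral>\<^sup>+x. f (x + a) \<partial>lborel) = (\<integral>\<^sup>+x. f x \<partial>lborel)"
proof -
  have "(\<integral>\<^sup>+x. f x \<partial>lborel) = (\<integral>\<^sup>+x. f x \<partial>density (distr lborel borel (\<lambda>x. a + 1 *\<^sub>R x)) (\<lambda>_. ennreal (\<bar>1\<bar>^DIM('a))))"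
    by (subst lborel_affine[of 1 a]) simp_all
  also have "\<dots> = (\<integral>\<^sup>+x. f (x + a) \<partial>lborel)"
    by (simp add: nn_integral_density nn_integral_distr add.commute)
  finally show ?thesis by simp
qed

lemma nn_integral_lborel_uminus:
  fixes f :: "'a::euclidean_space \<Rightarrow> ennreal"
  assumes [measurable]: "f \<in> borel_measurable borel"
  shows "(\<integral>\<^sup>+x. f (- x) \<partial>lborel) = (\<integral>\<^sup>+x. f x \<partial>lborel)"
proof -
  have "(\<integral>\<^sup>+x. f x \<partial>lborel) = (\<integral>\<^sup>+x. f x \<partial>density (distr lborel borel (\<lambda>x. 0 + (-1) *\<^sub>R x)) (\<lambda>_. ennreal (\<bar>-1\<bar>^DIM('a))))"
    by (subst lborel_affine[of "-1" 0]) simp_all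
  also have "\<dots> = (\<integral>\<^sup>+x. f (- x) \<partial>lborel)"
    by (simp add: nn_integral_density nn_integral_distr)
  finally show ?thesis by simp
qed

lemma borel_measurable_linear:
  fixes T :: "'a::euclidean_space \<Rightarrow> 'b::euclidean_space"
  assumes "linear T" shows "T \<in> borel_measurable borel"
  using assms by (intro borel_measurable_continuous_onI linear_continuous_on linear_conv_bounded_linear[THEN iffD1])

text \<open>Uniqueness of the translation invariant measure in disguise: after inserting the
  translation \<open>x \<mapsto> x + T\<^sup>-\<^sup>1 y\<close>, Fubini exchanges the roles of \<open>f\<close> and \<open>g\<close>.\<close>

lemma nn_integral_linear_cross:
  fixes T :: "'a::euclidean_space \<Rightarrow> 'a" and f g :: "'a \<Rightarrow> ennreal"
  assumes T: "linear T" "inj T" and [measurable]: "f \<in> borel_measurable borel" "g \<in> borel_measurable borel"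
  shows "(\<integral>\<^sup>+x. f (T x) \<partial>lborel) * (\<integral>\<^sup>+x. g x \<partial>lborel) = (\<integral>\<^sup>+x. g (T x) \<partial>lborel) * (\<integral>\<^sup>+x. f x \<partial>lborel)"
proof -
  have [measurable]: "T \<in> borel_measurable borel" by (rule borel_measurable_linear) fact
  have surj: "surj T" using T linear_injective_imp_surjective by blast
  have *: "(\<integral>\<^sup>+x. h (T x + y) \<partial>lborel) = (\<integral>\<^sup>+x. h (T x) \<partial>lborel)"
    if [measurable]: "h \<in> borel_measurable borel" for y and h :: "'a \<Rightarrow> ennreal"
  proof -
    obtain z where z: "y = T z" using surj by (metis surjD)
    show ?thesis
      using nn_integral_lborel_translate[of "\<lambda>x. h (T x)" z] by (simp add: z linear_add[OF T(1)])
  qed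
  \<comment> \<open>After the second translation \<open>g\<close> is read at \<open>y - T x\<close>;
    reflecting x brings it back to \<open>y + T x\<close>, where translation by a preimage of y
    applies.\<close>
  have **: "(\<integral>\<^sup>+x. g (y - T x) \<partial>lborel) = (\<integral>\<^sup>+x. g (T x) \<partial>lborel)" for y
    using nn_integral_lborel_uminus[of "\<lambda>x. g (y + T x)"] *[of g y]
    by (simp add: linear_neg[OF T(1)] add.commute)
  have "(\<integral>\<^sup>+x. f (T x) \<partial>lborel) * (\<integral>\<^sup>+x. g x \<partial>lborel) = (\<integral>\<^sup>+y. (\<integral>\<^sup>+x. f (T x + y) \<partial>lborel) * g y \<partial>lborel)"
    by (subst *) (simp_all add: nn_integral_cmult)
  also have "\<dots> = (\<integral>\<^sup>+y. \<integral>\<^sup>+x. f (T x + y) * g y \<partial>lborel \<partial>lborel)"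
    by (simp add: nn_integral_multc)
  also have "\<dots> = (\<integral>\<^sup>+x. \<integral>\<^sup>+y. f (T x + y) * g y \<partial>lborel \<partial>lborel)"
    by (rule lborel_pair.Fubini') measurable
  also have "\<dots> = (\<integral>\<^sup>+x. \<integral>\<^sup>+y. f y * g (y - T x) \<partial>lborel \<partial>lborel)"
  proof (rule nn_integral_cong)
    fix x
    show "(\<integral>\<^sup>+y. f (T x + y) * g y \<partial>lborel) = (\<integral>\<^sup>+y. f y * g (y - T x) \<partial>lborel)"
      using nn_integral_lborel_translate[of "\<lambda>y. f y * g (y - T x)" "T x"] by (simp add: add.commute)
  qed
  also have "\<dots> = (\<integral>\<^sup>+y. \<integral>\<^sup>+x. f y * g (y - T x) \<partial>lborel \<partial>lborel)"
    by (rule lborel_pair.Fubini') measurable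
  also have "\<dots> = (\<integral>\<^sup>+y. f y * (\<integral>\<^sup>+x. g (T x) \<partial>lborel) \<partial>lborel)"
    by (simp add: nn_integral_cmult **)
  also have "\<dots> = (\<integral>\<^sup>+x. g (T x) \<partial>lborel) * (\<integral>\<^sup>+x. f x \<partial>lborel)"
    by (simp add: nn_integral_multc mult.commute)
  finally show ?thesis .
qed

text \<open>For a linear bijection \<open>T\<close> this is the absolute value of its determinant. The formula
  makes the measurable dependence on \<open>T\<close> evident.\<close>

definition jac :: "('a::euclidean_space \<Rightarrow> 'a) \<Rightarrow> ennreal" where
  "jac T = emeasure lborel (cball 0 1 :: 'a set) / (\<integral>\<^sup>+x. indicator (cball 0 1) (T x) \<partial>lborel)"

text \<open>An injective linear map is bounded above and below by positive multiples of the norm, so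
  the preimage of the unit ball lies between two balls. This keeps the quotient \<open>jac\<close>
  away from 0 and infinity.\<close>

lemma ball_preimage_integral:
  fixes T :: "'a::euclidean_space \<Rightarrow> 'a"
  assumes T: "linear T" "inj T"
  shows "(\<integral>\<^sup>+x. indicator (cball 0 1) (T x) \<partial>lborel) \<noteq> 0" "(\<integral>\<^sup>+x. indicator (cball 0 1) (T x) \<partial>lborel) \<noteq> \<infinity>"
proof -
  have [measurable]: "T \<in> borel_measurable borel" by (rule borel_measurable_linear) fact
  have c: "emeasure lborel (cball 0 1 :: 'a set) \<noteq> 0" "emeasure lborel (cball 0 1 :: 'a set) \<noteq> \<infinity>"
    using content_cball_pos[of 1 "0::'a"] emeasure_lborel_cball_finite[of "0::'a" 1]
    by (auto simp: measure_def)
  obtain B where B: "B > 0" "\<And>x. norm (T x) \<le> B * norm x"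
    using linear_bounded_pos[OF T(1)] by blast
  have "emeasure lborel (cball 0 (1/B) :: 'a set) \<le> (\<integral>\<^sup>+x. indicator (cball 0 1) (T x) \<partial>lborel)"
    by (subst nn_integral_indicator[symmetric], simp, rule nn_integral_mono)
       (auto simp: indicator_def B(1) field_simps intro: order_trans[OF B(2)])
  moreover have "emeasure lborel (cball 0 (1/B) :: 'a set) \<noteq> 0"
    using content_cball_pos[of "1/B" "0::'a"] B(1) by (auto simp: measure_def)
  ultimately show "(\<integral>\<^sup>+x. indicator (cball 0 1) (T x) \<partial>lborel) \<noteq> 0" by auto
  obtain C where C: "C > 0" "\<And>x. C * norm x \<le> norm (T x)"
    using linear_inj_bounded_below_pos[OF T] by (metis mult.commute)
  have "(\<integral>\<^sup>+x. indicator (cball 0 1) (T x) \<partial>lborel) \<le> emeasure lborel (cball 0 (1/C) :: 'a set)"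
    by (subst nn_integral_indicator[symmetric], simp, rule nn_integral_mono)
       (auto simp: indicator_def C(1) field_simps intro: order_trans[OF C(2)])
  moreover have "emeasure lborel (cball 0 (1/C) :: 'a set) < \<infinity>"
    by (rule emeasure_lborel_cball_finite)
  ultimately show "(\<integral>\<^sup>+x. indicator (cball 0 1) (T x) \<partial>lborel) \<noteq> \<infinity>" by auto
qed

lemma emeasure_unit_ball:
  "emeasure lborel (cball 0 1 :: 'a::euclidean_space set) \<noteq> 0" "emeasure lborel (cball 0 1 :: 'a set) \<noteq> \<infinity>"
  using ball_preimage_integral[of "\<lambda>x::'a. x"] by (auto simp: linear_id[unfolded id_def])

lemma jac_pos_finite:
  assumes "linear T" "inj T" shows "jac T \<noteq> 0" "jac T \<noteq> \<infinity>"
  using ball_preimage_integral[OF assms] emeasure_unit_ball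
  by (auto simp: jac_def ennreal_divide_eq_0_iff ennreal_divide_eq_top_iff)

text \<open>The cross-multiplied identity with the indicator of the unit ball in place of g, divided
  by the volume of the preimage of the ball.\<close>

lemma nn_integral_linear:
  fixes T :: "'a::euclidean_space \<Rightarrow> 'a" and f :: "'a \<Rightarrow> ennreal"
  assumes T: "linear T" "inj T" and [measurable]: "f \<in> borel_measurable borel"
  shows "(\<integral>\<^sup>+x. f x \<partial>lborel) = jac T * (\<integral>\<^sup>+x. f (T x) \<partial>lborel)"
proof -
  let ?I = "\<integral>\<^sup>+x. indicator (cball 0 1) (T x) \<partial>(lborel::'a measure)"
  have "(\<integral>\<^sup>+x. f (T x) \<partial>lborel) * (\<integral>\<^sup>+x. indicator (cball 0 1 :: 'a set) x \<partial>lborel) = ?I * (\<integral>\<^sup>+x. f x \<partial>lborel)"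
    by (rule nn_integral_linear_cross[OF T, of f "indicator (cball 0 1)"]) (simp_all add: borel_measurable_indicator)
  then have eq: "?I * (\<integral>\<^sup>+x. f x \<partial>lborel) = (\<integral>\<^sup>+x. f (T x) \<partial>lborel) * emeasure lborel (cball 0 1 :: 'a set)"
    by simp
  have "(\<integral>\<^sup>+x. f x \<partial>lborel) = (?I * (\<integral>\<^sup>+x. f x \<partial>lborel)) / ?I"
    using ball_preimage_integral[OF T] by (simp add: ennreal_mult_divide_eq mult.commute)
  also have "\<dots> = ((\<integral>\<^sup>+x. f (T x) \<partial>lborel) * emeasure lborel (cball 0 1 :: 'a set)) / ?I"
    unfolding eq ..
  also have "\<dots> = jac T * (\<integral>\<^sup>+x. f (T x) \<partial>lborel)"
    by (simp add: jac_def ennreal_times_divide ennreal_divide_times mult.commute)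
  finally show ?thesis .
qed

lemma nn_integral_affine:
  fixes T :: "'a::euclidean_space \<Rightarrow> 'a" and f :: "'a \<Rightarrow> ennreal"
  assumes T: "linear T" "inj T" and [measurable]: "f \<in> borel_measurable borel"
  shows "(\<integral>\<^sup>+x. f x \<partial>lborel) = jac T * (\<integral>\<^sup>+x. f (T x + m) \<partial>lborel)"
  using nn_integral_linear[OF T, of "\<lambda>x. f (x + m)"] nn_integral_lborel_translate[of f m] by simp

text \<open>\<open>B\<close> changes variables in the volume of the \<open>A\<close>-preimage of the
  ball. \<open>A\<close> is allowed to be singular because \<open>colone X\<close> takes its place
  later for every X; the preimage then has infinite volume and both sides are 0.\<close>

lemma jac_compose:
  fixes B :: "'a::euclidean_space \<Rightarrow> 'a"
  assumes A: "linear A" and B: "linear B" "inj B"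
  shows "jac (\<lambda>x. A (B x)) = jac A * jac B"
proof -
  have [measurable]: "A \<in> borel_measurable borel" by (rule borel_measurable_linear) fact
  let ?I = "\<integral>\<^sup>+x. indicator (cball 0 1) (A (B x)) \<partial>(lborel::'a measure)"
  have *: "(\<integral>\<^sup>+x. indicator (cball 0 1) (A x) \<partial>lborel) = jac B * ?I"
    by (rule nn_integral_linear[OF B]) (rule measurable_compose[where N=borel and g="indicator (cball 0 1)"], simp_all add: borel_measurable_indicator)
  note jB = jac_pos_finite[OF B]
  have "jac A * jac B = emeasure lborel (cball 0 1 :: 'a set) * (jac B / (jac B * ?I))"
    unfolding jac_def[of A] * by (simp add: ennreal_times_divide ennreal_divide_times mult.commute)
  also have "jac B / (jac B * ?I) = 1 / ?I"
  proof (cases "?I = \<infinity>")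
    case True then show ?thesis using jB by (simp add: ennreal_mult_top)
  next
    case False
    then show ?thesis using jB by (simp add: divide_ennreal_def ennreal_inverse_mult mult.assoc[symmetric] ennreal_divide_self[unfolded divide_ennreal_def] less_top)
  qed
  finally show ?thesis by (simp add: jac_def ennreal_times_divide)
qed

lemma jac_id: "jac (\<lambda>x::'a::euclidean_space. x) = 1"
  using emeasure_unit_ball[where 'a='a] by (simp add: jac_def ennreal_divide_self less_top)

text \<open>The square of \<open>jac T\<close> is \<open>jac\<close> of the identity. Exchanges of
  coordinates are set up as involutions below, so that they preserve Lebesgue measure without any
  determinant being computed.\<close>

lemma jac_involution:
  fixes T :: "'a::euclidean_space \<Rightarrow> 'a"
  assumes T: "linear T" "\<And>x. T (T x) = x"
  shows "jac T = 1"
proof -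
  have "inj T" by (metis T(2) injI)
  then have 1: "jac T * jac T = 1" and fin: "jac T \<noteq> \<infinity>"
    using jac_compose[of T T] T jac_pos_finite[of T] by (simp_all add: jac_id)
  from fin obtain r where r: "jac T = ennreal r" "r \<ge> 0" by (cases "jac T") auto
  then have "r * r = 1" using 1 by (simp add: ennreal_mult'[symmetric])
  then have "r = 1" using r(2) by (metis abs_of_nonneg abs_1 power2_eq_square power2_eq_iff_nonneg one_power2 zero_le_one)
  then show ?thesis using r by simp
qed

lemma nn_integral_involution:
  fixes T :: "'a::euclidean_space \<Rightarrow> 'a" and f :: "'a \<Rightarrow> ennreal"
  assumes T: "linear T" "\<And>x. T (T x) = x" and [measurable]: "f \<in> borel_measurable borel"
  shows "(\<integral>\<^sup>+x. f x \<partial>lborel) = (\<integral>\<^sup>+x. f (T x) \<partial>lborel)"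
proof -
  have "inj T" by (metis T(2) injI)
  then show ?thesis using nn_integral_linear[of T f] jac_involution[OF T] T by simp
qed

section \<open>Matrices whose rows are points: measurability, Lebesgue measure, determinants\<close>

lemma measurable_vec_lambda [measurable (raw)]:
  fixes f :: "'n::finite \<Rightarrow> 'b \<Rightarrow> 'a::euclidean_space"
  assumes "\<And>i. f i \<in> borel_measurable M"
  shows "(\<lambda>x. \<chi> i. f i x) \<in> borel_measurable M"
  unfolding borel_measurable_euclidean_space[where f="\<lambda>x. \<chi> i. f i x"] Basis_vec_def
  using assms by (auto simp: inner_axis)

lemma measurable_vec_nth [measurable (raw)]:
  fixes f :: "'b \<Rightarrow> 'a::euclidean_space ^ 'n"
  assumes "f \<in> borel_measurable M"
  shows "(\<lambda>x. f x $ i) \<in> borel_measurable M"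
proof -
  have "(\<lambda>x::'a^'n. x $ i) \<in> borel_measurable borel"
    by (intro borel_measurable_continuous_onI continuous_intros)
  then show ?thesis using assms by (rule measurable_compose_rev)
qed

lemma measurable_det [measurable (raw)]:
  fixes f :: "'b \<Rightarrow> real ^ 'n ^ 'n"
  assumes [measurable]: "f \<in> borel_measurable M"
  shows "(\<lambda>x. det (f x)) \<in> borel_measurable M"
  unfolding det_def by measurable

lemma measurable_matrix_vector_mult [measurable (raw)]:
  fixes f :: "'b \<Rightarrow> real ^ 'n ^ 'm"
  assumes [measurable]: "f \<in> borel_measurable M" "g \<in> borel_measurable M"
  shows "(\<lambda>x. f x *v g x) \<in> borel_measurable M"
  unfolding matrix_vector_mult_def by measurable

lemma prod_Basis_vec:
  "(\<Prod>b\<in>Basis. f (b::'a::euclidean_space^'n)) = (\<Prod>i\<in>UNIV. \<Prod>u\<in>Basis. f (axis i u))"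
proof -
  have "(\<Prod>b\<in>Basis. f (b::'a^'n)) = prod f (\<Union>i\<in>UNIV. axis i ` Basis)"
    by (rule arg_cong[where f="prod f"]) (auto simp: Basis_vec_def)
  also have "\<dots> = (\<Prod>i\<in>UNIV. prod f (axis i ` Basis))"
    by (rule prod.UNION_disjoint) (auto simp: axis_eq_axis)
  also have "\<dots> = (\<Prod>i\<in>UNIV. \<Prod>u\<in>Basis. f (axis i u))"
    by (simp add: prod.reindex inj_on_def axis_eq_axis)
  finally show ?thesis .
qed

lemma mem_box_vec:
  "(X :: 'a::euclidean_space^'n) \<in> box l u \<longleftrightarrow> (\<forall>i. X $ i \<in> box (l $ i) (u $ i))"
  by (auto simp: mem_box Basis_vec_def inner_axis)

text \<open>The bridge from product measures, in which independent points live, to Lebesgue measure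
  on matrices, on which linear maps act.\<close>

lemma distr_PiM_lborel_vec:
  "distr (PiM UNIV (\<lambda>_::'n::finite. lborel)) borel vec_lambda = (lborel :: ('a::euclidean_space^'n) measure)"
proof (rule lborel_eqI[symmetric])
  fix l u :: "'a^'n" assume le: "\<And>b. b \<in> Basis \<Longrightarrow> l \<bullet> b \<le> u \<bullet> b"
  interpret finite_product_sigma_finite "\<lambda>_::'n. lborel :: 'a measure" UNIV
    by standard auto
  have vl: "vec_lambda -` box l u \<inter> space (PiM UNIV (\<lambda>_::'n. lborel)) = (\<Pi>\<^sub>E i\<in>UNIV. box (l $ i) (u $ i))"
    by (auto simp: mem_box_vec space_PiM PiE_iff)
  have [measurable]: "(\<lambda>x. \<chi> i. x i) \<in> borel_measurable (PiM UNIV (\<lambda>_::'n. lborel :: 'a measure))"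
    by measurable
  have l: "l $ i \<bullet> b \<le> u $ i \<bullet> b" if "b \<in> Basis" for i b
    using le[of "axis i b"] that by (simp add: inner_axis)
  show "emeasure (distr (PiM UNIV (\<lambda>_::'n. lborel)) borel vec_lambda) (box l u) = ennreal (\<Prod>b\<in>Basis. (u - l) \<bullet> b)"
    using l by (simp add: emeasure_distr vl measure_times emeasure_lborel_box_eq prod_Basis_vec inner_axis
        prod_ennreal[symmetric] prod_nonneg inner_diff_left)
qed simp

text \<open>Expansion along row \<open>k\<close>: the entries of the vector are the cofactors, which
  do not involve \<open>y\<close>.\<close>

lemma det_row_linear:
  fixes y :: "real^'n"
  shows "det (\<chi> i. if i = k then y else A i) = (\<chi> j. det (\<chi> i. if i = k then axis j 1 else A i)) \<bullet> y"
proof -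
  have "det (\<chi> i. if i = k then y else A i) = det (\<chi> i. if i = k then (\<Sum>j\<in>UNIV. y $ j *s axis j 1) else A i)"
    by (subst basis_expansion[of y]) simp
  also have "\<dots> = (\<Sum>j\<in>UNIV. y $ j * det (\<chi> i. if i = k then axis j 1 else A i))"
    by (subst det_linear_row_sum) (simp_all add: det_row_mul)
  finally show ?thesis by (simp add: inner_vec_def mult.commute)
qed

lemma det_eq_0_kernel:
  fixes A :: "real^'n^'n"
  shows "det A = 0 \<longleftrightarrow> (\<exists>z. z \<noteq> 0 \<and> (\<forall>i. A $ i \<bullet> z = 0))"
proof -
  have "A *v z = 0 \<longleftrightarrow> (\<forall>i. A $ i \<bullet> z = 0)" for z
    by (simp add: vec_eq_iff matrix_vector_mul_component)
  moreover have "det A = 0 \<longleftrightarrow> (\<exists>z. z \<noteq> 0 \<and> A *v z = 0)"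
    using invertible_det_nz[of A] matrix_left_invertible_ker[of A] invertible_left_inverse[of A] by metis
  ultimately show ?thesis by simp
qed

text \<open>The random rows are inserted one at a time. By expansion along the new row the
  determinant is \<open>v \<bullet> T y\<close>, and the cofactor vector \<open>v\<close> is
  non-zero because its inner product with the unit vector that stood there before is the previous
  determinant.\<close>

lemma AE_det_rows:
  fixes N :: "(real^'d) measure" and T :: "real^'d \<Rightarrow> real^'d"
  assumes N: "sigma_finite_measure N" and [measurable_cong]: "sets N = sets borel" and [measurable]: "T \<in> borel_measurable borel"
    and null: "\<And>v. v \<noteq> 0 \<Longrightarrow> AE x in N. v \<bullet> T x \<noteq> 0"
  shows "AE x in PiM UNIV (\<lambda>_::'d. N). det (\<chi> i. T (x i)) \<noteq> 0"
proof -
  interpret product_sigma_finite "\<lambda>_::'d. N" using N by (simp add: product_sigma_finite_def)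
  \<comment> \<open>Rows outside \<open>I\<close> are unit vectors, so the induction starts from the
    identity matrix.\<close>
  have "AE x in PiM I (\<lambda>_::'d. N). det (\<chi> i. if i \<in> I then T (x i) else axis i 1) \<noteq> 0" for I
    using finite[of I]
  proof (induction I rule: finite_induct)
    case empty
    have "(\<chi> i. axis i 1) = (mat 1 :: real^'d^'d)" by (simp add: mat_def axis_def vec_eq_iff)
    then show ?case by simp
  next
    case (insert j I)
    let ?D = "\<lambda>I x. det (\<chi> i. if i \<in> I then T (x i) else axis i 1)"
    have D [measurable]: "?D J \<in> borel_measurable (PiM J (\<lambda>_. N))" for J
    proof -
      have "(\<lambda>x. if i \<in> J then T (x i) else axis i 1) \<in> borel_measurable (PiM J (\<lambda>_. N))" for i
        by (cases "i \<in> J") simp_all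
      then show ?thesis by measurable
    qed
    let ?f = "\<lambda>x. indicator {0} (?D (insert j I) x) :: ennreal"
    have F: "?f \<in> borel_measurable (PiM (insert j I) (\<lambda>_. N))"
      by (rule measurable_compose[OF D[of "insert j I"]]) (simp add: borel_measurable_indicator)
    have "(\<integral>\<^sup>+y. ?f (x(j := y)) \<partial>N) = 0" if x: "?D I x \<noteq> 0" for x
    proof -
      define v where "v = (\<chi> k. det (\<chi> i. if i = j then axis k 1 else if i \<in> I then T (x i) else axis i 1) :: real^'d)"
      have eq: "det (\<chi> i. if i = j then y else if i \<in> I then T (x i) else axis i 1) = v \<bullet> y" for y
        unfolding v_def by (rule det_row_linear)
      have "(\<chi> i. if i \<in> I then T (x i) else axis i 1) = (\<chi> i. if i = j then axis j 1 else if i \<in> I then T (x i) else axis i 1)"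
        using insert.hyps by (auto simp: vec_eq_iff)
      then have "v \<noteq> 0" using x eq[of "axis j 1"] by auto
      have "?D (insert j I) (x(j := y)) = v \<bullet> T y" for y
      proof -
        have "(\<chi> i. if i \<in> insert j I then T ((x(j := y)) i) else axis i 1)
            = (\<chi> i. if i = j then T y else if i \<in> I then T (x i) else axis i 1)"
          by (auto simp: vec_eq_iff)
        then show ?thesis using eq by simp
      qed
      then have "(\<integral>\<^sup>+y. ?f (x(j := y)) \<partial>N) = (\<integral>\<^sup>+y. 0 \<partial>N)"
        using null[OF \<open>v \<noteq> 0\<close>] by (intro nn_integral_cong_AE) (auto simp: indicator_def elim: eventually_mono)
      then show ?thesis by simp
    qed
    then have "(\<integral>\<^sup>+x. (\<integral>\<^sup>+y. ?f (x(j := y)) \<partial>N) \<partial>PiM I (\<lambda>_. N)) = (\<integral>\<^sup>+x. 0 \<partial>PiM I (\<lambda>_. N))"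
      using insert.IH by (intro nn_integral_cong_AE) (auto elim: eventually_mono)
    then have "(\<integral>\<^sup>+x. ?f x \<partial>PiM (insert j I) (\<lambda>_. N)) = 0"
      using insert.hyps by (subst product_nn_integral_insert[OF _ _ F]) simp_all
    then have "AE x in PiM (insert j I) (\<lambda>_. N). ?f x = 0"
      by (subst (asm) nn_integral_0_iff_AE[OF F])
    then show ?case by (rule eventually_mono) (simp add: indicator_def split: if_splits)
  qed
  from this[of UNIV] show ?thesis by simp
qed

section \<open>The hyperplane through the rows of a matrix\<close>

text \<open>An arbitrary fixed index in two roles: as a row it selects the base point of a
  hyperplane, as a column it is the vertical direction.\<close>

definition piv :: "'d::finite" where "piv = (SOME i. True)"

text \<open>A normal vector of the hyperplane through the rows of \<open>X\<close>, as a generalised cross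
  product of their differences; it vanishes iff the rows are affinely dependent.\<close>

definition nu :: "real^'d^'d \<Rightarrow> real^'d" where
  "nu X = (\<chi> k. det (\<chi> i. if i = piv then axis k 1 else X $ i - X $ piv))"

definition side :: "real^'d^'d \<Rightarrow> real^'d \<Rightarrow> real" where
  "side X y = nu X \<bullet> (y - X $ piv)"

lemma det_nu: "det (\<chi> i. if i = piv then y else X $ i - X $ piv) = nu X \<bullet> y"
  unfolding nu_def by (rule det_row_linear)

lemma nu_orthogonal: "nu X \<bullet> (X $ i - X $ piv) = 0"
proof (cases "i = piv")
  case False
  let ?A = "\<chi> k. if k = piv then X $ i - X $ piv else X $ k - X $ piv"
  have "det ?A = 0"
    by (rule det_identical_rows[OF False]) (simp add: row_def vec_eq_iff)
  then show ?thesis by (simp add: det_nu)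
qed simp

lemma side_row [simp]: "side X (X $ i) = 0"
  by (simp add: side_def nu_orthogonal)

text \<open>The row differences together with \<open>nu X\<close> form a matrix of determinant
  \<open>nu X \<bullet> nu X\<close>, hence they span the space. The part of \<open>a\<close>
  orthogonal to \<open>nu X\<close> is orthogonal to all of them and must be 0.\<close>

lemma nu_parallel:
  assumes "nu X \<noteq> 0" "\<And>i. a \<bullet> (X $ i - X $ piv) = 0"
  shows "a = ((a \<bullet> nu X) / (nu X \<bullet> nu X)) *\<^sub>R nu X"
proof (rule ccontr)
  let ?z = "a - ((a \<bullet> nu X) / (nu X \<bullet> nu X)) *\<^sub>R nu X"
  assume "\<not> ?thesis"
  then have "?z \<noteq> 0" by simp
  moreover have "nu X \<bullet> ?z = 0" using assms(1) by (simp add: inner_diff_right inner_commute)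
  moreover have "(X $ i - X $ piv) \<bullet> ?z = 0" for i
  proof -
    have "(X $ i - X $ piv) \<bullet> a = 0" "(X $ i - X $ piv) \<bullet> nu X = 0"
      using assms(2)[of i] nu_orthogonal[of X i] by (metis inner_commute)+
    then show ?thesis by (simp add: inner_diff_right[of _ a])
  qed
  ultimately have "det (\<chi> i. if i = piv then nu X else X $ i - X $ piv) = 0"
    unfolding det_eq_0_kernel by (intro exI[of _ ?z] conjI allI) simp_all
  then show False using assms(1) by (simp add: det_nu)
qed

text \<open>When all cofactors vanish, the pivot row can be filled with any \<open>y\<close> and the
  matrix stays singular. The free \<open>y\<close> is chosen by each caller so that the kernel
  vector becomes contradictory.\<close>

lemma nu_eq_0_kernel:
  assumes "nu X = 0"
  shows "\<exists>z. z \<noteq> 0 \<and> y \<bullet> z = 0 \<and> (\<forall>i. (X $ i - X $ piv) \<bullet> z = 0)"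
proof -
  have "det (\<chi> i. if i = piv then y else X $ i - X $ piv) = 0" using assms by (simp add: det_nu)
  then obtain z where "z \<noteq> 0" and z: "\<And>i. (if i = piv then y else X $ i - X $ piv) \<bullet> z = 0"
    unfolding det_eq_0_kernel by auto
  moreover have "(X $ i - X $ piv) \<bullet> z = 0" for i
    using z[of i] by (cases "i = piv") auto
  moreover have "y \<bullet> z = 0" using z[of piv] by simp
  ultimately show ?thesis by blast
qed

lemma nu_nonzero_of_det: "det X \<noteq> 0 \<Longrightarrow> nu X \<noteq> 0"
proof
  assume "det X \<noteq> 0" "nu X = 0"
  then obtain z where z: "z \<noteq> 0" "X $ piv \<bullet> z = 0" "\<And>i. (X $ i - X $ piv) \<bullet> z = 0"
    using nu_eq_0_kernel by blast
  then have "X $ i \<bullet> z = 0" for i using z(3)[of i] by (simp add: inner_diff_left)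
  then show False using z(1) \<open>det X \<noteq> 0\<close> unfolding det_eq_0_kernel by blast
qed

lemma nu_inj: "nu X \<noteq> 0 \<Longrightarrow> inj (\<lambda>i. X $ i)"
proof (rule injI, rule ccontr)
  fix i j assume "nu X \<noteq> 0" "X $ i = X $ j" "i \<noteq> j"
  let ?A = "\<chi> k. if k = piv then nu X else X $ k - X $ piv"
  have A: "det ?A \<noteq> 0" using \<open>nu X \<noteq> 0\<close> by (simp add: det_nu)
  have "k \<noteq> piv" if "k \<in> {i, j}" for k
  proof
    assume "k = piv"
    define l where "l = (if k = i then j else i)"
    have "row l ?A = 0" using that \<open>k = piv\<close> \<open>X $ i = X $ j\<close> \<open>i \<noteq> j\<close>
      by (auto simp: row_def vec_eq_iff l_def)
    then show False using A det_zero_row(2)[of l ?A] by blast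
  qed
  then have "i \<noteq> piv" "j \<noteq> piv" by auto
  then have "row i ?A = row j ?A" using \<open>X $ i = X $ j\<close> by (simp add: row_def vec_eq_iff)
  then show False using det_identical_rows[OF \<open>i \<noteq> j\<close>] A by blast
qed

lemma measurable_nu [measurable]: "nu \<in> borel_measurable borel"
proof -
  have "(\<lambda>X. if i = piv then axis k 1 else X $ i - X $ piv) \<in> borel_measurable (borel :: (real^'d::finite^'d) measure)" for i k :: "'d::finite"
    by (cases "i = piv") simp_all
  then show ?thesis unfolding nu_def by measurable
qed

lemma measurable_side [measurable (raw)]:
  assumes [measurable]: "f \<in> borel_measurable M" "g \<in> borel_measurable M"
  shows "(\<lambda>x. side (f x) (g x)) \<in> borel_measurable M"
  unfolding side_def by measurable

lemma continuous_nu: "continuous_on UNIV nu"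
proof -
  have "continuous_on UNIV (\<lambda>X::real^'d::finite^'d. if i = piv then axis k 1 else X $ i - X $ piv)" for i k :: "'d::finite"
    by (cases "i = piv") (auto intro!: continuous_intros)
  then show ?thesis unfolding nu_def det_def by (intro continuous_intros)
qed

section \<open>Splitting off the height of points, with the old height kept as a dummy\<close>

text \<open>A vector is read as a point of the coordinate hyperplane together with a height. Once
  the height is overwritten by \<open>t\<close>, the entry \<open>x $ piv\<close> carries no
  information.\<close>

definition rep :: "real \<Rightarrow> real^'d \<Rightarrow> real^'d" where
  "rep t x = (\<chi> j. if j = piv then t else x $ j)"

definition repc :: "real^'d^'d \<Rightarrow> real^'d \<Rightarrow> real^'d^'d" where
  "repc X v = (\<chi> i. rep (v $ i) (X $ i))"

definition maprows :: "(real^'d \<Rightarrow> real^'d) \<Rightarrow> real^'d^'d \<Rightarrow> real^'d^'d" where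
  "maprows f X = (\<chi> i. f (X $ i))"

lemma rep_nth: "rep t x $ j = (if j = piv then t else x $ j)" by (simp add: rep_def)
lemma rep_rep [simp]: "rep t (rep s x) = rep t x" by (simp add: rep_def vec_eq_iff)
lemma rep_self [simp]: "rep (x $ piv) x = x" by (simp add: rep_def vec_eq_iff)
lemma rep_split: "rep t x = rep 0 x + t *\<^sub>R axis piv 1" by (simp add: rep_def vec_eq_iff axis_def)

lemma inner_rep: "rep s x \<bullet> rep t y = rep 0 x \<bullet> y + s * t"
proof -
  have "rep 0 x \<bullet> y = (\<Sum>j\<in>UNIV. if j = piv then 0 else x $ j * y $ j)"
    unfolding inner_vec_def by (rule sum.cong) (auto simp: rep_nth)
  moreover have "rep s x \<bullet> rep t y = (\<Sum>j\<in>UNIV. (if j = piv then s * t else 0) + (if j = piv then 0 else x $ j * y $ j))"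
    unfolding inner_vec_def by (rule sum.cong) (auto simp: rep_nth)
  ultimately show ?thesis by (simp add: sum.distrib)
qed

lemma inner_rep': "rep s x \<bullet> y = rep 0 x \<bullet> y + s * y $ piv"
  using inner_rep[of s x "y $ piv" y] by simp

lemma norm_rep: "(norm (rep t x))\<^sup>2 = (norm (rep 0 x))\<^sup>2 + t\<^sup>2"
  unfolding power2_norm_eq_inner using inner_rep[of t x t x] inner_rep[of 0 x 0 x] by (simp add: power2_eq_square)

lemma linear_rep0: "linear (rep 0)"
  by (rule linearI) (auto simp: rep_def vec_eq_iff)

lemma measurable_rep [measurable (raw)]:
  assumes [measurable]: "f \<in> borel_measurable M" "g \<in> borel_measurable M"
  shows "(\<lambda>x. rep (f x) (g x)) \<in> borel_measurable M"
proof -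
  have "(\<lambda>x. if j = piv then f x else g x $ j) \<in> borel_measurable M" for j
    by (cases "j = piv") simp_all
  then show ?thesis unfolding rep_def by measurable
qed

lemma measurable_repc [measurable (raw)]:
  assumes [measurable]: "f \<in> borel_measurable M" "g \<in> borel_measurable M"
  shows "(\<lambda>x. repc (f x) (g x)) \<in> borel_measurable M"
  unfolding repc_def by measurable

lemma measurable_indicator_compose [measurable (raw)]:
  assumes [measurable]: "f \<in> borel_measurable M" "A \<in> sets borel"
  shows "(\<lambda>x. indicator A (f x) :: ennreal) \<in> borel_measurable M"
  by (rule measurable_compose[OF assms(1)]) (simp add: borel_measurable_indicator)

lemma measurable_jac_matrix [measurable (raw)]:
  fixes f :: "'b \<Rightarrow> real^'d^'d"
  assumes [measurable]: "f \<in> borel_measurable M"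
  shows "(\<lambda>x. jac ((*v) (f x))) \<in> borel_measurable M"
  unfolding jac_def by measurable

text \<open>Exchanging \<open>t\<close> with the pivot entry is a linear involution on pairs, so the
  pivot coordinate can be integrated separately. The leftover entry ranges over [0,1], an interval
  of length 1, and therefore contributes no factor.\<close>

lemma nn_integral_rep:
  fixes F :: "real^'d \<Rightarrow> ennreal"
  assumes [measurable]: "F \<in> borel_measurable borel"
  shows "(\<integral>\<^sup>+x. F x \<partial>lborel) = (\<integral>\<^sup>+x. indicator {0..1} (x $ piv) * (\<integral>\<^sup>+t. F (rep t x) \<partial>lborel) \<partial>lborel)"
proof -
  let ?T = "\<lambda>(x::real^'d, t). (rep t x, x $ piv)"
  let ?f = "\<lambda>(x, t). F x * indicator {0..1::real} t"
  have [measurable]: "?f \<in> borel_measurable borel" "(\<lambda>y. ?f (?T y)) \<in> borel_measurable borel"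
    unfolding borel_prod[symmetric] by measurable
  have "linear ?T" by (rule linearI) (auto simp: rep_def vec_eq_iff)
  moreover have "?T (?T y) = y" for y by (cases y) (simp add: rep_nth)
  ultimately have "(\<integral>\<^sup>+y. ?f y \<partial>lborel) = (\<integral>\<^sup>+y. ?f (?T y) \<partial>lborel)"
    by (rule nn_integral_involution) simp
  then show ?thesis
    by (simp add: lborel_prod[symmetric] lborel.nn_integral_fst[symmetric] nn_integral_cmult nn_integral_multc mult.commute)
qed

text \<open>Confines the dummy column to the unit cube, which has volume 1.\<close>

abbreviation window :: "real^'d^'d \<Rightarrow> ennreal" where
  "window X \<equiv> indicator (cbox 0 (\<chi> i. 1)) (\<chi> i. X $ i $ piv)"

lemma nn_integral_repc:
  fixes F :: "real^'d^'d \<Rightarrow> ennreal"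
  assumes [measurable]: "F \<in> borel_measurable borel"
  shows "(\<integral>\<^sup>+X. F X \<partial>lborel) = (\<integral>\<^sup>+X. window X * (\<integral>\<^sup>+c. F (repc X c) \<partial>lborel) \<partial>lborel)"
proof -
  let ?T = "\<lambda>(X::real^'d^'d, c). (repc X c, \<chi> i. X $ i $ piv)"
  let ?f = "\<lambda>(X, c). F X * indicator (cbox 0 (\<chi> i. 1) :: (real^'d) set) c"
  have [measurable]: "?f \<in> borel_measurable borel" "(\<lambda>y. ?f (?T y)) \<in> borel_measurable borel"
    unfolding borel_prod[symmetric] by measurable
  have "linear ?T" by (rule linearI) (auto simp: repc_def rep_def vec_eq_iff)
  moreover have "?T (?T y) = y" for y by (cases y) (simp add: repc_def rep_def vec_eq_iff)
  ultimately have "(\<integral>\<^sup>+y. ?f y \<partial>lborel) = (\<integral>\<^sup>+y. ?f (?T y) \<partial>lborel)"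
    by (rule nn_integral_involution) simp
  moreover have "emeasure lborel (cbox 0 (\<chi> i. 1) :: (real^'d) set) = 1"
  proof -
    have "emeasure lborel (cbox 0 (\<chi> i. 1) :: (real^'d) set) = (\<Prod>b\<in>Basis. ((\<chi> i. 1) - 0::real^'d) \<bullet> b)"
      by (rule emeasure_lborel_cbox) (auto simp: Basis_vec_def inner_axis)
    then show ?thesis by (simp add: prod_Basis_vec inner_axis)
  qed
  ultimately show ?thesis
    by (simp add: lborel_prod[symmetric] lborel.nn_integral_fst[symmetric] nn_integral_cmult nn_integral_multc mult.commute)
qed

lemma null_hyperplane:
  fixes v :: "'a::euclidean_space"
  assumes "v \<noteq> 0" shows "AE x in lborel. v \<bullet> x \<noteq> c"
proof -
  have "closed {x. v \<bullet> x = c}" by (rule closed_hyperplane)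
  moreover have "{x. v \<bullet> x = c} \<in> null_sets lebesgue"
    using negligible_hyperplane[of v c] assms by (simp add: negligible_iff_null_sets)
  ultimately have "{x. v \<bullet> x = c} \<in> null_sets lborel"
    by (simp add: null_sets_completion_iff borel_closed)
  from AE_not_in[OF this] show ?thesis by simp
qed

text \<open>Rows of the form (horizontal part, 1). So \<open>colone X *v a\<close> lists the values
  at the rows of the affine function with slope \<open>rep 0 a\<close> and constant
  \<open>a $ piv\<close>, and the determinant is, up to sign, (d-1)! times the volume of the simplex
  spanned by the horizontal projections of the rows.\<close>

abbreviation colone :: "real^'d^'d \<Rightarrow> real^'d^'d" where
  "colone X \<equiv> repc X (\<chi> i. 1)"

lemma AE_colone: "AE X in lborel. det (colone X :: real^'d^'d) \<noteq> 0"
proof -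
  have "AE x in PiM UNIV (\<lambda>_::'d. lborel). det (\<chi> i. rep 1 (x i :: real^'d)) \<noteq> 0"
  proof (rule AE_det_rows)
    fix v :: "real^'d" assume "v \<noteq> 0"
    have eq: "v \<bullet> rep 1 x = rep 0 v \<bullet> x + v $ piv" for x
      using inner_rep[of "v $ piv" v 1 x] by simp
    show "AE x in lborel. v \<bullet> rep 1 x \<noteq> 0"
    \<comment> \<open>For vertical \<open>v\<close> the inner product is the non-zero constant
      \<open>v $ piv\<close>; otherwise it vanishes only on a hyperplane.\<close>
    proof (cases "rep 0 v = 0")
      case True
      then have "v $ piv \<noteq> 0" using \<open>v \<noteq> 0\<close> rep_split[of "v $ piv" v] by auto
      then show ?thesis by (simp add: eq True)
    next
      case False
      show ?thesis using null_hyperplane[OF False, of "- v $ piv"]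
        by (rule eventually_mono) (simp add: eq)
    qed
  qed (simp_all add: lborel.sigma_finite_measure_axioms)
  moreover have "{X \<in> space borel. det (colone X :: real^'d^'d) \<noteq> 0} \<in> sets borel"
    by measurable
  ultimately show ?thesis
    by (subst distr_PiM_lborel_vec[symmetric], subst AE_distr_iff) (simp_all add: repc_def)
qed

lemma linear_mv: "linear ((*v) (A::real^'n^'m))" by (rule matrix_vector_mul_linear)

lemma inj_mv: "det (A::real^'n^'n) \<noteq> 0 \<Longrightarrow> inj ((*v) A)"
  using invertible_det_nz inj_matrix_vector_mult by blast

section \<open>The affine Blaschke-Petkantschin formula\<close>

text \<open>Integral over the d-tuples on the graph hyperplane with parameter \<open>a\<close>. The
  factor \<open>jac\<close> is the Jacobian of the d heights as functions of the d
  parameters.\<close>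

definition chart_integral :: "(real^'d^'d \<Rightarrow> ennreal) \<Rightarrow> real^'d \<Rightarrow> ennreal" where
  "chart_integral \<Phi> a = (\<integral>\<^sup>+X. window X * jac ((*v) (colone X)) * \<Phi> (repc X (colone X *v a)) \<partial>lborel)"

text \<open>The horizontal hyperplane at height \<open>h\<close>: the chart integral at slope 0 and
  constant \<open>h\<close>, since \<open>colone X\<close> then returns \<open>h\<close> in every
  entry.\<close>

definition slice_integral :: "(real^'d^'d \<Rightarrow> ennreal) \<Rightarrow> real \<Rightarrow> ennreal" where
  "slice_integral \<Phi> h = (\<integral>\<^sup>+X. window X * jac ((*v) (colone X)) * \<Phi> (repc X (\<chi> i. h)) \<partial>lborel)"

lemma measurable_chart_integral [measurable]:
  assumes [measurable]: "\<Phi> \<in> borel_measurable borel"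
  shows "chart_integral \<Phi> \<in> borel_measurable borel"
  unfolding chart_integral_def by measurable

lemma measurable_slice_integral [measurable]:
  assumes [measurable]: "\<Phi> \<in> borel_measurable borel"
  shows "slice_integral \<Phi> \<in> borel_measurable borel"
  unfolding slice_integral_def by measurable

text \<open>Hyperplanes that are graphs over the coordinate hyperplane orthogonal to \<open>axis piv 1\<close> are
  parametrised by \<open>a\<close>; for fixed other columns the pivot column of \<open>X\<close> depends linearly on \<open>a\<close>.\<close>

lemma nn_integral_chart:
  fixes \<Phi> :: "real^'d^'d \<Rightarrow> ennreal"
  assumes [measurable]: "\<Phi> \<in> borel_measurable borel"
  shows "(\<integral>\<^sup>+X. \<Phi> X \<partial>lborel) = (\<integral>\<^sup>+a. chart_integral \<Phi> a \<partial>lborel)"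
proof -
  have "(\<integral>\<^sup>+X. \<Phi> X \<partial>lborel) = (\<integral>\<^sup>+X. window X * (\<integral>\<^sup>+c. \<Phi> (repc X c) \<partial>lborel) \<partial>lborel)"
    by (rule nn_integral_repc) simp
  also have "\<dots> = (\<integral>\<^sup>+X. window X * (jac ((*v) (colone X)) * (\<integral>\<^sup>+a. \<Phi> (repc X (colone X *v a)) \<partial>lborel)) \<partial>lborel)"
  proof (rule nn_integral_cong_AE, rule eventually_mono[OF AE_colone])
    fix X :: "real^'d^'d" assume "det (colone X) \<noteq> 0"
    then show "window X * (\<integral>\<^sup>+c. \<Phi> (repc X c) \<partial>lborel) =
        window X * (jac ((*v) (colone X)) * (\<integral>\<^sup>+a. \<Phi> (repc X (colone X *v a)) \<partial>lborel))"
      using nn_integral_linear[OF linear_mv inj_mv, of "colone X" "\<lambda>c. \<Phi> (repc X c)"] by simp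
  qed
  also have "\<dots> = (\<integral>\<^sup>+X. (\<integral>\<^sup>+a. window X * jac ((*v) (colone X)) * \<Phi> (repc X (colone X *v a)) \<partial>lborel) \<partial>lborel)"
    by (simp add: nn_integral_cmult mult.assoc)
  also have "\<dots> = (\<integral>\<^sup>+a. (\<integral>\<^sup>+X. window X * jac ((*v) (colone X)) * \<Phi> (repc X (colone X *v a)) \<partial>lborel) \<partial>lborel)"
    by (rule lborel_pair.Fubini') measurable
  finally show ?thesis by (simp add: chart_integral_def)
qed

text \<open>The shear is the product of two involutions, the reflection \<open>?D\<close> of the
  pivot coordinate and \<open>?D\<close> followed by the shear term.\<close>

lemma jac_shear:
  fixes m :: "real^'d"
  assumes "m $ piv = 0"
  shows "jac (\<lambda>y. y + (h * (m \<bullet> y)) *\<^sub>R axis piv 1) = 1"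
proof -
  let ?e = "axis piv 1 :: real^'d"
  let ?D = "\<lambda>y. y - (2 * y $ piv) *\<^sub>R ?e"
  let ?E = "\<lambda>y. ?D y + (h * (m \<bullet> y)) *\<^sub>R ?e"
  have me: "m \<bullet> ?e = 0" using assms by (simp add: inner_axis)
  have lin: "linear ?D" "linear ?E"
    by (rule linearI; simp add: algebra_simps inner_add_right)+
  have D: "?D (?D y) = y" for y by (simp add: algebra_simps)
  have E: "?E (?E y) = y" for y
    unfolding vec_eq_iff by (simp add: inner_add_right inner_diff_right me) (simp add: axis_def algebra_simps)
  have "inj ?D" by (metis (no_types, lifting) D injI)
  have "(\<lambda>y. y + (h * (m \<bullet> y)) *\<^sub>R ?e) = (\<lambda>y. ?E (?D y))"
    by (rule ext) (simp add: algebra_simps inner_diff_right me)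
  then show ?thesis
    using jac_compose[OF lin(2) lin(1) \<open>inj ?D\<close>] jac_involution[OF lin(1) D] jac_involution[OF lin(2) E] by simp
qed

definition rotation_invariant :: "(real^'d^'d \<Rightarrow> 'b) \<Rightarrow> bool" where
  "rotation_invariant \<Phi> \<longleftrightarrow> (\<forall>R X. orthogonal_transformation R \<longrightarrow> \<Phi> (maprows R X) = \<Phi> X)"

text \<open>A rotation takes the hyperplane with parameter \<open>a\<close> to a hyperplane orthogonal to
  \<open>axis piv 1\<close>; the Jacobian \<open>w\<close> does not depend on the offset \<open>b\<close>.\<close>

lemma chart_integral_eq_slice_integral:
  fixes a :: "real^'d"
  shows "\<exists>w N. 0 < N \<and> w \<noteq> 0 \<and> (\<forall>b \<Phi>. \<Phi> \<in> borel_measurable borel \<longrightarrow> rotation_invariant \<Phi> \<longrightarrow>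
    chart_integral \<Phi> (rep b a) = w * slice_integral \<Phi> (b / N))"
proof -
  let ?e = "axis piv 1 :: real^'d"
  \<comment> \<open>The hyperplane with slope \<open>a\<close> and constant b is the set of y with
    \<open>y $ piv - rep 0 a \<bullet> y = b\<close>. Its normal \<open>rep 1 (-a)\<close> has
    length \<open>N\<close>, so b / N is its signed distance from the origin.\<close>
  define N where "N = norm (rep 1 (-a))"
  have N2: "N\<^sup>2 = (norm (rep 0 a))\<^sup>2 + 1"
    using norm_rep[of 1 "-a"] linear_neg[OF linear_rep0, of a] by (simp add: N_def)
  then have N: "N > 0" by (metis N_def add_nonneg_eq_0_iff norm_ge_zero one_neq_zero order_le_less power_zero_numeral zero_le_power2 zero_le_one)
  define u where "u = (1/N) *\<^sub>R rep 1 (-a)"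
  have "norm u = 1" using N by (simp add: u_def N_def)
  then obtain R where R: "orthogonal_transformation R" "R ?e = u"
    using orthogonal_transformation_exists[of ?e u] by auto
  have linR: "linear R" using R(1) by (simp add: orthogonal_transformation_def)
  have u_inner: "N * (u \<bullet> y) = y $ piv - rep 0 a \<bullet> y" for y
    using N inner_rep'[of 1 "-a" y] linear_neg[OF linear_rep0, of a] by (simp add: u_def)
  have uR: "u \<bullet> R y = y $ piv" for y
    using R by (metis cart_eq_inner_axis inner_commute orthogonal_transformation_def)
  have upiv: "u $ piv = 1/N" by (simp add: u_def rep_nth)
  \<comment> \<open>Rotate the horizontal part of z, then project along the vertical direction. The
    dummy entry of z is carried along so that \<open>B\<close> can be an invertible map of the full
    space. Raising z to height h shifts the projection by h times the horizontal part
    \<open>m\<close> of the normal.\<close>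
  define B where "B z = rep (z $ piv) (R (rep 0 z))" for z
  define m where "m = rep 0 u"
  have mpiv: "m $ piv = 0" by (simp add: m_def rep_nth)
  have linB: "linear B"
    unfolding B_def
    by (rule linearI) (simp_all add: linear_add[OF linear_rep0] linear_scale[OF linear_rep0]
        linear_add[OF linR] linear_scale[OF linR], auto simp: rep_def vec_eq_iff)
  have Bpiv: "B z $ piv = z $ piv" for z by (simp add: B_def rep_nth)
  have row: "B z + h *\<^sub>R m = rep (z $ piv) (R (rep h z))" for z h
    unfolding rep_split[of h z] linear_add[OF linR] linear_scale[OF linR] R(2)
    by (auto simp: B_def m_def rep_def vec_eq_iff)
  have injB: "inj B"
  proof (subst linear_injective_0[OF linB], intro allI impI)
    fix z assume "B z = 0"
    then have z0: "z $ piv = 0" using Bpiv[of z] by simp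
    then have "rep 0 z = z" using rep_self[of z] by simp
    have off: "R z $ j = 0" if "j \<noteq> piv" for j
    proof -
      have "B z $ j = R z $ j" using that by (simp add: B_def rep_nth \<open>rep 0 z = z\<close>)
      then show ?thesis using \<open>B z = 0\<close> by simp
    qed
    define t where "t = R z $ piv"
    have Rz: "R z = t *\<^sub>R ?e" using off by (auto simp: vec_eq_iff axis_def t_def)
    \<comment> \<open>A vertical vector \<open>R z\<close> orthogonal to \<open>u\<close> must be 0,
      because \<open>u\<close> has the non-zero pivot entry 1/N: the hyperplane is a graph.\<close>
    have "u \<bullet> R z = 0" using uR z0 by simp
    then have "t = 0" using N by (simp add: Rz inner_axis upiv)
    then have "norm z = 0" using Rz orthogonal_transformation_norm[OF R(1), of z] by simp
    then show "z = 0" by simp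
  qed
  have surjB: "surj B" using linB injB linear_injective_imp_surjective by blast
  let ?L = "maprows B"
  have linL: "linear ?L"
    by (rule linearI) (simp_all add: maprows_def vec_eq_iff linear_add[OF linB] linear_scale[OF linB])
  have injL: "inj ?L"
  proof (rule injI)
    fix X Y assume "?L X = ?L Y"
    then have "?L X $ i = ?L Y $ i" for i by simp
    then have "X $ i = Y $ i" for i using injB by (simp add: maprows_def inj_eq)
    then show "X = Y" by (simp add: vec_eq_iff)
  qed
  have linA: "linear (adjoint B)" by (rule adjoint_linear[OF linB])
  have injA: "inj (adjoint B)"
  proof (subst linear_injective_0[OF linA], intro allI impI)
    fix y assume "adjoint B y = 0"
    then have "B z \<bullet> y = 0" for z using adjoint_works[OF linB, of z y] by simp
    then have "y \<bullet> y = 0" using surjB by (metis surjD)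
    then show "y = 0" by simp
  qed
  have "chart_integral \<Phi> (rep b a) = jac ?L * jac (adjoint B) * slice_integral \<Phi> (b / N)"
    if [measurable]: "\<Phi> \<in> borel_measurable borel" and inv: "rotation_invariant \<Phi>" for b \<Phi>
  proof -
    define h where "h = b / N"
    define S where "S y = y + (h * (m \<bullet> y)) *\<^sub>R ?e" for y
    have jacS: "jac S = 1" unfolding S_def[abs_def] by (rule jac_shear[OF mpiv])
    have linS: "linear S"
      unfolding S_def[abs_def] by (rule linearI) (simp_all add: algebra_simps inner_add_right)
    have injS: "inj S"
    proof (subst linear_injective_0[OF linS], intro allI impI)
      fix y assume "S y = 0"
      then have "m \<bullet> S y = 0" by simp
      then have "m \<bullet> y = 0" using mpiv by (simp add: S_def inner_add_right inner_axis)
      then show "y = 0" using \<open>S y = 0\<close> by (simp add: S_def)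
    qed
    let ?Q = "\<lambda>Z. ?L Z + (\<chi> i. h *\<^sub>R m)"
    have rowQ: "?Q Z $ i = rep (Z $ i $ piv) (R (rep h (Z $ i)))" for Z i
      by (simp add: maprows_def row)
    have colQ: "(\<chi> i. ?Q Z $ i $ piv) = (\<chi> i. Z $ i $ piv)" for Z
      by (simp only: rowQ) (simp add: rep_nth)
    \<comment> \<open>Moving the points by \<open>?Q\<close> multiplies \<open>colone Z\<close> on
      the right by a matrix independent of Z. The offset enters only through the shear
      \<open>S\<close>, of Jacobian 1, which is why the final factor does not depend on b.\<close>
    have mv: "colone (?Q Z) *v y = colone Z *v adjoint B (S y)" for Z y
    proof -
      have "rep 1 (?Q Z $ i) \<bullet> y = rep 1 (Z $ i) \<bullet> adjoint B (S y)" for i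
      proof -
        let ?z = "rep 1 (Z $ i)"
        have "rep 1 (?Q Z $ i) = B ?z + h *\<^sub>R m"
          unfolding rowQ row by (simp add: rep_nth)
        then have "rep 1 (?Q Z $ i) \<bullet> y = B ?z \<bullet> y + h * (m \<bullet> y)" by (simp add: inner_add_left)
        also have "\<dots> = B ?z \<bullet> S y"
          using Bpiv[of ?z] by (simp add: S_def inner_add_right inner_axis rep_nth)
        also have "\<dots> = ?z \<bullet> adjoint B (S y)" by (simp add: adjoint_works[OF linB])
        finally show ?thesis .
      qed
      then show ?thesis by (simp add: vec_eq_iff matrix_vector_mul_component repc_def)
    qed
    have jac_eq: "jac ((*v) (colone (?Q Z))) = jac (adjoint B) * jac ((*v) (colone Z))" for Z
    proof -
      have "jac ((*v) (colone (?Q Z))) = jac (\<lambda>y. colone Z *v (adjoint B (S y)))"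
        by (rule arg_cong[where f=jac]) (rule ext, rule mv)
      also have "\<dots> = jac (\<lambda>y. colone Z *v adjoint B y) * jac S"
        by (rule jac_compose[OF _ linS injS]) (rule linear_compose[OF linA linear_mv, unfolded o_def])
      also have "jac (\<lambda>y. colone Z *v adjoint B y) = jac ((*v) (colone Z)) * jac (adjoint B)"
        by (rule jac_compose[OF linear_mv linA injA])
      finally show ?thesis by (simp add: jacS mult.commute)
    qed
    \<comment> \<open>\<open>?Q Z\<close> consists of the projections of the rotated points, and the
      affine function with parameter \<open>rep b a\<close> restores their heights. What remains is
      a rotated copy of a configuration at height h.\<close>
    have Phi_eq: "\<Phi> (repc (?Q Z) (colone (?Q Z) *v rep b a)) = \<Phi> (repc Z (\<chi> i. h))" for Z
    proof -
      have "repc (?Q Z) (colone (?Q Z) *v rep b a) = maprows R (repc Z (\<chi> i. h))"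
      proof -
        have "rep (rep 1 (?Q Z $ i) \<bullet> rep b a) (?Q Z $ i) = R (rep h (Z $ i))" for i
        proof -
          let ?y = "R (rep h (Z $ i))"
          have "N * (u \<bullet> ?y) = b" using N by (simp add: uR rep_nth h_def)
          then have "?y $ piv = rep 0 ?y \<bullet> a + b"
            using inner_rep[of 0 ?y 0 a] inner_rep[of 0 a 0 ?y] u_inner[of ?y] inner_commute[of "rep 0 a" "rep 0 ?y"]
            by simp
          moreover have "rep 1 (?Q Z $ i) \<bullet> rep b a = rep 0 ?y \<bullet> a + b"
            unfolding rowQ by (simp add: inner_rep)
          ultimately show ?thesis unfolding rowQ by (metis rep_rep rep_self)
        qed
        then show ?thesis by (simp add: vec_eq_iff matrix_vector_mul_component repc_def maprows_def)
      qed
      then show ?thesis using inv R(1) by (simp add: rotation_invariant_def)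
    qed
    have [measurable]: "?Q \<in> borel_measurable borel"
      using borel_measurable_linear[OF linL] by measurable
    have "chart_integral \<Phi> (rep b a) = jac ?L * (\<integral>\<^sup>+Z. window (?Q Z) * jac ((*v) (colone (?Q Z))) * \<Phi> (repc (?Q Z) (colone (?Q Z) *v rep b a)) \<partial>lborel)"
      unfolding chart_integral_def
      by (rule nn_integral_affine[OF linL injL]) measurable
    also have "\<dots> = jac ?L * (\<integral>\<^sup>+Z. window Z * (jac (adjoint B) * jac ((*v) (colone Z))) * \<Phi> (repc Z (\<chi> i. h)) \<partial>lborel)"
      unfolding colQ jac_eq Phi_eq ..
    also have "\<dots> = jac ?L * (\<integral>\<^sup>+Z. jac (adjoint B) * (window Z * jac ((*v) (colone Z)) * \<Phi> (repc Z (\<chi> i. h))) \<partial>lborel)"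
      by (simp add: mult_ac)
    also have "\<dots> = jac ?L * jac (adjoint B) * slice_integral \<Phi> h"
      by (subst nn_integral_cmult) (simp_all add: slice_integral_def mult.assoc)
    finally show ?thesis by (simp add: h_def)
  qed
  moreover have "jac ?L * jac (adjoint B) \<noteq> 0"
    using jac_pos_finite[OF linL injL] jac_pos_finite[OF linA injA] by simp
  ultimately show ?thesis using N by blast
qed

text \<open>Substituting b = N h, the slope \<open>a\<close> survives only in the factor w.
  Cross-multiplication rests on w being the same for all integrands.\<close>

lemma nn_integral_chart_slice:
  fixes a :: "real^'d"
  shows "\<exists>w. w \<noteq> 0 \<and> (\<forall>\<Phi>. \<Phi> \<in> borel_measurable borel \<longrightarrow> rotation_invariant \<Phi> \<longrightarrow>
    (\<integral>\<^sup>+b. chart_integral \<Phi> (rep b a) \<partial>lborel) = w * (\<integral>\<^sup>+h. slice_integral \<Phi> h \<partial>lborel))"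
proof -
  obtain w N where N: "0 < N" "w \<noteq> 0" and w: "\<And>b \<Theta>. \<Theta> \<in> borel_measurable borel \<Longrightarrow> rotation_invariant \<Theta> \<Longrightarrow>
      chart_integral \<Theta> (rep b a) = w * slice_integral \<Theta> (b / N)"
    using chart_integral_eq_slice_integral[of a] by blast
  have "(\<integral>\<^sup>+b. chart_integral \<Theta> (rep b a) \<partial>lborel) = ennreal N * w * (\<integral>\<^sup>+h. slice_integral \<Theta> h \<partial>lborel)"
    if [measurable]: "\<Theta> \<in> borel_measurable borel" and i: "rotation_invariant \<Theta>" for \<Theta>
  proof -
    have "(\<integral>\<^sup>+b. chart_integral \<Theta> (rep b a) \<partial>lborel) = w * (\<integral>\<^sup>+b. slice_integral \<Theta> (b / N) \<partial>lborel)"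
      by (simp add: w i nn_integral_cmult)
    also have "(\<integral>\<^sup>+b. slice_integral \<Theta> (b / N) \<partial>lborel) = ennreal \<bar>N\<bar> * (\<integral>\<^sup>+h. slice_integral \<Theta> h \<partial>lborel)"
      using N by (subst nn_integral_real_affine[where c=N and t=0]) simp_all
    finally show ?thesis using N by (simp add: mult_ac)
  qed
  then show ?thesis using N by (intro exI[of _ "ennreal N * w"]) simp
qed

lemma nn_integral_chart_window:
  fixes \<Phi> :: "real^'d^'d \<Rightarrow> ennreal"
  assumes [measurable]: "\<Phi> \<in> borel_measurable borel"
  shows "(\<integral>\<^sup>+X. \<Phi> X \<partial>lborel) = (\<integral>\<^sup>+a. indicator {0..1} (a $ piv) * (\<integral>\<^sup>+b. chart_integral \<Phi> (rep b a) \<partial>lborel) \<partial>lborel)"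
  by (subst nn_integral_chart, simp, rule nn_integral_rep) measurable

text \<open>The affine Blaschke-Petkantschin formula for rotation invariant integrands; the constant,
  an integral over all directions, is eliminated by cross-multiplication.\<close>

theorem blaschke_petkantschin_cross:
  fixes \<Phi> \<Psi> :: "real^'d^'d \<Rightarrow> ennreal"
  assumes [measurable]: "\<Phi> \<in> borel_measurable borel" "\<Psi> \<in> borel_measurable borel"
    and inv: "rotation_invariant \<Phi>" "rotation_invariant \<Psi>"
  shows "(\<integral>\<^sup>+h. slice_integral \<Phi> h \<partial>lborel) * (\<integral>\<^sup>+X. \<Psi> X \<partial>lborel) =
    (\<integral>\<^sup>+h. slice_integral \<Psi> h \<partial>lborel) * (\<integral>\<^sup>+X. \<Phi> X \<partial>lborel)"
proof -
  note * = nn_integral_chart_window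
  have **: "(\<integral>\<^sup>+h. slice_integral \<Phi> h \<partial>lborel) * (\<integral>\<^sup>+b. chart_integral \<Psi> (rep b a) \<partial>lborel) =
    (\<integral>\<^sup>+h. slice_integral \<Psi> h \<partial>lborel) * (\<integral>\<^sup>+b. chart_integral \<Phi> (rep b a) \<partial>lborel)" for a
    using nn_integral_chart_slice[of a] inv assms by (auto simp: mult_ac)
  have "(\<integral>\<^sup>+h. slice_integral \<Phi> h \<partial>lborel) * (\<integral>\<^sup>+X. \<Psi> X \<partial>lborel)
      = (\<integral>\<^sup>+a. indicator {0..1} (a $ piv) * ((\<integral>\<^sup>+h. slice_integral \<Phi> h \<partial>lborel) * (\<integral>\<^sup>+b. chart_integral \<Psi> (rep b a) \<partial>lborel)) \<partial>(lborel :: (real^'d) measure))"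
    by (subst *[of \<Psi>], simp, subst nn_integral_cmult[symmetric]) (simp_all add: mult_ac)
  also have "\<dots> = (\<integral>\<^sup>+a. (\<integral>\<^sup>+h. slice_integral \<Psi> h \<partial>lborel) * (indicator {0..1} (a $ piv) * (\<integral>\<^sup>+b. chart_integral \<Phi> (rep b a) \<partial>lborel)) \<partial>(lborel :: (real^'d) measure))"
    unfolding ** by (simp add: mult_ac)
  also have "\<dots> = (\<integral>\<^sup>+h. slice_integral \<Psi> h \<partial>lborel) * (\<integral>\<^sup>+X. \<Phi> X \<partial>lborel)"
    by (subst *[of \<Phi>], simp, subst nn_integral_cmult[symmetric]) simp_all
  finally show ?thesis .
qed

text \<open>If the slice total were 0 or infinite, so would be the chart integrals over the offset
  for every slope. The total mass would then be 0, or infinity times the volume of a strip, and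
  never 1.\<close>

lemma slice_total_pos_finite:
  fixes \<Phi> :: "real^'d^'d \<Rightarrow> ennreal"
  assumes [measurable]: "\<Phi> \<in> borel_measurable borel" and inv: "rotation_invariant \<Phi>"
    and one: "(\<integral>\<^sup>+X. \<Phi> X \<partial>lborel) = 1"
  shows "(\<integral>\<^sup>+h. slice_integral \<Phi> h \<partial>lborel) \<noteq> 0" "(\<integral>\<^sup>+h. slice_integral \<Phi> h \<partial>lborel) \<noteq> \<infinity>"
proof -
  show "(\<integral>\<^sup>+h. slice_integral \<Phi> h \<partial>lborel) \<noteq> 0"
  proof
    assume "(\<integral>\<^sup>+h. slice_integral \<Phi> h \<partial>lborel) = 0"
    then have "(\<integral>\<^sup>+b. chart_integral \<Phi> (rep b a) \<partial>lborel) = 0" for a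
      using nn_integral_chart_slice[of a] inv assms(1) by auto
    then show False using one by (subst (asm) nn_integral_chart_window) simp_all
  qed
  show "(\<integral>\<^sup>+h. slice_integral \<Phi> h \<partial>lborel) \<noteq> \<infinity>"
  proof
    assume "(\<integral>\<^sup>+h. slice_integral \<Phi> h \<partial>lborel) = \<infinity>"
    then have "(\<integral>\<^sup>+b. chart_integral \<Phi> (rep b a) \<partial>lborel) = \<infinity>" for a
      using nn_integral_chart_slice[of a] inv assms(1) by (auto simp: ennreal_mult_top)
    then have "1 = (\<integral>\<^sup>+a. indicator {a. a $ piv \<in> {0..1}} (a :: real^'d) * \<infinity> \<partial>lborel)"
      using one by (subst (asm) nn_integral_chart_window) (simp_all add: indicator_def)
    also have "\<dots> = emeasure lborel {a::real^'d. a $ piv \<in> {0..1}} * \<infinity>"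
      by (subst nn_integral_multc) simp_all
    finally have *: "1 = emeasure lborel {a::real^'d. a $ piv \<in> {0..1}} * \<infinity>" .
    then show False by (cases "emeasure lborel {a::real^'d. a $ piv \<in> {0..1}} = 0") (auto simp: ennreal_mult_top)
  qed
qed

section \<open>Jacobians of rotations and of dilations of slices\<close>

lemma jac_diagonal:
  fixes T :: "'a::euclidean_space \<Rightarrow> 'a"
  assumes T: "linear T" "\<And>x b. b \<in> Basis \<Longrightarrow> T x \<bullet> b = c b * (x \<bullet> b)" and c: "\<And>b. b \<in> Basis \<Longrightarrow> c b > 0"
  shows "jac T = ennreal (\<Prod>b\<in>Basis. c b)"
proof -
  have inj: "inj T"
  proof (subst linear_injective_0[OF T(1)], intro allI impI)
    fix x assume "T x = 0"
    then have "x \<bullet> b = 0" if "b \<in> Basis" for b using T(2)[OF that, of x] c[OF that] by simp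
    then show "x = 0" by (metis euclidean_all_zero_iff)
  qed
  have T_eq: "T x = 0 + (\<Sum>j\<in>Basis. (c j * (x \<bullet> j)) *\<^sub>R j)" for x
    by (rule euclidean_eqI) (simp add: T(2))
  have [measurable]: "T \<in> borel_measurable borel" by (rule borel_measurable_linear[OF T(1)])
  let ?I = "\<integral>\<^sup>+x. indicator (cball 0 1) (T x) \<partial>(lborel::'a measure)"
  have "emeasure lborel (cball 0 1 :: 'a set) = (\<integral>\<^sup>+x. indicator (cball 0 1 :: 'a set) x \<partial>lborel)" by simp
  also have "\<dots> = (\<integral>\<^sup>+x. indicator (cball 0 1 :: 'a set) x \<partial>density (distr lborel borel T) (\<lambda>_. ennreal (\<Prod>j\<in>Basis. \<bar>c j\<bar>)))"
    using c using lborel_affine_euclidean[of c 0] by (simp add: T_eq[symmetric] less_imp_neq[symmetric] del: add_0)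
  also have "\<dots> = ennreal (\<Prod>j\<in>Basis. \<bar>c j\<bar>) * ?I"
    by (subst nn_integral_density) (simp_all add: nn_integral_cmult nn_integral_distr borel_measurable_indicator del: nn_integral_indicator)
  also have "(\<Prod>j\<in>Basis. \<bar>c j\<bar>) = (\<Prod>b\<in>Basis. c b)"
    using c by (intro prod.cong) (auto simp: less_imp_le)
  finally show ?thesis
    using ball_preimage_integral[OF T(1) inj] by (simp add: jac_def ennreal_mult_divide_eq)
qed

lemma jac_orthogonal:
  fixes T :: "'a::euclidean_space \<Rightarrow> 'a"
  assumes "orthogonal_transformation T" shows "jac T = 1"
proof -
  have "(\<integral>\<^sup>+x. indicator (cball 0 1) (T x) \<partial>lborel) = (\<integral>\<^sup>+x. indicator (cball 0 1 :: 'a set) x \<partial>lborel)"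
    by (rule nn_integral_cong) (auto simp: indicator_def orthogonal_transformation_norm[OF assms])
  then show ?thesis
    using emeasure_unit_ball[where 'a='a] by (simp add: jac_def ennreal_divide_self less_top)
qed

lemma nn_integral_orthogonal:
  fixes T :: "'a::euclidean_space \<Rightarrow> 'a" and f :: "'a \<Rightarrow> ennreal"
  assumes T: "orthogonal_transformation T" and "f \<in> borel_measurable borel"
  shows "(\<integral>\<^sup>+x. f (T x) \<partial>lborel) = (\<integral>\<^sup>+x. f x \<partial>lborel)"
  using nn_integral_linear[of T f] assms jac_orthogonal[OF T] orthogonal_transformation_inj[OF T]
  by (simp add: orthogonal_transformation_def)

text \<open>Dilates the horizontal coordinates and leaves the dummy alone. With factor
  \<open>s h\<close> it carries the central slice of a radial density to the slice at height
  h.\<close>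

definition squeeze :: "real \<Rightarrow> real^'d \<Rightarrow> real^'d" where
  "squeeze s z = rep (z $ piv) (s *\<^sub>R z)"

lemma linear_squeeze: "linear (squeeze s)"
  by (rule linearI) (auto simp: squeeze_def rep_def vec_eq_iff algebra_simps)

lemma inj_squeeze:
  fixes s :: real assumes "s > 0"
  shows "inj (squeeze s :: real^'d \<Rightarrow> real^'d)"
proof (rule injI)
  fix x y :: "real^'d" assume "squeeze s x = squeeze s y"
  then have eq: "squeeze s x $ j = squeeze s y $ j" for j by simp
  have "x $ j = y $ j" for j
    using eq[of j] assms by (cases "j = piv") (simp_all add: squeeze_def rep_nth)
  then show "x = y" by (simp add: vec_eq_iff)
qed

lemma inner_squeeze: "squeeze s x \<bullet> y = x \<bullet> squeeze s y"
  unfolding inner_vec_def by (rule sum.cong) (auto simp: squeeze_def rep_nth)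

lemma prod_except_piv:
  fixes k :: "'d::finite"
  shows "(\<Prod>j\<in>UNIV. if j = k then 1 else s) = (s::real) ^ (CARD('d) - 1)"
  by (subst prod.remove[of UNIV k]) (simp_all add: card_Diff_singleton)

lemma jac_squeeze:
  assumes "s > 0" shows "jac (squeeze s :: real^'d \<Rightarrow> real^'d) = ennreal (s ^ (CARD('d) - 1))"
proof -
  let ?c = "\<lambda>b::real^'d. if b = axis piv 1 then 1 else s"
  have "jac (squeeze s :: real^'d \<Rightarrow> real^'d) = ennreal (\<Prod>b\<in>Basis. ?c b)"
    using assms by (intro jac_diagonal linear_squeeze)
      (auto simp: Basis_vec_def inner_axis squeeze_def rep_nth axis_eq_axis)
  also have "(\<Prod>b\<in>Basis. ?c b) = (\<Prod>j\<in>UNIV. if j = (piv::'d) then 1 else s)"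
    by (simp add: prod_Basis_vec axis_eq_axis)
  finally show ?thesis by (simp add: prod_except_piv)
qed

lemma linear_maprows: "linear f \<Longrightarrow> linear (maprows f)"
  by (rule linearI) (simp_all add: maprows_def vec_eq_iff linear_add linear_scale)

lemma inj_maprows:
  assumes "inj f" shows "inj (maprows f)"
proof (rule injI)
  fix X Y assume "maprows f X = maprows f Y"
  then have "maprows f X $ i = maprows f Y $ i" for i by simp
  then have "X $ i = Y $ i" for i using assms by (simp add: maprows_def inj_eq)
  then show "X = Y" by (simp add: vec_eq_iff)
qed

lemma jac_maprows_squeeze:
  assumes "s > 0"
  shows "jac (maprows (squeeze s) :: real^'d^'d \<Rightarrow> real^'d^'d) = ennreal ((s ^ (CARD('d) - 1)) ^ CARD('d))"
proof -
  let ?c = "\<lambda>b::real^'d^'d. if \<exists>i. b = axis i (axis piv 1) then 1 else s"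
  have c: "?c (axis i (axis j 1)) = (if j = piv then 1 else s)" for i j
    by (auto simp: axis_eq_axis)
  have "jac (maprows (squeeze s) :: real^'d^'d \<Rightarrow> real^'d^'d) = ennreal (\<Prod>b\<in>Basis. ?c b)"
  proof (intro jac_diagonal linear_maprows linear_squeeze)
    fix x b :: "real^'d^'d" assume "b \<in> Basis"
    then obtain i j where b: "b = axis i (axis j 1)" by (auto simp: Basis_vec_def)
    show "maprows (squeeze s) x \<bullet> b = ?c b * (x \<bullet> b)"
      unfolding b c by (simp add: inner_axis maprows_def squeeze_def rep_nth)
  qed (use assms in auto)
  also have "(\<Prod>b\<in>Basis. ?c b) = (\<Prod>i\<in>(UNIV::'d set). \<Prod>j\<in>UNIV. if j = (piv::'d) then 1 else s)"
    unfolding prod_Basis_vec by (simp add: c)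
  finally show ?thesis by (simp add: prod_except_piv)
qed

text \<open>The distance of the hyperplane through the rows of \<open>X\<close> from the origin.\<close>

definition hd :: "real^'d^'d \<Rightarrow> real" where
  "hd X = \<bar>nu X \<bullet> X $ piv\<bar> / norm (nu X)"

lemma measurable_hd [measurable]: "hd \<in> borel_measurable borel"
  unfolding hd_def by measurable

section \<open>Distance from the origin: behaviour on slices and under rotations\<close>

text \<open>Points of equal height have horizontal differences, so their normal is vertical; it is
  non-zero because their horizontal projections are affinely independent.\<close>

lemma nu_repc:
  assumes det: "det (colone X) \<noteq> 0"
  obtains r where "r \<noteq> 0" "nu (repc X (\<chi> i. h)) = r *\<^sub>R axis piv 1"
proof -
  let ?Y = "repc X (\<chi> i. h)" and ?e = "axis piv 1 :: real^'b"
  have row: "?Y $ i = rep h (X $ i)" for i by (simp add: repc_def)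
  have "nu ?Y \<noteq> 0"
  proof
    assume "nu ?Y = 0"
    then obtain z where z: "z \<noteq> 0" "?e \<bullet> z = 0" "\<And>i. (?Y $ i - ?Y $ piv) \<bullet> z = 0"
      using nu_eq_0_kernel by blast
    have z0: "z $ piv = 0" using z(2) by (simp add: inner_axis')
    define t where "t = rep h (X $ piv) \<bullet> z"
    have "rep h (X $ i) \<bullet> z = t" for i using z(3)[of i] by (simp add: row t_def inner_diff_left)
    then have "rep 1 (X $ i) \<bullet> z = t" for i
      using inner_rep'[of 1 "X $ i" z] inner_rep'[of h "X $ i" z] z0 by simp
    \<comment> \<open>For horizontal z the pivot entry of a row is irrelevant. All rows of
      \<open>colone X\<close> thus have inner product t with z, and subtracting t times the vertical
      unit vector gives a vector in the kernel.\<close>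
    then have "colone X $ i \<bullet> (z - t *\<^sub>R ?e) = 0" for i
      by (simp add: repc_def inner_diff_right inner_axis rep_nth)
    moreover have "z - t *\<^sub>R ?e \<noteq> 0"
    proof
      assume "z - t *\<^sub>R ?e = 0"
      then have eq: "z = t *\<^sub>R ?e" by simp
      then have "z $ piv = t" by simp
      then show False using z0 z(1) eq by simp
    qed
    ultimately show False using det unfolding det_eq_0_kernel by blast
  qed
  moreover have "?e \<bullet> (?Y $ i - ?Y $ piv) = 0" for i
    by (simp add: row inner_axis' inner_diff_right rep_nth)
  ultimately obtain k where k: "?e = k *\<^sub>R nu ?Y" using nu_parallel[of ?Y ?e] by blast
  then have "k \<noteq> 0" using axis_eq_0_iff[of piv "1::real"] by auto
  then have "nu ?Y = (1/k) *\<^sub>R ?e" by (simp add: k)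
  then show ?thesis using that[of "1/k"] \<open>k \<noteq> 0\<close> by simp
qed

lemma hd_repc: "det (colone X) \<noteq> 0 \<Longrightarrow> hd (repc X (\<chi> i. h)) = \<bar>h\<bar>"
  by (erule nu_repc[of X h]) (simp add: hd_def inner_axis' repc_def rep_nth abs_mult)

text \<open>Under an orthogonal R the generalised cross product becomes det R times the rotated
  \<open>nu X\<close>. Since det R is 1 or -1, both the numerator and the denominator of
  \<open>hd\<close> keep their values.\<close>

lemma rotation_invariant_hd: "rotation_invariant (hd :: real^'d^'d \<Rightarrow> real)"
  unfolding rotation_invariant_def
proof (intro allI impI)
  fix R :: "real^'d \<Rightarrow> real^'d" and X :: "real^'d^'d" assume R: "orthogonal_transformation R"
  have lin: "linear R" using R by (simp add: orthogonal_transformation_def)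
  define \<delta> where "\<delta> = det (matrix R)"
  have \<delta>: "\<bar>\<delta>\<bar> = 1" using orthogonal_transformation_det[OF R] by (simp add: \<delta>_def)
  have 1: "nu (maprows R X) \<bullet> R y = \<delta> * (nu X \<bullet> y)" for y
  proof -
    let ?A = "\<chi> i. if i = piv then y else X $ i - X $ piv"
    have "(\<chi> i. if i = piv then R y else maprows R X $ i - maprows R X $ piv) = ?A ** transpose (matrix R)"
    proof -
      have "(?A ** transpose (matrix R)) $ i = R (?A $ i)" for i
      proof -
        have "R v $ k = (\<Sum>j\<in>UNIV. v $ j * matrix R $ k $ j)" for v k
        proof -
          have "(\<Sum>j\<in>UNIV. matrix R $ k $ j * v $ j) = (matrix R *v v) $ k"
            by (simp only: matrix_vector_mult_def vec_lambda_beta)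
          then show ?thesis using fun_cong[OF matrix_vector_mul(2)[OF lin], of v] by (simp add: mult.commute)
        qed
        then show ?thesis by (simp add: vec_eq_iff matrix_matrix_mult_def transpose_def)
      qed
      then show ?thesis by (simp add: vec_eq_iff maprows_def linear_diff[OF lin])
    qed
    then have "nu (maprows R X) \<bullet> R y = det (?A ** transpose (matrix R))"
      by (simp only: det_nu[symmetric])
    then show ?thesis by (simp add: det_mul det_transpose \<delta>_def det_nu mult.commute)
  qed
  have 2: "nu (maprows R X) = \<delta> *\<^sub>R R (nu X)"
  proof -
    have "nu (maprows R X) \<bullet> z = (\<delta> *\<^sub>R R (nu X)) \<bullet> z" for z
    proof -
      obtain y where "z = R y" using orthogonal_transformation_surj[OF R] by (metis surjD)
      then show ?thesis using 1[of y] R by (simp add: orthogonal_transformation_def)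
    qed
    then show ?thesis by (metis vector_eq_rdot)
  qed
  show "hd (maprows R X) = hd X"
  proof -
    have "norm (nu (maprows R X)) = norm (nu X)" using 2 \<delta> by (simp add: orthogonal_transformation_norm[OF R])
    moreover have "\<bar>nu (maprows R X) \<bullet> maprows R X $ piv\<bar> = \<bar>nu X \<bullet> X $ piv\<bar>"
      using 1[of "X $ piv"] \<delta> by (simp add: maprows_def abs_mult)
    ultimately show ?thesis by (simp add: hd_def)
  qed
qed

section \<open>The law of the distance for radial densities\<close>

lemma PiM_density_lborel:
  fixes f :: "'a::euclidean_space \<Rightarrow> ennreal"
  assumes [measurable]: "f \<in> borel_measurable borel" and "prob_space (density lborel f)" and I: "finite I"
  shows "PiM I (\<lambda>_. density lborel f) = density (PiM I (\<lambda>_. lborel)) (\<lambda>x. \<Prod>i\<in>I. f (x i))"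
proof -
  interpret prob_space "density lborel f" by fact
  interpret D: product_sigma_finite "\<lambda>_. density lborel f" by standard
  interpret L: product_sigma_finite "\<lambda>_. lborel :: 'a measure" by standard
  show ?thesis
  proof (rule D.PiM_eqI[OF I, symmetric])
    show "sets (density (PiM I (\<lambda>_. lborel)) (\<lambda>x. \<Prod>i\<in>I. f (x i))) = sets (PiM I (\<lambda>_. density lborel f))"
      by (simp cong: sets_PiM_cong)
    fix A :: "'b \<Rightarrow> 'a set" assume "\<And>i. i \<in> I \<Longrightarrow> A i \<in> sets (density lborel f)"
    then have A [measurable]: "\<And>i. i \<in> I \<Longrightarrow> A i \<in> sets borel" by simp
    have "emeasure (density (PiM I (\<lambda>_. lborel)) (\<lambda>x. \<Prod>i\<in>I. f (x i))) (Pi\<^sub>E I A)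
        = (\<integral>\<^sup>+x. (\<Prod>i\<in>I. f (x i)) * indicator (Pi\<^sub>E I A) x \<partial>PiM I (\<lambda>_. lborel))"
      using I A by (intro emeasure_density) (auto intro!: sets_PiM_I_finite)
    also have "\<dots> = (\<integral>\<^sup>+x. (\<Prod>i\<in>I. f (x i) * indicator (A i) (x i)) \<partial>PiM I (\<lambda>_. lborel))"
    proof (rule nn_integral_cong)
      fix x assume "x \<in> space (PiM I (\<lambda>_. lborel :: 'a measure))"
      then have "x \<in> extensional I" by (simp add: space_PiM PiE_def)
      then have "(indicator (Pi\<^sub>E I A) x :: ennreal) = (\<Prod>i\<in>I. indicator (A i) (x i))"
        using I by (auto simp: indicator_def PiE_def Pi_iff prod_zero_iff intro!: prod.neutral)
      then show "(\<Prod>i\<in>I. f (x i)) * indicator (Pi\<^sub>E I A) x = (\<Prod>i\<in>I. f (x i) * indicator (A i) (x i))"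
        by (simp add: prod.distrib)
    qed
    also have "\<dots> = (\<Prod>i\<in>I. \<integral>\<^sup>+x. f x * indicator (A i) x \<partial>lborel)"
      using I by (intro L.product_nn_integral_prod) measurable
    also have "\<dots> = (\<Prod>i\<in>I. emeasure (density lborel f) (A i))"
      using A by (intro prod.cong) (simp_all add: emeasure_density)
    finally show "emeasure (density (PiM I (\<lambda>_. lborel)) (\<lambda>x. \<Prod>i\<in>I. f (x i))) (Pi\<^sub>E I A) = (\<Prod>i\<in>I. emeasure (density lborel f) (A i))" .
  qed
qed

lemma nn_integral_PiM_density:
  fixes f :: "real^'d \<Rightarrow> ennreal" and G :: "real^'d^'d \<Rightarrow> ennreal"
  assumes [measurable]: "f \<in> borel_measurable borel" and p: "prob_space (density lborel f)"
    and [measurable]: "G \<in> borel_measurable borel"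
  shows "(\<integral>\<^sup>+x. G (vec_lambda x) \<partial>PiM UNIV (\<lambda>_::'d. density lborel f)) = (\<integral>\<^sup>+X. (\<Prod>i\<in>UNIV. f (X $ i)) * G X \<partial>lborel)"
proof -
  have [measurable]: "(\<lambda>x. \<chi> i. x i) \<in> borel_measurable (PiM UNIV (\<lambda>_::'d. lborel :: (real^'d) measure))"
    by measurable
  have "(\<integral>\<^sup>+x. G (vec_lambda x) \<partial>PiM UNIV (\<lambda>_::'d. density lborel f))
      = (\<integral>\<^sup>+x. (\<Prod>i\<in>UNIV. f (x i)) * G (vec_lambda x) \<partial>PiM UNIV (\<lambda>_::'d. lborel))"
    by (subst PiM_density_lborel[OF _ p]) (simp_all add: nn_integral_density)
  also have "\<dots> = (\<integral>\<^sup>+X. (\<Prod>i\<in>UNIV. f (X $ i)) * G X \<partial>lborel)"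
    by (subst (2) distr_PiM_lborel_vec[symmetric], subst nn_integral_distr) simp_all
  finally show ?thesis .
qed

text \<open>For \<open>k\<close> at least 1, the probability that \<open>k\<close> further
  independent points fall strictly on one side of the hyperplane through d independent points. For
  \<open>k = 0\<close> the value is 2.\<close>

definition facet_moment :: "(real^'d) measure \<Rightarrow> nat \<Rightarrow> real" where
  "facet_moment \<mu> k = (LINT x|PiM UNIV (\<lambda>_. \<mu>).
    measure \<mu> {y. side (vec_lambda x) y < 0} ^ k + measure \<mu> {y. side (vec_lambda x) y > 0} ^ k)"

text \<open>Slices of the density orthogonal to a coordinate direction are rescaled copies of the
  central slice: the slice at height \<open>h\<close> is \<open>q h\<close> times the central one dilated by \<open>s h\<close>.\<close>

locale radial_density =
  fixes g :: "real^'d \<Rightarrow> real" and c :: real and a :: "nat \<Rightarrow> real" and J :: "real set"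
    and q s D0 :: "real \<Rightarrow> real"
  assumes g_measurable [measurable]: "g \<in> borel_measurable borel"
    and g_nonneg: "\<And>x. 0 \<le> g x" and c_pos: "0 < c"
    and prob: "prob_space (density lborel (\<lambda>x. ennreal (c * g x)))"
    and g_rotation: "\<And>R x. orthogonal_transformation R \<Longrightarrow> g (R x) = g x"
    and a_mono: "incseq a" and a_pos: "\<And>n. 0 < a n" and J_eq: "J = (\<Union>n. {- a n..a n})" and J_open: "open J"
    and g_slice: "\<And>h x. h \<in> J \<Longrightarrow> g (rep h x) = q h * g (rep 0 ((1 / s h) *\<^sub>R x))"
    and g_outside: "\<And>h x. h \<notin> J \<Longrightarrow> g (rep h x) = 0"
    and q_pos: "\<And>h. h \<in> J \<Longrightarrow> 0 < q h" and s_pos: "\<And>h. h \<in> J \<Longrightarrow> 0 < s h"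
    and q_even: "\<And>h. q (- h) = q h" and s_even: "\<And>h. s (- h) = s h"
    and q_cont: "continuous_on J q" and s_cont: "continuous_on J s"
    and deriv: "\<And>h. h \<in> J \<Longrightarrow>
      ((\<lambda>h. q h * s h ^ CARD('d)) has_real_derivative - D0 h * (q h * s h ^ (CARD('d) - 1))) (at h)"
    and D0_mono: "mono_on J D0" and D0_cont: "continuous_on J D0" and D0_odd: "\<And>h. D0 (- h) = - D0 h"
begin

abbreviation \<mu> :: "(real^'d) measure" where "\<mu> \<equiv> density lborel (\<lambda>x. ennreal (c * g x))"

text \<open>Mass of the slice at height \<open>h\<close> relative to the central one:
  \<open>q h\<close> comes from the density and the power of \<open>s h\<close> from the dilation in
  dimension d-1.\<close>

definition f0 :: "real \<Rightarrow> real" where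
  "f0 h = indicator J h * (q h * s h ^ (CARD('d) - 1))"

text \<open>The d points contribute (q s^(d-1))^d, and the Jacobian of \<open>colone\<close> another
  s^(d-1). The product is regrouped as \<open>f0\<close> times the power d-1 of q s^d, the function
  whose derivative the locale controls.\<close>

definition kern :: "real \<Rightarrow> real" where
  "kern h = indicator J h * ((q h * s h ^ (CARD('d) - 1)) * (q h * s h ^ CARD('d)) ^ (CARD('d) - 1))"

lemma J_sym: "- h \<in> J \<longleftrightarrow> h \<in> J"
  unfolding J_eq by (auto simp: minus_le_iff)

lemma J_sets [measurable]: "J \<in> sets borel" using J_open by (rule borel_open)

lemma f0_measurable [measurable]: "f0 \<in> borel_measurable borel"
proof -
  have "continuous_on J (\<lambda>h. q h * s h ^ (CARD('d) - 1))"
    by (intro continuous_intros q_cont s_cont)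
  from borel_measurable_continuous_on_indicator[OF J_sets this] show ?thesis
    by (simp add: f0_def[abs_def])
qed

lemma kern_measurable [measurable]: "kern \<in> borel_measurable borel"
proof -
  have "continuous_on J (\<lambda>h. (q h * s h ^ (CARD('d) - 1)) * (q h * s h ^ CARD('d)) ^ (CARD('d) - 1))"
    by (intro continuous_intros q_cont s_cont)
  from borel_measurable_continuous_on_indicator[OF J_sets this] show ?thesis
    by (simp add: kern_def[abs_def])
qed

lemma f0_nonneg: "0 \<le> f0 h" and kern_nonneg: "0 \<le> kern h"
  using q_pos[of h] s_pos[of h] by (auto simp: f0_def kern_def indicator_def less_imp_le)

lemma slice_squeeze:
  assumes "h \<in> J" shows "g (rep h (squeeze (s h) z)) = q h * g (rep 0 z)"
proof -
  have "rep 0 ((1 / s h) *\<^sub>R squeeze (s h) z) = rep 0 z"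
    using s_pos[OF assms] by (simp add: vec_eq_iff squeeze_def rep_nth)
  then show ?thesis using g_slice[OF assms, of "squeeze (s h) z"] by simp
qed

lemma marginal_ennreal:
  assumes [measurable]: "W \<in> borel_measurable borel"
  shows "(\<integral>\<^sup>+x. W (x $ piv) \<partial>\<mu>) =
    (\<integral>\<^sup>+x. indicator {0..1} (x $ piv) * ennreal (c * g (rep 0 x)) \<partial>lborel) * (\<integral>\<^sup>+t. W t * ennreal (f0 t) \<partial>lborel)"
    (is "_ = ?C * _")
proof -
  have inner: "(\<integral>\<^sup>+x. indicator {0..1} (x $ piv) * ennreal (c * g (rep t x)) \<partial>lborel) = ?C * ennreal (f0 t)" for t
  proof (cases "t \<in> J")
    case True
    let ?T = "squeeze (s t) :: real^'d \<Rightarrow> real^'d"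
    have "(\<integral>\<^sup>+x. indicator {0..1} (x $ piv) * ennreal (c * g (rep t x)) \<partial>lborel)
        = jac ?T * (\<integral>\<^sup>+x. indicator {0..1} (?T x $ piv) * ennreal (c * g (rep t (?T x))) \<partial>lborel)"
      by (rule nn_integral_linear[OF linear_squeeze inj_squeeze[OF s_pos[OF True]]]) measurable
    also have "(\<integral>\<^sup>+x. indicator {0..1} (?T x $ piv) * ennreal (c * g (rep t (?T x))) \<partial>lborel)
        = (\<integral>\<^sup>+x. ennreal (q t) * (indicator {0..1} (x $ piv) * ennreal (c * g (rep 0 x))) \<partial>lborel)"
    proof (rule nn_integral_cong)
      fix x
      have "ennreal (c * (q t * g (rep 0 x))) = ennreal (q t) * ennreal (c * g (rep 0 x))"
        using q_pos[OF True] by (subst ennreal_mult'[symmetric]) (simp_all add: mult_ac)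
      then show "indicator {0..1} (?T x $ piv) * ennreal (c * g (rep t (?T x)))
          = ennreal (q t) * (indicator {0..1} (x $ piv) * ennreal (c * g (rep 0 x)))"
        by (simp add: slice_squeeze[OF True]) (simp add: squeeze_def rep_nth mult_ac)
    qed
    also have "\<dots> = ennreal (q t) * ?C" by (rule nn_integral_cmult) measurable
    also have "jac ?T = ennreal (s t ^ (CARD('d) - 1))" by (rule jac_squeeze[OF s_pos[OF True]])
    also have "ennreal (s t ^ (CARD('d) - 1)) * (ennreal (q t) * ?C) = ?C * ennreal (f0 t)"
      using True q_pos[OF True] s_pos[OF True] by (simp add: f0_def ennreal_mult mult_ac less_imp_le)
    finally show ?thesis .
  next
    case False
    then show ?thesis by (simp add: g_outside f0_def)
  qed
  have m: "(\<lambda>t. ennreal (c * g (rep t x)) * W t) \<in> borel_measurable lborel" for x by measurable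
  have "(\<integral>\<^sup>+x. W (x $ piv) \<partial>\<mu>) = (\<integral>\<^sup>+x. ennreal (c * g x) * W (x $ piv) \<partial>lborel)"
    by (subst nn_integral_density) simp_all
  also have "\<dots> = (\<integral>\<^sup>+x. indicator {0..1} (x $ piv) * (\<integral>\<^sup>+t. ennreal (c * g (rep t x)) * W t \<partial>lborel) \<partial>(lborel :: (real^'d) measure))"
    using nn_integral_rep[of "\<lambda>x. ennreal (c * g x) * W (x $ piv)"] by (simp add: rep_nth)
  also have "\<dots> = (\<integral>\<^sup>+x. \<integral>\<^sup>+t. indicator {0..1} (x $ piv) * ennreal (c * g (rep t x)) * W t \<partial>lborel \<partial>(lborel :: (real^'d) measure))"
    by (rule nn_integral_cong) (simp only: mult.assoc nn_integral_cmult[OF m])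
  also have "\<dots> = (\<integral>\<^sup>+t. \<integral>\<^sup>+x. indicator {0..1} (x $ piv) * ennreal (c * g (rep t x)) * W t \<partial>(lborel :: (real^'d) measure) \<partial>lborel)"
    by (rule lborel_pair.Fubini') measurable
  also have "\<dots> = (\<integral>\<^sup>+t. (\<integral>\<^sup>+x. indicator {0..1} (x $ piv) * ennreal (c * g (rep t x)) \<partial>(lborel :: (real^'d) measure)) * W t \<partial>lborel)"
    by (rule nn_integral_cong, rule nn_integral_multc) measurable
  also have "\<dots> = (\<integral>\<^sup>+t. ?C * (W t * ennreal (f0 t)) \<partial>lborel)"
    by (rule nn_integral_cong) (subst inner, simp only: mult_ac)
  also have "\<dots> = ?C * (\<integral>\<^sup>+t. W t * ennreal (f0 t) \<partial>lborel)"
    by (rule nn_integral_cmult) measurable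
  finally show ?thesis .
qed

text \<open>The constant of \<open>marginal_ennreal\<close>, multiplied by the integral of
  \<open>f0\<close>, equals the total mass 1, so it is neither 0 nor infinite.\<close>

lemma marginal_exists:
  "\<exists>C>0. \<forall>W \<in> borel_measurable borel. (\<integral>\<^sup>+x. W (x $ piv) \<partial>\<mu>) = (\<integral>\<^sup>+t. W t * ennreal (C * f0 t) \<partial>lborel)"
proof -
  interpret prob_space \<mu> by (rule prob)
  define C where "C = (\<integral>\<^sup>+x. indicator {0..1} (x $ piv) * ennreal (c * g (rep 0 x)) \<partial>(lborel :: (real^'d) measure))"
  have "1 = C * (\<integral>\<^sup>+t. ennreal (f0 t) \<partial>lborel)"
    using marginal_ennreal[of "\<lambda>_. 1"] emeasure_space_1 by (simp add: C_def)
  then have C0: "C \<noteq> 0" "(\<integral>\<^sup>+t. ennreal (f0 t) \<partial>lborel) \<noteq> 0" by (metis mult_zero_left mult_zero_right one_neq_zero)+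
  have "C \<noteq> \<infinity>"
  proof
    assume "C = \<infinity>"
    then have "C * (\<integral>\<^sup>+t. ennreal (f0 t) \<partial>lborel) = \<infinity>" using C0 by (simp add: ennreal_top_mult)
    then show False using \<open>1 = C * _\<close> by simp
  qed
  with C0(1) obtain r where r: "C = ennreal r" "0 < r"
    by (cases C) (auto simp: less_le)
  have "(\<integral>\<^sup>+x. W (x $ piv) \<partial>\<mu>) = (\<integral>\<^sup>+t. W t * ennreal (r * f0 t) \<partial>lborel)"
    if [measurable]: "W \<in> borel_measurable borel" for W
  proof -
    have "(\<integral>\<^sup>+x. W (x $ piv) \<partial>\<mu>) = ennreal r * (\<integral>\<^sup>+t. W t * ennreal (f0 t) \<partial>lborel)"
      using marginal_ennreal[OF that] by (simp add: C_def[symmetric] r)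
    also have "\<dots> = (\<integral>\<^sup>+t. ennreal r * (W t * ennreal (f0 t)) \<partial>lborel)"
      by (rule nn_integral_cmult[symmetric]) measurable
    also have "\<dots> = (\<integral>\<^sup>+t. W t * ennreal (r * f0 t) \<partial>lborel)"
      using r(2) by (intro nn_integral_cong) (simp add: ennreal_mult' mult_ac)
    finally show ?thesis .
  qed
  then show ?thesis using r(2) by blast
qed

definition dens :: "real^'d^'d \<Rightarrow> ennreal" where
  "dens X = (\<Prod>i\<in>UNIV. ennreal (c * g (X $ i)))"

lemma dens_measurable [measurable]: "dens \<in> borel_measurable borel"
  unfolding dens_def by measurable

text \<open>Dilating all d rows back to the central slice collects (s^(d-1))^d from the change of
  variables, s^(d-1) from \<open>colone\<close> and q^d from the density.\<close>

lemma slice_integral_dens: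
  "slice_integral dens h =
    (\<integral>\<^sup>+X. window X * jac ((*v) (colone X)) * (\<Prod>i\<in>UNIV. ennreal (c * g (rep 0 (X $ i)))) \<partial>lborel) * ennreal (kern h)"
  (is "_ = ?C * _")
proof (cases "h \<in> J")
  case False
  then have "dens (repc X (\<chi> i. h)) = 0" for X by (simp add: dens_def repc_def g_outside)
  then show ?thesis using False by (simp add: slice_integral_def kern_def)
next
  case True
  let ?T = "maprows (squeeze (s h)) :: real^'d^'d \<Rightarrow> real^'d^'d"
  let ?P = "\<lambda>X::real^'d^'d. \<Prod>i\<in>UNIV. ennreal (c * g (rep 0 (X $ i)))"
  note q = q_pos[OF True] and s = s_pos[OF True]
  have lin: "linear ?T" by (intro linear_maprows linear_squeeze)
  have inj: "inj ?T" by (intro inj_maprows inj_squeeze s)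
  have win: "(\<chi> i. ?T X $ i $ piv) = (\<chi> i. X $ i $ piv)" for X
    by (simp add: maprows_def squeeze_def rep_nth)
  \<comment> \<open>The dilation acts on \<open>colone X\<close> from the right and spares the
    column of ones, because \<open>squeeze\<close> fixes the pivot entry.\<close>
  have jac: "jac ((*v) (colone (?T X))) = jac ((*v) (colone X)) * ennreal (s h ^ (CARD('d) - 1))" for X
  proof -
    have "colone (?T X) *v y = colone X *v squeeze (s h) y" for y
    proof -
      have "rep 1 (squeeze (s h) x) \<bullet> y = rep 1 x \<bullet> squeeze (s h) y" for x :: "real^'d"
      proof -
        have "rep 1 (squeeze (s h) x) = squeeze (s h) (rep 1 x)" by (simp add: squeeze_def vec_eq_iff rep_nth)
        then show ?thesis by (simp add: inner_squeeze)
      qed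
      then show ?thesis by (simp add: vec_eq_iff matrix_vector_mul_component repc_def maprows_def)
    qed
    then have "jac ((*v) (colone (?T X))) = jac (\<lambda>y. colone X *v squeeze (s h) y)"
      by (intro arg_cong[where f=jac] ext)
    also have "\<dots> = jac ((*v) (colone X)) * jac (squeeze (s h) :: real^'d \<Rightarrow> real^'d)"
      by (rule jac_compose[OF linear_mv linear_squeeze inj_squeeze[OF s]])
    finally show ?thesis by (simp add: jac_squeeze[OF s])
  qed
  have dens: "dens (repc (?T X) (\<chi> i. h)) = ennreal (q h ^ CARD('d)) * ?P X" for X
  proof -
    have "dens (repc (?T X) (\<chi> i. h)) = (\<Prod>i\<in>UNIV. ennreal (q h) * ennreal (c * g (rep 0 (X $ i))))"
      unfolding dens_def
    proof (rule prod.cong[OF refl])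
      fix i
      have "repc (?T X) (\<chi> i. h) $ i = rep h (squeeze (s h) (X $ i))" by (simp add: repc_def maprows_def)
      then have "ennreal (c * g (repc (?T X) (\<chi> i. h) $ i)) = ennreal (q h * (c * g (rep 0 (X $ i))))"
        using slice_squeeze[OF True] by (simp add: mult_ac)
      then show "ennreal (c * g (repc (?T X) (\<chi> i. h) $ i)) = ennreal (q h) * ennreal (c * g (rep 0 (X $ i)))"
        using q by (simp add: ennreal_mult')
    qed
    then show ?thesis using q by (simp add: prod.distrib ennreal_power less_imp_le)
  qed
  have m: "(\<lambda>X. window X * jac ((*v) (colone X)) * ?P X) \<in> borel_measurable lborel" by measurable
  have "slice_integral dens h = jac ?T * (\<integral>\<^sup>+X. window (?T X) * jac ((*v) (colone (?T X))) * dens (repc (?T X) (\<chi> i. h)) \<partial>lborel)"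
    unfolding slice_integral_def by (rule nn_integral_linear[OF lin inj]) measurable
  also have "\<dots> = jac ?T * (\<integral>\<^sup>+X. (ennreal (s h ^ (CARD('d) - 1)) * ennreal (q h ^ CARD('d))) * (window X * jac ((*v) (colone X)) * ?P X) \<partial>lborel)"
    unfolding win jac dens by (simp add: mult_ac)
  also have "\<dots> = jac ?T * ((ennreal (s h ^ (CARD('d) - 1)) * ennreal (q h ^ CARD('d))) * ?C)"
    by (simp only: nn_integral_cmult[OF m])
  also have "\<dots> = ?C * (ennreal ((s h ^ (CARD('d) - 1)) ^ CARD('d)) * (ennreal (s h ^ (CARD('d) - 1)) * ennreal (q h ^ CARD('d))))"
    by (simp add: jac_maprows_squeeze[OF s] mult_ac)
  also have "ennreal ((s h ^ (CARD('d) - 1)) ^ CARD('d)) * (ennreal (s h ^ (CARD('d) - 1)) * ennreal (q h ^ CARD('d))) = ennreal (kern h)"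
  proof -
    have "q h ^ CARD('d) = q h * q h ^ (CARD('d) - 1)" by (simp flip: power_Suc)
    then have "(s h ^ (CARD('d) - 1)) ^ CARD('d) * (s h ^ (CARD('d) - 1) * q h ^ CARD('d)) = kern h"
      using True by (simp add: kern_def power_mult_distrib power_mult[symmetric] mult_ac)
    then show ?thesis using q s by (simp flip: ennreal_mult)
  qed
  finally show ?thesis .
qed

lemma slice_integral_dens_hd:
  "slice_integral (\<lambda>X. dens X * G (hd X)) h = G \<bar>h\<bar> * slice_integral dens h"
  if [measurable]: "G \<in> borel_measurable borel" for G :: "real \<Rightarrow> ennreal"
proof -
  have "slice_integral (\<lambda>X. dens X * G (hd X)) h
      = (\<integral>\<^sup>+X. G \<bar>h\<bar> * (window X * jac ((*v) (colone X)) * dens (repc X (\<chi> i. h))) \<partial>lborel)"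
    unfolding slice_integral_def
    by (rule nn_integral_cong_AE, rule eventually_mono[OF AE_colone]) (simp add: hd_repc mult_ac)
  also have "\<dots> = G \<bar>h\<bar> * slice_integral dens h"
    unfolding slice_integral_def by (rule nn_integral_cmult) measurable
  finally show ?thesis .
qed

lemma rotation_invariant_dens: "rotation_invariant dens"
  by (simp add: rotation_invariant_def dens_def maprows_def g_rotation)

text \<open>Blaschke-Petkantschin is applied to \<open>dens\<close> weighted by a function of the
  distance and compared with \<open>dens\<close> itself. The latter has mass 1, which fixes the
  unknown constant.\<close>

lemma law_hd:
  "\<exists>K>0. (\<integral>\<^sup>+h. ennreal (kern h) \<partial>lborel) = ennreal K \<and> (\<forall>G \<in> borel_measurable borel.
    ennreal K * (\<integral>\<^sup>+x. G (hd (vec_lambda x)) \<partial>PiM UNIV (\<lambda>_. \<mu>)) = (\<integral>\<^sup>+h. G \<bar>h\<bar> * ennreal (kern h) \<partial>lborel))"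
proof -
  define C where "C = (\<integral>\<^sup>+X. window X * jac ((*v) (colone X)) * (\<Prod>i\<in>UNIV. ennreal (c * g (rep 0 (X $ i)))) \<partial>(lborel :: (real^'d^'d) measure))"
  have slice: "slice_integral dens h = C * ennreal (kern h)" for h
    by (simp add: slice_integral_dens C_def)
  have expect: "(\<integral>\<^sup>+x. G (hd (vec_lambda x)) \<partial>PiM UNIV (\<lambda>_. \<mu>)) = (\<integral>\<^sup>+X. dens X * G (hd X) \<partial>lborel)"
    if [measurable]: "G \<in> borel_measurable borel" for G :: "real \<Rightarrow> ennreal"
    unfolding dens_def by (rule nn_integral_PiM_density[OF _ prob]) measurable
  have "prob_space (PiM UNIV (\<lambda>_::'d. \<mu>))" using prob by (intro prob_space_PiM)
  then have one: "(\<integral>\<^sup>+X. dens X \<partial>lborel) = 1"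
    using expect[of "\<lambda>_. 1"] prob_space.emeasure_space_1[of "PiM UNIV (\<lambda>_::'d. \<mu>)"] by simp
  have tot: "(\<integral>\<^sup>+h. slice_integral dens h \<partial>lborel) = C * (\<integral>\<^sup>+h. ennreal (kern h) \<partial>lborel)"
    unfolding slice by (rule nn_integral_cmult) measurable
  note pf = slice_total_pos_finite[OF dens_measurable rotation_invariant_dens one, unfolded tot]
  then have C: "C \<noteq> 0" "(\<integral>\<^sup>+h. ennreal (kern h) \<partial>lborel) \<noteq> 0" by auto
  then have C': "C \<noteq> \<infinity>" "(\<integral>\<^sup>+h. ennreal (kern h) \<partial>lborel) \<noteq> \<infinity>"
    using pf(2) by (auto simp: ennreal_mult_eq_top_iff)
  then obtain K where K: "(\<integral>\<^sup>+h. ennreal (kern h) \<partial>lborel) = ennreal K" "0 < K"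
    using C(2) by (cases "\<integral>\<^sup>+h. ennreal (kern h) \<partial>lborel") (auto simp: less_le)
  have "ennreal K * (\<integral>\<^sup>+x. G (hd (vec_lambda x)) \<partial>PiM UNIV (\<lambda>_. \<mu>)) = (\<integral>\<^sup>+h. G \<bar>h\<bar> * ennreal (kern h) \<partial>lborel)"
    if G [measurable]: "G \<in> borel_measurable borel" for G
  proof -
    have inv: "rotation_invariant (\<lambda>X. dens X * G (hd X))"
      using rotation_invariant_dens rotation_invariant_hd unfolding rotation_invariant_def by metis
    have "(\<integral>\<^sup>+h. slice_integral dens h \<partial>lborel) * (\<integral>\<^sup>+X. dens X * G (hd X) \<partial>lborel) =
        (\<integral>\<^sup>+h. slice_integral (\<lambda>X. dens X * G (hd X)) h \<partial>lborel) * (\<integral>\<^sup>+X. dens X \<partial>lborel)"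
      by (rule blaschke_petkantschin_cross[OF dens_measurable _ rotation_invariant_dens inv]) measurable
    then have "C * ennreal K * (\<integral>\<^sup>+X. dens X * G (hd X) \<partial>lborel) = (\<integral>\<^sup>+h. slice_integral (\<lambda>X. dens X * G (hd X)) h \<partial>lborel)"
      unfolding one tot K by simp
    also have "\<dots> = (\<integral>\<^sup>+h. C * (G \<bar>h\<bar> * ennreal (kern h)) \<partial>lborel)"
      unfolding slice_integral_dens_hd[OF G] slice by (simp only: mult_ac)
    also have "\<dots> = C * (\<integral>\<^sup>+h. G \<bar>h\<bar> * ennreal (kern h) \<partial>lborel)"
      by (rule nn_integral_cmult) measurable
    finally have "C * (ennreal K * (\<integral>\<^sup>+X. dens X * G (hd X) \<partial>lborel)) = C * (\<integral>\<^sup>+h. G \<bar>h\<bar> * ennreal (kern h) \<partial>lborel)"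
      by (simp only: mult.assoc)
    then show ?thesis using C(1) C'(1) unfolding expect[OF G]
      by (subst (asm) ennreal_mult_cancel_left) auto
  qed
  then show ?thesis using K by blast
qed

end

section \<open>The moment inequality for a concave profile\<close>

text \<open>The tangent at \<open>y\<close> to the convex power function, obtained from Bernoulli's
  inequality for t / y. It serves as the supporting line in Jensen's inequality.\<close>

lemma bernoulli_tangent:
  fixes y t :: real assumes "0 < y" "0 \<le> t"
  shows "y ^ k + real k * y ^ (k - 1) * (t - y) \<le> t ^ k"
proof -
  have "1 + real k * (t / y - 1) \<le> (1 + (t / y - 1)) ^ k"
    using assms by (intro Bernoulli_inequality) simp
  then have "y ^ k * (1 + real k * (t / y - 1)) \<le> y ^ k * (t / y) ^ k"
    using assms by (intro mult_left_mono) simp_all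
  also have "y ^ k * (t / y) ^ k = t ^ k" using assms by (simp add: power_divide)
  also have "y ^ k * (1 + real k * (t / y - 1)) = y ^ k + real k * y ^ (k - 1) * (t - y)"
    using assms by (cases k) (simp_all add: field_simps)
  finally show ?thesis .
qed

text \<open>\<open>F\<close> is the distribution function with density \<open>f\<close> of a coordinate, and \<open>f * L ^ m\<close> is (up to
  a constant) the density of the signed distance of the random hyperplane. As a function of
  \<open>F\<close>, \<open>L\<close> has derivative \<open>- D\<close>, so monotonicity of \<open>D\<close> expresses its concavity.\<close>

locale concave_profile =
  fixes J :: "real set" and a :: "nat \<Rightarrow> real" and f F L D :: "real \<Rightarrow> real" and m :: nat and kap :: "real \<Rightarrow> real"
  assumes J_open: "open J" and a_mono: "incseq a" and a_pos: "\<And>n. 0 < a n" and J_eq: "J = (\<Union>n. {- a n..a n})"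
    and f_cont: "continuous_on J f" and f_pos: "\<And>h. h \<in> J \<Longrightarrow> 0 < f h"
    and L_pos: "\<And>h. h \<in> J \<Longrightarrow> 0 < L h" and L_even: "\<And>h. L (- h) = L h"
    and D_cont: "continuous_on J D" and D_mono: "mono_on J D" and D_odd: "\<And>h. D (- h) = - D h"
    and L_deriv: "\<And>h. h \<in> J \<Longrightarrow> (L has_real_derivative - (D h * f h)) (at h)"
    and F_deriv: "\<And>h. h \<in> J \<Longrightarrow> (F has_real_derivative f h) (at h)"
    and F_sym: "\<And>h. F (- h) = 1 - F h" and F_nonneg: "\<And>h. 0 \<le> F h" and F_measurable [measurable]: "F \<in> borel_measurable borel"
    and F_lim: "(\<lambda>n. F (a n)) \<longlonglongrightarrow> 1"
    and kap_eq: "\<And>h. kap h = indicator J h * (f h * L h ^ m)" and kap_even: "\<And>h. kap (- h) = kap h"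
    and kap_integrable: "integrable lborel kap"
begin

lemma F_le_1: "F h \<le> 1" using F_sym[of h] F_nonneg[of "-h"] by simp

lemma kap_measurable [measurable]: "kap \<in> borel_measurable borel"
  using kap_integrable by simp

lemma kap_nonneg: "0 \<le> kap h"
  using f_pos[of h] L_pos[of h] by (simp add: kap_eq indicator_def less_imp_le)

lemma J_sym: "- h \<in> J \<longleftrightarrow> h \<in> J"
  unfolding J_eq by (auto simp: minus_le_iff)

lemma J_interval: "x \<in> J \<Longrightarrow> y \<in> J \<Longrightarrow> x \<le> t \<Longrightarrow> t \<le> y \<Longrightarrow> t \<in> J"
proof -
  assume "x \<in> J" "y \<in> J" and t: "x \<le> t" "t \<le> y"
  then obtain i j where ij: "x \<in> {- a i..a i}" "y \<in> {- a j..a j}" by (auto simp: J_eq)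
  have "a i \<le> a (max i j)" "a j \<le> a (max i j)" using a_mono by (simp_all add: incseqD)
  then have "t \<in> {- a (max i j)..a (max i j)}" using ij t by auto
  then show "t \<in> J" by (auto simp: J_eq)
qed

lemma a_in_J: "a n \<in> J" "0 \<in> J"
  using a_pos[of n] by (auto simp: J_eq intro!: exI[of _ n] less_imp_le)

text \<open>L is concave in F with slope -D, so its tangent at \<open>h\<close>, followed up to F =
  1, lies above L and hence above 0. For Gaussian laws this is the classical bound on the Mills
  ratio.\<close>

lemma mills:
  assumes h: "h \<in> J" shows "D h * (1 - F h) \<le> L h"
proof -
  obtain n0 where n0: "h \<le> a n0" using h by (auto simp: J_eq)
  \<comment> \<open>F need not attain 1 within \<open>J\<close>, so the tangent is followed up to
    \<open>a n\<close> and the limit is taken afterwards.\<close>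
  have "D h * (F (a n) - F h) \<le> L h" if "n \<ge> n0" for n
  proof -
    have ha: "h \<le> a n" using n0 incseqD[OF a_mono that] by simp
    have "L (a n) + D h * F (a n) \<le> L h + D h * F h"
    proof (rule DERIV_nonpos_imp_nonincreasing[OF ha])
      fix t assume t: "h \<le> t" "t \<le> a n"
      then have tJ: "t \<in> J" using J_interval[OF h a_in_J(1)] by blast
      have "((\<lambda>t. L t + D h * F t) has_real_derivative - (D t * f t) + D h * f t) (at t)"
        using L_deriv[OF tJ] F_deriv[OF tJ] by (auto intro!: derivative_eq_intros)
      moreover have "D h * f t \<le> D t * f t"
        using mono_onD[OF D_mono h tJ t(1)] f_pos[OF tJ] by (intro mult_right_mono) auto
      ultimately show "\<exists>y. ((\<lambda>t. L t + D h * F t) has_real_derivative y) (at t) \<and> y \<le> 0" by force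
    qed
    moreover have "0 < L (a n)" by (rule L_pos[OF a_in_J(1)])
    ultimately show ?thesis by (simp add: algebra_simps)
  qed
  moreover have "(\<lambda>n. D h * (F (a n) - F h)) \<longlonglongrightarrow> D h * (1 - F h)"
    by (intro tendsto_intros F_lim)
  ultimately show ?thesis by (intro LIMSEQ_le_const2) auto
qed

lemma mills': "h \<in> J \<Longrightarrow> - D h * F h \<le> L h"
  using mills[of "- h"] by (simp add: J_sym D_odd F_sym L_even)

lemma D_nonneg: "h \<in> J \<Longrightarrow> 0 \<le> h \<Longrightarrow> 0 \<le> D h"
  using mono_onD[OF D_mono a_in_J(2), of h] D_odd[of 0] by simp

lemma D_nonpos: "h \<in> J \<Longrightarrow> h \<le> 0 \<Longrightarrow> D h \<le> 0"
  using D_nonneg[of "- h"] by (simp add: J_sym D_odd)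

lemma L_le: assumes h: "h \<in> J" shows "L h \<le> L 0"
proof -
  have "L t \<le> L 0" if t: "t \<in> J" "0 \<le> t" for t
  proof (rule DERIV_nonpos_imp_nonincreasing[OF t(2)])
    fix x assume x: "0 \<le> x" "x \<le> t"
    then have xJ: "x \<in> J" using J_interval[OF a_in_J(2) t(1)] by blast
    have "0 \<le> D x * f x" using D_nonneg[OF xJ x(1)] f_pos[OF xJ] by simp
    then show "\<exists>y. (L has_real_derivative y) (at x) \<and> y \<le> 0" using L_deriv[OF xJ] by force
  qed
  from this[of "\<bar>h\<bar>"] show ?thesis using h L_even[of h] by (cases "0 \<le> h") (simp_all add: J_sym)
qed

text \<open>The derivative of F^k (1-F) L^m. The factor 1-F removes the boundary term on the right
  and, for \<open>k\<close> at least 1, the factor F^k removes the one on the left.\<close>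

definition dPsi :: "nat \<Rightarrow> real \<Rightarrow> real" where
  "dPsi k h = real k * F h ^ (k - 1) * f h * (1 - F h) * L h ^ m - F h ^ k * f h * L h ^ m
    - F h ^ k * (1 - F h) * (real m * L h ^ (m - 1) * (D h * f h))"

lemma Psi_deriv:
  "h \<in> J \<Longrightarrow> ((\<lambda>h. F h ^ k * (1 - F h) * L h ^ m) has_real_derivative dPsi k h) (at h)"
  by (rule derivative_eq_intros F_deriv L_deriv refl | assumption)+ (simp add: dPsi_def algebra_simps)

lemma F_cont: "continuous_on J F" and L_cont: "continuous_on J L"
  using DERIV_isCont[OF F_deriv] DERIV_isCont[OF L_deriv] by (auto intro: continuous_at_imp_continuous_on)

lemma dPsi_cont: "continuous_on J (dPsi k)"
  unfolding dPsi_def[abs_def] by (intro continuous_intros F_cont L_cont f_cont D_cont)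

lemma J_sets [measurable]: "J \<in> sets borel" using J_open by (rule borel_open)

text \<open>The slope D may be unbounded near the ends of \<open>J\<close>, as it is for beta laws.
  The tail bounds \<open>mills\<close> and \<open>mills'\<close> absorb it on the side where it is
  positive and where it is negative, respectively.\<close>

lemma tail_term_bound:
  assumes h: "h \<in> J" and k: "1 \<le> k"
  shows "\<bar>F h ^ k * (1 - F h) * D h\<bar> \<le> L h"
proof -
  have F: "0 \<le> F h" "F h \<le> 1" by (rule F_nonneg F_le_1)+
  have Fk: "0 \<le> F h ^ k" "F h ^ k \<le> F h" "F h ^ k \<le> 1"
    using F k power_decreasing[of 1 k "F h"] by (auto intro: power_le_one)
  have abs: "\<bar>F h ^ k * (1 - F h) * D h\<bar> = F h ^ k * (1 - F h) * \<bar>D h\<bar>"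
    using F Fk by (simp add: abs_mult)
  show ?thesis
  proof (cases "0 \<le> D h")
    case True
    have "F h ^ k * (1 - F h) * \<bar>D h\<bar> \<le> 1 * (1 - F h) * D h"
      using F Fk True by (intro mult_mono) auto
    also have "\<dots> \<le> L h" using mills[OF h] by (simp add: mult.commute)
    finally show ?thesis unfolding abs .
  next
    case False
    have "F h ^ k * (1 - F h) * \<bar>D h\<bar> \<le> F h * 1 * (- D h)"
      using F Fk False by (intro mult_mono) auto
    also have "\<dots> \<le> L h" using mills'[OF h] by (simp add: mult.commute)
    finally show ?thesis unfolding abs .
  qed
qed

lemma dPsi_bound:
  assumes h: "h \<in> J" and k: "1 \<le> k"
  shows "\<bar>dPsi k h\<bar> \<le> (real k + 1 + real m) * kap h"
proof -
  have F: "0 \<le> F h" "F h \<le> 1" by (rule F_nonneg F_le_1)+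
  have pos: "0 < f h" "0 < L h" using f_pos[OF h] L_pos[OF h] .
  have kap: "kap h = f h * L h ^ m" using h by (simp add: kap_eq)
  have kap0: "0 \<le> kap h" by (rule kap_nonneg)
  have "F h ^ (k - 1) * (1 - F h) \<le> 1 * 1" using F by (intro mult_mono power_le_one) auto
  then have "real k * (F h ^ (k - 1) * (1 - F h)) * kap h \<le> real k * 1 * kap h"
    using kap0 by (intro mult_right_mono mult_left_mono) auto
  moreover have "F h ^ k * kap h \<le> 1 * kap h"
    using F kap0 by (intro mult_right_mono power_le_one) auto
  moreover have "\<bar>F h ^ k * (1 - F h) * (real m * L h ^ (m - 1) * (D h * f h))\<bar> \<le> real m * kap h"
  proof (cases m)
    case (Suc m')
    have "\<bar>F h ^ k * (1 - F h) * (real m * L h ^ (m - 1) * (D h * f h))\<bar>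
        = \<bar>F h ^ k * (1 - F h) * D h\<bar> * (real m * L h ^ (m - 1) * f h)"
      using pos by (simp add: abs_mult mult_ac)
    also have "\<dots> \<le> L h * (real m * L h ^ (m - 1) * f h)"
      using pos by (intro mult_right_mono tail_term_bound[OF h k]) simp
    finally show ?thesis by (simp add: kap Suc mult_ac)
  qed simp
  moreover have "dPsi k h = real k * (F h ^ (k - 1) * (1 - F h)) * kap h - F h ^ k * kap h
      - F h ^ k * (1 - F h) * (real m * L h ^ (m - 1) * (D h * f h))"
    by (simp add: dPsi_def kap mult_ac)
  moreover have "0 \<le> real k * (F h ^ (k - 1) * (1 - F h)) * kap h" "0 \<le> F h ^ k * kap h"
    using F kap0 by simp_all
  ultimately show ?thesis unfolding abs_le_iff by (auto simp: algebra_simps)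
qed

text \<open>The fundamental theorem of calculus applies on the compact intervals from -a n to a n,
  and \<open>dPsi_bound\<close> dominates the passage to \<open>J\<close>. The boundary terms are at
  most (1 - F (a n)) times a constant and tend to 0.\<close>

lemma integral_dPsi:
  assumes k: "1 \<le> k"
  shows "integrable lborel (\<lambda>h. dPsi k h * indicator J h)" "(LINT h|lborel. dPsi k h * indicator J h) = 0"
proof -
  let ?g = "\<lambda>h. dPsi k h * indicator J h" and ?w = "\<lambda>h. (real k + 1 + real m) * kap h"
  have gm [measurable]: "?g \<in> borel_measurable borel"
    using borel_measurable_continuous_on_indicator[OF J_sets dPsi_cont] by (simp add: mult.commute)
  have w: "integrable lborel ?w" using kap_integrable by simp
  have eq: "dPsi k h * indicator {- a n..a n} h = ?g h * indicator {- a n..a n} h" for n h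
    by (auto simp: indicator_def J_eq)
  have bound: "\<bar>?g h\<bar> \<le> ?w h" for h
    using dPsi_bound[OF _ k, of h] kap_nonneg[of h] by (simp add: indicator_def)
  have lim: "(\<lambda>n. ?g h * indicator {- a n..a n} h) \<longlonglongrightarrow> ?g h" for h
  proof (cases "h \<in> J")
    case True
    then obtain n0 where "h \<in> {- a n0..a n0}" by (auto simp: J_eq)
    moreover have "a n0 \<le> a n" if "n \<ge> n0" for n using incseqD[OF a_mono that] .
    ultimately have "\<forall>n\<ge>n0. ?g h * indicator {- a n..a n} h = ?g h" by (force simp: indicator_def)
    then have "eventually (\<lambda>n. ?g h * indicator {- a n..a n} h = ?g h) sequentially"
      by (auto simp: eventually_sequentially)
    then show ?thesis by (rule tendsto_eventually)
  qed simp
  show "integrable lborel ?g"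
    by (rule Bochner_Integration.integrable_bound[OF w]) (use bound in \<open>auto intro!: AE_I2 order_trans[OF bound]\<close>)
  have conv: "(\<lambda>n. LINT h|lborel. ?g h * indicator {- a n..a n} h) \<longlonglongrightarrow> (LINT h|lborel. ?g h)"
  proof (rule integral_dominated_convergence[where w="?w"])
    show "AE h in lborel. norm (?g h * indicator {- a n..a n} h) \<le> ?w h" for n
      using bound kap_nonneg by (intro AE_I2) (auto simp: indicator_def)
  qed (use w lim in auto)
  have ftc: "(LINT h|lborel. ?g h * indicator {- a n..a n} h) =
      F (a n) ^ k * (1 - F (a n)) * L (a n) ^ m - F (- a n) ^ k * (1 - F (- a n)) * L (- a n) ^ m" for n
  proof -
    have "isCont (dPsi k) h" if "- a n \<le> h" "h \<le> a n" for h
      using that dPsi_cont[of k] J_open by (subst (asm) continuous_on_eq_continuous_at) (auto simp: J_eq)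
    then show ?thesis
      unfolding eq[symmetric] using a_pos[of n]
      by (intro integral_FTC_Icc_real Psi_deriv) (auto simp: J_eq)
  qed
  have "(\<lambda>n. (1 - F (a n)) * (2 * L 0 ^ m)) \<longlonglongrightarrow> (1 - 1) * (2 * L 0 ^ m)"
    by (intro tendsto_intros F_lim)
  then have z: "(\<lambda>n. (1 - F (a n)) * (2 * L 0 ^ m)) \<longlonglongrightarrow> 0" by simp
  have "(\<lambda>n. LINT h|lborel. ?g h * indicator {- a n..a n} h) \<longlonglongrightarrow> 0"
  proof (rule Lim_null_comparison[OF _ z], rule always_eventually, rule allI)
    fix n
    have F: "0 \<le> F (a n)" "F (a n) \<le> 1" by (rule F_nonneg F_le_1)+
    have L: "0 \<le> L (a n) ^ m" "L (a n) ^ m \<le> L 0 ^ m"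
      using L_pos[OF a_in_J(1)[of n]] L_le[OF a_in_J(1)[of n]] by (auto intro: power_mono)
    have "F (a n) ^ k * (1 - F (a n)) * L (a n) ^ m \<le> 1 * (1 - F (a n)) * L 0 ^ m"
      using F L by (intro mult_mono power_le_one) auto
    moreover have "(1 - F (a n)) ^ k * F (a n) * L (a n) ^ m \<le> (1 - F (a n)) * 1 * L 0 ^ m"
      using F L power_decreasing[of 1 k "1 - F (a n)"] k by (intro mult_mono) auto
    moreover have "0 \<le> F (a n) ^ k * (1 - F (a n)) * L (a n) ^ m" "0 \<le> (1 - F (a n)) ^ k * F (a n) * L (a n) ^ m"
      using F L by simp_all
    ultimately show "norm (LINT h|lborel. ?g h * indicator {- a n..a n} h) \<le> (1 - F (a n)) * (2 * L 0 ^ m)"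
      unfolding ftc F_sym L_even real_norm_def abs_le_iff by (auto simp: algebra_simps)
  qed
  with conv show "(LINT h|lborel. ?g h) = 0" by (rule LIMSEQ_unique)
qed

lemma integrable_kap_bounded:
  assumes [measurable]: "G \<in> borel_measurable borel" and "\<And>h. \<bar>G h\<bar> \<le> B"
  shows "integrable lborel (\<lambda>h. G h * kap h)"
proof (rule Bochner_Integration.integrable_bound[of lborel "\<lambda>h. B * kap h"])
  show "AE h in lborel. norm (G h * kap h) \<le> norm (B * kap h)"
    using assms(2) kap_nonneg by (intro AE_I2) (auto simp: abs_mult intro!: mult_right_mono order_trans[OF assms(2)])
qed (use kap_integrable in auto)

definition A :: "nat \<Rightarrow> real" where "A k = (LINT h|lborel. F h ^ k * kap h)"

lemma integrable_F_power: "integrable lborel (\<lambda>h. F h ^ k * kap h)"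
  using F_nonneg F_le_1 by (intro integrable_kap_bounded[where B=1]) (auto intro: power_le_one)

text \<open>Integrate \<open>dPsi\<close> and estimate (1-F) D by L. This alone makes the right-hand
  side non-negative. For non-positive h, however, D is non-positive and the whole of L is gained;
  the left-hand side collects this gain.\<close>

lemma moment_inequality:
  assumes k: "1 \<le> k"
  shows "real m * (LINT h|lborel. (indicator {..0} h * F h ^ k) * kap h) \<le> (real m + 1 + real k) * A k - real k * A (k - 1)"
proof -
  have ptw: "real m * ((indicator {..0} h * F h ^ k) * kap h) \<le>
      (real m + 1 + real k) * (F h ^ k * kap h) - real k * (F h ^ (k - 1) * kap h) + dPsi k h * indicator J h" for h
  proof (cases "h \<in> J")
    case True
    have F: "0 \<le> F h" "F h \<le> 1" by (rule F_nonneg F_le_1)+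
    have pos: "0 < f h" "0 < L h" using f_pos[OF True] L_pos[OF True] .
    have kap: "kap h = f h * L h ^ m" using True by (simp add: kap_eq)
    have Fk: "F h ^ k = F h * F h ^ (k - 1)" using k by (simp flip: power_Suc)
    \<comment> \<open>Both sides are 0 for m = 0, so the truncated exponent m - 1 does no
      harm.\<close>
    have mL: "real m * L h ^ m = real m * L h ^ (m - 1) * L h" by (cases m) simp_all
    have "indicator {..0} h * L h \<le> L h - (1 - F h) * D h"
    proof (cases "h \<le> 0")
      case True
      then have "(1 - F h) * D h \<le> 0" using D_nonpos \<open>h \<in> J\<close> F by (intro mult_nonneg_nonpos) auto
      then show ?thesis using True by simp
    next
      case False
      then show ?thesis using mills[OF \<open>h \<in> J\<close>] by (simp add: mult.commute)
    qed
    moreover define W where "W = real m * L h ^ (m - 1) * f h * F h ^ k"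
    moreover have "0 \<le> W" using pos F by (simp add: W_def)
    ultimately have "W * (indicator {..0} h * L h) \<le> W * (L h - (1 - F h) * D h)"
      by (intro mult_left_mono)
    moreover have "W * (L h - (1 - F h) * D h) = W * L h - W * ((1 - F h) * D h)"
      by (rule right_diff_distrib)
    moreover have "W * (indicator {..0} h * L h) = real m * ((indicator {..0} h * F h ^ k) * kap h)"
    proof -
      have "real m * ((indicator {..0} h * F h ^ k) * kap h) = (real m * L h ^ m) * (indicator {..0} h * F h ^ k * f h)"
        by (simp add: kap mult_ac)
      then show ?thesis unfolding mL W_def by (simp only: mult_ac)
    qed
    moreover have "W * L h = real m * (F h ^ k * kap h)"
    proof -
      have "real m * (F h ^ k * kap h) = (real m * L h ^ m) * (F h ^ k * f h)"
        by (simp add: kap mult_ac)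
      then show ?thesis unfolding mL W_def by (simp only: mult_ac)
    qed
    moreover have "dPsi k h = real k * (F h ^ (k - 1) * kap h) - real k * (F h ^ k * kap h) - F h ^ k * kap h
        - W * ((1 - F h) * D h)"
      by (simp add: dPsi_def kap Fk W_def algebra_simps)
    moreover have "(real m + 1 + real k) * (F h ^ k * kap h) = real m * (F h ^ k * kap h) + F h ^ k * kap h + real k * (F h ^ k * kap h)"
      by (simp add: distrib_right)
    moreover have "dPsi k h * indicator J h = dPsi k h" using True by simp
    ultimately show ?thesis by linarith
  next
    case False
    then show ?thesis by (simp add: kap_eq)
  qed
  have i1: "integrable lborel (\<lambda>h. (indicator {..0} h * F h ^ k) * kap h)"
    using F_nonneg F_le_1 by (intro integrable_kap_bounded[where B=1]) (auto simp: indicator_def intro: power_le_one)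
  note ints = integrable_F_power[of k] integrable_F_power[of "k - 1"] integral_dPsi[OF k]
  have "real m * (LINT h|lborel. (indicator {..0} h * F h ^ k) * kap h) = (LINT h|lborel. real m * ((indicator {..0} h * F h ^ k) * kap h))"
    by simp
  also have "\<dots> \<le> (LINT h|lborel. (real m + 1 + real k) * (F h ^ k * kap h) - real k * (F h ^ (k - 1) * kap h) + dPsi k h * indicator J h)"
    by (rule integral_mono) (use i1 ints ptw in auto)
  also have "\<dots> = (real m + 1 + real k) * A k - real k * A (k - 1)"
    unfolding A_def using ints by simp
  finally show ?thesis .
qed

lemma integral_reflect: "(LINT h|lborel. G (- h) * kap h) = (LINT h|lborel. G h * kap h)"
  using lborel_integral_real_affine[of "-1" "\<lambda>h. G h * kap h" 0] by (simp add: kap_even)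

definition tot :: real where "tot = (LINT h|lborel. kap h)"

text \<open>The mean of F^k + (1-F)^k under the normalised weight \<open>kap\<close>. When the
  profile comes from a radial density, this is \<open>facet_moment\<close>.\<close>

definition moment :: "nat \<Rightarrow> real" where
  "moment k = (LINT h|lborel. (F h ^ k + F (- h) ^ k) * kap h) / tot"

text \<open>\<open>J\<close> is open, so F still increases strictly beyond any point of
  \<open>J\<close> while it stays bounded by 1; symmetry gives the lower bound.\<close>

lemma F_strict: assumes h: "h \<in> J" shows "F h < 1" "0 < F h"
proof -
  have "F t < 1" if t: "t \<in> J" for t
  proof -
    obtain e where e: "e > 0" "ball t e \<subseteq> J" using J_open t open_contains_ball by blast
    then have u: "t + e/2 \<in> J" by (auto simp: dist_real_def)
    have "F t < F (t + e/2)"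
    proof (rule DERIV_pos_imp_increasing[where f=F])
      fix x assume "t \<le> x" "x \<le> t + e/2"
      then have "x \<in> J" using J_interval[OF t u] by blast
      then show "\<exists>y. DERIV F x :> y \<and> 0 < y" using F_deriv f_pos by blast
    qed (use e in simp)
    then show ?thesis using F_le_1[of "t + e/2"] by simp
  qed
  note * = this
  from *[OF h] show "F h < 1" .
  from *[of "- h"] show "0 < F h" using h by (simp add: J_sym F_sym)
qed

lemma integral_pos:
  assumes [measurable]: "G \<in> borel_measurable borel" and "\<And>h. \<bar>G h\<bar> \<le> B" and nn: "\<And>h. 0 \<le> G h" and pos: "\<And>h. h \<in> J \<Longrightarrow> 0 < G h"
  shows "0 < (LINT h|lborel. G h * kap h)"
proof -
  have int: "integrable lborel (\<lambda>h. G h * kap h)" by (rule integrable_kap_bounded) fact+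
  have "0 \<le> (LINT h|lborel. G h * kap h)" using nn kap_nonneg by (intro Bochner_Integration.integral_nonneg) simp
  moreover have "(LINT h|lborel. G h * kap h) \<noteq> 0"
  proof
    assume "(LINT h|lborel. G h * kap h) = 0"
    then have "AE h in lborel. G h * kap h = 0"
      using int nn kap_nonneg by (subst (asm) integral_nonneg_eq_0_iff_AE) auto
    then have "AE h in lborel. h \<notin> {- a 0..a 0}"
    proof (rule eventually_mono)
      fix h assume 0: "G h * kap h = 0"
      show "h \<notin> {- a 0..a 0}"
      proof
        assume "h \<in> {- a 0..a 0}"
        then have "h \<in> J" by (auto simp: J_eq)
        then have "0 < G h * kap h" using pos f_pos L_pos by (simp add: kap_eq)
        then show False using 0 by simp
      qed
    qed
    then have "{- a 0..a 0} \<in> null_sets lborel" by (subst AE_iff_null_sets) simp_all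
    then show False using a_pos[of 0] by (simp add: null_sets_def)
  qed
  ultimately show ?thesis by simp
qed

lemma tot_pos: "0 < tot"
  using integral_pos[of "\<lambda>_. 1" 1] by (simp add: tot_def)

lemma moment_A: "moment k = 2 * A k / tot"
proof -
  have i: "integrable lborel (\<lambda>h. F (- h) ^ k * kap h)"
    using F_nonneg F_le_1 by (intro integrable_kap_bounded[where B=1]) (auto intro: power_le_one)
  have "(LINT h|lborel. (F h ^ k + F (- h) ^ k) * kap h) = (LINT h|lborel. F h ^ k * kap h) + (LINT h|lborel. F (- h) ^ k * kap h)"
    using i integrable_F_power[of k] by (simp add: distrib_right)
  then show ?thesis using integral_reflect[of "\<lambda>h. F h ^ k"] by (simp add: moment_def A_def)
qed

text \<open>Since F^2 + (1-F)^2 = 1 - 2 F (1-F), the left-hand side is the mean of F (1-F).\<close>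

lemma gap_eq: "(1 - moment 2) / 2 = (LINT h|lborel. (F h * (1 - F h)) * kap h) / tot"
proof -
  have i: "integrable lborel (\<lambda>h. F h * (1 - F h) * kap h)"
    using F_nonneg F_le_1 by (intro integrable_kap_bounded[where B=1]) (auto intro: mult_le_one)
  have "(LINT h|lborel. (F h ^ 2 + F (- h) ^ 2) * kap h) = (LINT h|lborel. kap h - 2 * (F h * (1 - F h) * kap h))"
    by (rule Bochner_Integration.integral_cong) (simp_all add: F_sym power2_eq_square algebra_simps)
  also have "\<dots> = tot - 2 * (LINT h|lborel. (F h * (1 - F h)) * kap h)"
    using i kap_integrable by (simp add: tot_def)
  finally have eq: "(LINT h|lborel. (F h ^ 2 + F (- h) ^ 2) * kap h) = \<dots>" .
  have "(1 - (tot - 2 * Y) / tot) / 2 = Y / tot" for Y using tot_pos by (simp add: field_simps)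
  then show ?thesis by (simp only: moment_def eq)
qed

lemma moment_2_less_1: "moment 2 < 1"
proof -
  have "0 < (LINT h|lborel. (F h * (1 - F h)) * kap h)"
    using F_nonneg F_le_1 F_strict by (intro integral_pos[where B=1]) (auto simp: abs_mult intro: mult_le_one)
  then have "0 < (1 - moment 2) / 2" unfolding gap_eq using tot_pos by simp
  then show ?thesis by simp
qed

text \<open>Converts the gain from the half-line of non-positive h into a moment. By Jensen the mean
  of (F (1-F))^k is at least the k-th power of the mean in \<open>gap_eq\<close>; by symmetry half
  of it comes from that half-line, where F (1-F) is at most F.\<close>

theorem moment_gap:
  assumes k: "1 \<le> k"
  shows "real m * ((1 - moment 2) / 2) ^ k \<le> (real m + 1 + real k) * moment k - real k * moment (k - 1)"
proof -
  define y where "y = (1 - moment 2) / 2"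
  have y0: "0 < y" using moment_2_less_1 by (simp add: y_def)
  define G where "G h = F h * (1 - F h)" for h
  have [measurable]: "G \<in> borel_measurable borel" unfolding G_def by measurable
  have G: "0 \<le> G h" "G h \<le> 1" for h using F_nonneg[of h] F_le_1[of h] by (auto simp: G_def intro: mult_le_one)
  have iG: "integrable lborel (\<lambda>h. G h * kap h)" "integrable lborel (\<lambda>h. G h ^ k * kap h)"
    "integrable lborel (\<lambda>h. (indicator {..0} h * G h ^ k) * kap h)"
    "integrable lborel (\<lambda>h. (indicator {0..} h * G h ^ k) * kap h)"
    "integrable lborel (\<lambda>h. (indicator {..0} h * F h ^ k) * kap h)"
    using G F_nonneg F_le_1 by (intro integrable_kap_bounded[where B=1]; auto simp: indicator_def intro: power_le_one)+
  \<comment> \<open>The linear term of the tangent at y has mean 0, because y is the mean of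
    \<open>G\<close>.\<close>
  have "y ^ k * tot = (LINT h|lborel. y ^ k * kap h + real k * y ^ (k - 1) * (G h * kap h - y * kap h))"
  proof -
    have "(LINT h|lborel. y ^ k * kap h + real k * y ^ (k - 1) * (G h * kap h - y * kap h))
        = y ^ k * tot + real k * y ^ (k - 1) * ((LINT h|lborel. G h * kap h) - y * tot)"
      using iG(1) kap_integrable by (simp add: tot_def)
    moreover have "(LINT h|lborel. G h * kap h) = y * tot"
      using gap_eq tot_pos unfolding G_def y_def by simp
    ultimately show ?thesis by simp
  qed
  also have "\<dots> \<le> (LINT h|lborel. G h ^ k * kap h)"
  proof (rule integral_mono)
    fix h
    have "(y ^ k + real k * y ^ (k - 1) * (G h - y)) * kap h \<le> G h ^ k * kap h"
      using bernoulli_tangent[OF y0 G(1)] kap_nonneg by (intro mult_right_mono) auto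
    then show "y ^ k * kap h + real k * y ^ (k - 1) * (G h * kap h - y * kap h) \<le> G h ^ k * kap h"
      by (simp add: algebra_simps)
  qed (use iG kap_integrable in auto)
  \<comment> \<open>The point 0 is counted in both halves, so the step is an inequality.\<close>
  also have "\<dots> \<le> (LINT h|lborel. (indicator {..0} h * G h ^ k) * kap h + (indicator {0..} h * G h ^ k) * kap h)"
    using iG G kap_nonneg by (intro integral_mono) (auto simp: indicator_def)
  also have "\<dots> = 2 * (LINT h|lborel. (indicator {..0} h * G h ^ k) * kap h)"
  proof -
    have "(LINT h|lborel. (indicator {0..} h * G h ^ k) * kap h) = (LINT h|lborel. (indicator {..0} (- h) * G (- h) ^ k) * kap h)"
      by (rule Bochner_Integration.integral_cong) (auto simp: indicator_def G_def F_sym mult.commute)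
    also have "\<dots> = (LINT h|lborel. (indicator {..0} h * G h ^ k) * kap h)"
      by (rule integral_reflect)
    finally show ?thesis using iG by simp
  qed
  also have "\<dots> \<le> 2 * (LINT h|lborel. (indicator {..0} h * F h ^ k) * kap h)"
  proof (intro mult_left_mono integral_mono iG)
    fix h
    have "G h ^ k \<le> F h ^ k" using F_nonneg[of h] F_le_1[of h] G[of h]
      by (intro power_mono) (auto simp: G_def mult_left_le)
    then show "(indicator {..0} h * G h ^ k) * kap h \<le> (indicator {..0} h * F h ^ k) * kap h"
      using kap_nonneg by (intro mult_right_mono) (auto simp: indicator_def)
  qed simp
  finally have "real m * (y ^ k * tot) \<le> 2 * (real m * (LINT h|lborel. (indicator {..0} h * F h ^ k) * kap h))"
    by (simp add: mult_left_mono mult.left_commute)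
  also have "\<dots> \<le> 2 * ((real m + 1 + real k) * A k - real k * A (k - 1))"
    using moment_inequality[OF k] by simp
  also have "\<dots> = ((real m + 1 + real k) * moment k - real k * moment (k - 1)) * tot"
    using tot_pos by (simp add: moment_A field_simps)
  finally show ?thesis using tot_pos by (simp add: y_def[symmetric])
qed

end

section \<open>From radial densities to concave profiles\<close>

definition null_hyperplanes :: "'a::euclidean_space measure \<Rightarrow> bool" where
  "null_hyperplanes \<mu> \<longleftrightarrow> (\<forall>v c. v \<noteq> 0 \<longrightarrow> (AE x in \<mu>. v \<bullet> x \<noteq> c))"

text \<open>Reduced to linear independence of the d points. It is stronger than affine independence,
  but equally almost sure, because hyperplanes through the origin are null as well.\<close>

lemma AE_nu_nonzero:
  fixes \<mu> :: "(real^'d) measure"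
  assumes "prob_space \<mu>" "sets \<mu> = sets borel" "null_hyperplanes \<mu>"
  shows "AE x in PiM UNIV (\<lambda>_::'d. \<mu>). nu (vec_lambda x) \<noteq> 0"
proof -
  have "AE x in PiM UNIV (\<lambda>_::'d. \<mu>). det (\<chi> i. x i) \<noteq> 0"
    using assms by (intro AE_det_rows[where T="\<lambda>x. x"]) (auto simp: null_hyperplanes_def prob_space_imp_sigma_finite)
  then show ?thesis by (rule eventually_mono) (rule nu_nonzero_of_det)
qed

context radial_density begin

interpretation \<mu>: prob_space \<mu> by (rule prob)

definition C where "C = (SOME C. 0 < C \<and> (\<forall>W \<in> borel_measurable borel.
  (\<integral>\<^sup>+x. W (x $ piv) \<partial>\<mu>) = (\<integral>\<^sup>+t. W t * ennreal (C * f0 t) \<partial>lborel)))"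

lemma C_pos: "0 < C"
  and marginal: "W \<in> borel_measurable borel \<Longrightarrow> (\<integral>\<^sup>+x. W (x $ piv) \<partial>\<mu>) = (\<integral>\<^sup>+t. W t * ennreal (C * f0 t) \<partial>lborel)"
proof -
  have "0 < C \<and> (\<forall>W \<in> borel_measurable borel. (\<integral>\<^sup>+x. W (x $ piv) \<partial>\<mu>) = (\<integral>\<^sup>+t. W t * ennreal (C * f0 t) \<partial>lborel))"
    unfolding C_def by (rule someI_ex) (use marginal_exists in blast)
  then show "0 < C" "W \<in> borel_measurable borel \<Longrightarrow> (\<integral>\<^sup>+x. W (x $ piv) \<partial>\<mu>) = (\<integral>\<^sup>+t. W t * ennreal (C * f0 t) \<partial>lborel)" by auto
qed

definition F :: "real \<Rightarrow> real" where "F t = measure \<mu> {x. x $ piv < t}"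

lemma \<mu>_sets [simp]: "sets \<mu> = sets borel" and \<mu>_space [simp]: "space \<mu> = UNIV"
  by simp_all

lemma emeasure_marginal:
  assumes [measurable]: "S \<in> sets borel"
  shows "emeasure \<mu> {x. x $ piv \<in> S} = (\<integral>\<^sup>+t. indicator S t * ennreal (C * f0 t) \<partial>lborel)"
proof -
  have "emeasure \<mu> {x. x $ piv \<in> S} = (\<integral>\<^sup>+x. indicator {x. x $ piv \<in> S} x \<partial>\<mu>)"
    by (subst nn_integral_indicator) simp_all
  also have "\<dots> = (\<integral>\<^sup>+x. indicator S (x $ piv) \<partial>\<mu>)"
    by (rule nn_integral_cong) (simp add: indicator_def)
  also have "\<dots> = (\<integral>\<^sup>+t. indicator S t * ennreal (C * f0 t) \<partial>lborel)"
    by (rule marginal) simp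
  finally show ?thesis .
qed

lemma null_hyperplanes_\<mu>: "null_hyperplanes \<mu>"
  unfolding null_hyperplanes_def
proof (intro allI impI)
  fix v :: "real^'d" and k assume "v \<noteq> 0"
  from null_hyperplane[OF this, of k] show "AE x in \<mu>. v \<bullet> x \<noteq> k"
    by (subst AE_density) (auto elim: eventually_mono)
qed

lemma measure_rotation:
  assumes R: "orthogonal_transformation R" and S [measurable]: "S \<in> sets borel"
  shows "measure \<mu> {x. R x \<in> S} = measure \<mu> S"
proof -
  have [measurable]: "R \<in> borel_measurable borel"
    using R by (intro borel_measurable_linear) (simp add: orthogonal_transformation_def)
  have "emeasure \<mu> {x. R x \<in> S} = (\<integral>\<^sup>+x. ennreal (c * g (R x)) * indicator S (R x) \<partial>lborel)"
    by (subst emeasure_density) (auto simp: g_rotation[OF R] indicator_def intro!: nn_integral_cong)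
  also have "\<dots> = (\<integral>\<^sup>+x. ennreal (c * g x) * indicator S x \<partial>lborel)"
    by (rule nn_integral_orthogonal[OF R]) simp
  also have "\<dots> = emeasure \<mu> S" by (subst emeasure_density) simp_all
  finally show ?thesis by (simp add: measure_def)
qed

text \<open>A rotation carrying the pivot direction to \<open>u\<close> reduces every half-space to
  one bounded by a value of the pivot coordinate.\<close>

lemma measure_halfspace:
  assumes "norm u = 1"
  shows "measure \<mu> {y. u \<bullet> y < t} = F t"
proof -
  have "norm (axis piv 1 :: real^'d) = norm u" using assms by simp
  from orthogonal_transformation_exists[OF this]
  obtain R :: "real^'d \<Rightarrow> real^'d" where R: "orthogonal_transformation R" "R (axis piv 1) = u" by blast
  have "u \<bullet> R x = x $ piv" for x :: "real^'d"
    using R by (metis cart_eq_inner_axis inner_commute orthogonal_transformation_def)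
  then have "{x. R x \<in> {y. u \<bullet> y < t}} = {x. x $ piv < t}" by auto
  then show ?thesis using measure_rotation[OF R(1), of "{y. u \<bullet> y < t}"] by (simp add: F_def)
qed

lemma measure_halfspace':
  assumes "norm u = 1"
  shows "measure \<mu> {y. t < u \<bullet> y} = F (- t)"
  using measure_halfspace[of "- u" "- t"] assms by simp

lemma F_sym: "F (- t) = 1 - F t"
proof -
  let ?e = "axis piv 1 :: real^'d"
  have e: "norm ?e = 1" by simp
  have "AE x in \<mu>. ?e \<bullet> x \<noteq> t" using null_hyperplanes_\<mu> axis_eq_0_iff[of piv "1::real"] unfolding null_hyperplanes_def by auto
  then have "measure \<mu> {y. t < ?e \<bullet> y} = measure \<mu> {y. \<not> ?e \<bullet> y < t}"
    by (intro \<mu>.finite_measure_eq_AE) (auto elim!: eventually_mono)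
  also have "\<dots> = 1 - measure \<mu> {y. ?e \<bullet> y < t}"
    using \<mu>.prob_neg[of "\<lambda>y. ?e \<bullet> y < t"] by simp
  finally show ?thesis unfolding measure_halfspace[OF e] measure_halfspace'[OF e] .
qed

lemma F_measurable [measurable]: "F \<in> borel_measurable borel"
  by (rule borel_measurable_mono) (auto simp: mono_def F_def intro!: \<mu>.finite_measure_mono)

text \<open>On a compact interval around h inside \<open>J\<close> the marginal density is
  continuous, and F differs from its indefinite integral by a constant.\<close>

lemma F_deriv:
  assumes h: "h \<in> J"
  shows "(F has_real_derivative C * (q h * s h ^ (CARD('d) - 1))) (at h)"
proof -
  let ?f = "\<lambda>h. C * (q h * s h ^ (CARD('d) - 1))"
  obtain e where e: "e > 0" "cball h e \<subseteq> J" using J_open h open_contains_cball by blast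
  define l r where "l = h - e" and "r = h + e"
  have lr: "{l..r} \<subseteq> J" using e by (auto simp: l_def r_def cball_def dist_real_def subset_eq abs_le_iff)
  have cont: "continuous_on {l..r} ?f"
    by (intro continuous_intros continuous_on_subset[OF q_cont lr] continuous_on_subset[OF s_cont lr])
  have F_eq: "F u = F l + integral {l..u} ?f" if u: "u \<in> {l..r}" for u
  proof -
    have nn: "0 \<le> ?f t" if "t \<in> {l..u}" for t
      using that u lr C_pos q_pos[of t] s_pos[of t] by (auto simp: subset_eq less_imp_le)
    have int: "set_integrable lborel {l..u} ?f"
      using u by (intro borel_integrable_atLeastAtMost' continuous_on_subset[OF cont]) auto
    have "emeasure \<mu> {x. x $ piv \<in> {l..<u}} = (\<integral>\<^sup>+t. indicator {l..<u} t * ennreal (C * f0 t) \<partial>lborel)"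
      by (rule emeasure_marginal) simp
    also have "\<dots> = (\<integral>\<^sup>+t. ennreal (indicator {l..u} t *\<^sub>R ?f t) \<partial>lborel)"
    proof (rule nn_integral_cong_AE, rule eventually_mono[OF AE_lborel_singleton[of u]])
      fix t assume "t \<noteq> u"
      then show "indicator {l..<u} t * ennreal (C * f0 t) = ennreal (indicator {l..u} t *\<^sub>R ?f t)"
        using u lr by (auto simp: indicator_def f0_def subset_eq)
    qed
    also have "\<dots> = ennreal (LINT t|lborel. indicator {l..u} t *\<^sub>R ?f t)"
      using int nn unfolding set_integrable_def
      by (intro nn_integral_eq_integral AE_I2) (auto simp: indicator_def)
    also have "(LINT t|lborel. indicator {l..u} t *\<^sub>R ?f t) = integral {l..u} ?f"
      using set_borel_integral_eq_integral(2)[OF int] unfolding set_lebesgue_integral_def .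
    finally have "measure \<mu> {x. x $ piv \<in> {l..<u}} = integral {l..u} ?f"
    proof -
      assume "emeasure \<mu> {x. x $ piv \<in> {l..<u}} = ennreal (integral {l..u} ?f)"
      moreover have "0 \<le> integral {l..u} ?f"
        by (rule Henstock_Kurzweil_Integration.integral_nonneg[OF set_borel_integral_eq_integral(1)[OF int]]) (rule nn)
      ultimately show ?thesis by (simp add: measure_def)
    qed
    moreover have "F u = F l + measure \<mu> {x. x $ piv \<in> {l..<u}}"
      unfolding F_def using u by (subst \<mu>.finite_measure_Union[symmetric]) (auto intro!: arg_cong[where f="measure \<mu>"])
    ultimately show ?thesis by simp
  qed
  have "((\<lambda>u. integral {l..u} ?f) has_real_derivative ?f h) (at h within {l..r})"
    using e(1) by (intro integral_has_real_derivative[OF cont]) (simp add: l_def r_def)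
  from DERIV_add[OF DERIV_const this, of "F l"]
  have "((\<lambda>u. F l + integral {l..u} ?f) has_real_derivative ?f h) (at h within {l..r})"
    by (simp only: add_0)
  then have "(F has_real_derivative ?f h) (at h within {l..r})"
  proof (rule has_field_derivative_transform_within[where d=1])
    show "h \<in> {l..r}" using e(1) by (simp add: l_def r_def)
  qed (simp_all only: F_eq[symmetric] zero_less_one)
  then show ?thesis using e(1) by (simp add: at_within_Icc_at l_def r_def)
qed

lemma F_lim: "(\<lambda>n. F (a n)) \<longlonglongrightarrow> 1"
proof -
  have "(\<lambda>n. measure \<mu> {x. x $ piv < a n}) \<longlonglongrightarrow> measure \<mu> (\<Union>n. {x. x $ piv < a n})"
    using a_mono by (intro \<mu>.finite_Lim_measure_incseq) (auto simp: incseq_def le_fun_def intro: less_le_trans)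
  moreover have "measure \<mu> (\<Union>n. {x. x $ piv < a n}) = 1"
  proof -
    have "emeasure \<mu> {x. x $ piv \<in> - J} = 0"
    proof -
      have "(\<integral>\<^sup>+t. indicator (- J) t * ennreal (C * f0 t) \<partial>lborel) = (\<integral>\<^sup>+t. 0 \<partial>(lborel :: real measure))"
        by (rule nn_integral_cong) (simp add: f0_def indicator_def)
      then show ?thesis by (subst emeasure_marginal) simp_all
    qed
    then have "AE x in \<mu>. x $ piv \<in> J" by (intro AE_I[where N="{x. x $ piv \<in> - J}"]) auto
    then have "AE x in \<mu>. x \<in> (\<Union>n. {x. x $ piv < a n})"
    proof (rule eventually_mono)
      fix x :: "real^'d" assume x: "x $ piv \<in> J"
      obtain e where e: "e > 0" "ball (x $ piv) e \<subseteq> J" using J_open x open_contains_ball by blast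
      \<comment> \<open>\<open>J\<close> is open: moving slightly to the right stays in
        \<open>J\<close> and yields the strict inequality \<open>x $ piv < a n\<close>.\<close>
      then have "x $ piv + e/2 \<in> J" by (auto simp: dist_real_def)
      then obtain n where "x $ piv + e/2 \<le> a n" by (auto simp: J_eq)
      then show "x \<in> (\<Union>n. {x. x $ piv < a n})" using e(1) by (auto intro!: exI[of _ n])
    qed
    then show ?thesis by (subst \<mu>.prob_eq_1) auto
  qed
  ultimately show ?thesis by (simp add: F_def)
qed

lemma kern_integrable: "integrable lborel kern"
  using law_hd kern_nonneg by (auto intro!: integrableI_nonneg)

text \<open>L = q s^d has derivative -D0 q s^(d-1) and F has derivative C q s^(d-1). As a function
  of F, L therefore has slope -D0 / C, and monotonicity of \<open>D0\<close> becomes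
  concavity.\<close>

lemma concave_profile: "concave_profile J a (\<lambda>h. C * (q h * s h ^ (CARD('d) - 1))) F (\<lambda>h. q h * s h ^ CARD('d))
    (\<lambda>h. D0 h / C) (CARD('d) - 1) (\<lambda>h. C * kern h)"
proof
  show "open J" "incseq a" "\<And>n. 0 < a n" "J = (\<Union>n. {- a n..a n})"
    by (rule J_open a_mono a_pos J_eq)+
  show "continuous_on J (\<lambda>h. C * (q h * s h ^ (CARD('d) - 1)))" "continuous_on J (\<lambda>h. D0 h / C)"
    using C_pos by (auto intro!: continuous_intros q_cont s_cont D0_cont)
  show "\<And>h. h \<in> J \<Longrightarrow> 0 < C * (q h * s h ^ (CARD('d) - 1))" "\<And>h. h \<in> J \<Longrightarrow> 0 < q h * s h ^ CARD('d)"
    using C_pos q_pos s_pos by simp_all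
  show "\<And>h. q (- h) * s (- h) ^ CARD('d) = q h * s h ^ CARD('d)" "\<And>h. D0 (- h) / C = - (D0 h / C)"
    by (simp_all add: q_even s_even D0_odd)
  show "mono_on J (\<lambda>h. D0 h / C)"
    using D0_mono C_pos by (auto simp: mono_on_def intro!: divide_right_mono)
  show "\<And>h. h \<in> J \<Longrightarrow> ((\<lambda>h. q h * s h ^ CARD('d)) has_real_derivative - (D0 h / C * (C * (q h * s h ^ (CARD('d) - 1))))) (at h)"
    using deriv C_pos by simp
  show "\<And>h. h \<in> J \<Longrightarrow> (F has_real_derivative C * (q h * s h ^ (CARD('d) - 1))) (at h)" by (rule F_deriv)
  show "\<And>h. F (- h) = 1 - F h" by (rule F_sym)
  show "\<And>h. 0 \<le> F h" by (simp add: F_def)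
  show "F \<in> borel_measurable borel" by simp
  show "(\<lambda>n. F (a n)) \<longlonglongrightarrow> 1" by (rule F_lim)
  show "\<And>h. C * kern h = indicator J h * (C * (q h * s h ^ (CARD('d) - 1)) * (q h * s h ^ CARD('d)) ^ (CARD('d) - 1))"
    by (simp add: kern_def)
  show "\<And>h. C * kern (- h) = C * kern h"
    by (simp add: kern_def q_even s_even indicator_def J_sym)
  show "integrable lborel (\<lambda>h. C * kern h)" using kern_integrable by simp
qed

interpretation profile: concave_profile J a "\<lambda>h. C * (q h * s h ^ (CARD('d) - 1))" F "\<lambda>h. q h * s h ^ CARD('d)"
    "\<lambda>h. D0 h / C" "CARD('d) - 1" "\<lambda>h. C * kern h"
  by (rule concave_profile)

text \<open>The sign of the offset t depends on the orientation of \<open>nu X\<close>, and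
  \<open>hd\<close> forgets it. Nothing is lost, as the sum of the two powers is even in t.\<close>

lemma sides:
  assumes nu: "nu X \<noteq> 0"
  shows "measure \<mu> {y. side X y < 0} ^ k + measure \<mu> {y. side X y > 0} ^ k = F (hd X) ^ k + F (- hd X) ^ k"
proof -
  define r where "r = norm (nu X)"
  define u where "u = (1 / r) *\<^sub>R nu X"
  define t where "t = (nu X \<bullet> X $ piv) / r"
  have r: "0 < r" using nu by (simp add: r_def)
  have u: "norm u = 1" using r by (simp add: u_def r_def)
  have side: "side X y = r * (u \<bullet> y - t)" for y using r by (simp add: side_def u_def t_def inner_diff_right field_simps)
  have "{y. side X y < 0} = {y. u \<bullet> y < t}" "{y. side X y > 0} = {y. t < u \<bullet> y}"
    using r by (auto simp: side mult_less_0_iff zero_less_mult_iff)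
  then have "measure \<mu> {y. side X y < 0} = F t" "measure \<mu> {y. side X y > 0} = F (- t)"
    by (simp_all add: measure_halfspace[OF u] measure_halfspace'[OF u])
  moreover have "hd X = \<bar>t\<bar>" using r by (simp add: hd_def t_def r_def)
  ultimately show ?thesis by (cases "0 \<le> t") simp_all
qed

lemma facet_moment_eq: "facet_moment \<mu> k = profile.moment k"
proof -
  let ?G = "\<lambda>t. F t ^ k + F (- t) ^ k"
  let ?P = "PiM UNIV (\<lambda>_::'d. \<mu>)"
  interpret P: prob_space ?P using prob by (intro prob_space_PiM)
  have G: "0 \<le> ?G t" "?G t \<le> 2" for t
    using power_le_one[OF profile.F_nonneg[of t] profile.F_le_1, of k] power_le_one[OF profile.F_nonneg[of "-t"] profile.F_le_1, of k]
      profile.F_nonneg[of t] profile.F_nonneg[of "-t"] by simp_all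
  obtain K where K: "0 < K" "(\<integral>\<^sup>+h. ennreal (kern h) \<partial>lborel) = ennreal K"
    and law: "\<And>G. G \<in> borel_measurable borel \<Longrightarrow>
      ennreal K * (\<integral>\<^sup>+x. G (hd (vec_lambda x)) \<partial>?P) = (\<integral>\<^sup>+h. G \<bar>h\<bar> * ennreal (kern h) \<partial>lborel)"
    using law_hd by blast
  have [measurable]: "(\<lambda>x. vec_lambda x) \<in> measurable ?P (borel :: (real^'d^'d) measure)"
  proof -
    have "(\<lambda>x. \<chi> i. x i) \<in> borel_measurable ?P" by measurable
    then show ?thesis by simp
  qed
  have "facet_moment \<mu> k = (LINT x|?P. ?G (hd (vec_lambda x)))"
    unfolding facet_moment_def
  proof (rule integral_cong_AE)
    have sm: "(\<lambda>x. measure \<mu> {y. P (side (vec_lambda x) y)}) \<in> borel_measurable ?P"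
      if [measurable]: "Measurable.pred borel P" for P :: "real \<Rightarrow> bool"
    proof -
      have "(\<lambda>x. measure \<mu> (Pair x -` {(x, y). P (side (vec_lambda x) y)} \<inter> space \<mu>)) \<in> borel_measurable ?P"
        unfolding measure_def by measurable
      then show ?thesis by (simp add: vimage_def)
    qed
    show "(\<lambda>x. measure \<mu> {y. side (vec_lambda x) y < 0} ^ k + measure \<mu> {y. side (vec_lambda x) y > 0} ^ k) \<in> borel_measurable ?P"
      using sm[of "\<lambda>t. t < 0"] sm[of "\<lambda>t. t > 0"] by measurable
    show "AE x in ?P. measure \<mu> {y. side (vec_lambda x) y < 0} ^ k + measure \<mu> {y. side (vec_lambda x) y > 0} ^ k = ?G (hd (vec_lambda x))"
      using AE_nu_nonzero[OF prob _ null_hyperplanes_\<mu>] by (auto elim!: eventually_mono simp: sides)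
  qed measurable
  also have "\<dots> = enn2real (\<integral>\<^sup>+x. ennreal (?G (hd (vec_lambda x))) \<partial>?P)"
    using G by (intro integral_eq_nn_integral) auto
  finally have 1: "facet_moment \<mu> k = enn2real (\<integral>\<^sup>+x. ennreal (?G (hd (vec_lambda x))) \<partial>?P)" .
  have int: "integrable lborel (\<lambda>h. ?G h * kern h)"
    using profile.integrable_kap_bounded[of ?G 2] G C_pos by (simp add: mult.left_commute)
  have "ennreal K * (\<integral>\<^sup>+x. ennreal (?G (hd (vec_lambda x))) \<partial>?P) = (\<integral>\<^sup>+h. ennreal (?G \<bar>h\<bar>) * ennreal (kern h) \<partial>lborel)"
    by (rule law[of "\<lambda>t. ennreal (?G t)"]) simp
  also have "\<dots> = (\<integral>\<^sup>+h. ennreal (?G h * kern h) \<partial>lborel)"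
  proof (rule nn_integral_cong)
    fix h
    have "?G \<bar>h\<bar> = ?G h" by (cases "0 \<le> h") simp_all
    then show "ennreal (?G \<bar>h\<bar>) * ennreal (kern h) = ennreal (?G h * kern h)"
      using G kern_nonneg by (simp add: ennreal_mult)
  qed
  also have "\<dots> = ennreal (LINT h|lborel. ?G h * kern h)"
    using int G kern_nonneg by (intro nn_integral_eq_integral) auto
  finally have "enn2real (ennreal K * (\<integral>\<^sup>+x. ennreal (?G (hd (vec_lambda x))) \<partial>?P)) = (LINT h|lborel. ?G h * kern h)"
    using G kern_nonneg by (simp add: Bochner_Integration.integral_nonneg)
  then have 2: "K * facet_moment \<mu> k = (LINT h|lborel. ?G h * kern h)"
    using K by (simp add: 1 enn2real_mult)
  \<comment> \<open>The weight of the profile is C times \<open>kern\<close>; the factor C cancels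
    in the normalised moment.\<close>
  have "profile.tot = C * K"
    unfolding profile.tot_def using K kern_nonneg
    by (subst integral_mult_right_zero) (simp add: integral_eq_nn_integral)
  moreover have "(LINT h|lborel. ?G h * (C * kern h)) = C * (LINT h|lborel. ?G h * kern h)"
    by (subst integral_mult_right_zero[symmetric]) (simp add: mult.left_commute)
  ultimately show ?thesis
    unfolding profile.moment_def 2[symmetric] using C_pos K by simp
qed

theorem facet_moment_gap:
  assumes "1 \<le> k"
  shows "real (CARD('d) - 1) * ((1 - facet_moment \<mu> 2) / 2) ^ k \<le>
    (real CARD('d) + real k) * facet_moment \<mu> k - real k * facet_moment \<mu> (k - 1)"
  using profile.moment_gap[OF assms] by (simp add: facet_moment_eq of_nat_diff)

lemma facet_moment_2_less_1: "facet_moment \<mu> 2 < 1"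
  using profile.moment_2_less_1 by (simp add: facet_moment_eq)

end

text \<open>Everything that the counting argument uses about the law. The family of inequalities is
  closed under convergence of moments; strictness is recovered from the bound on the second
  moment.\<close>

definition facet_gap :: "(real^'d) measure \<Rightarrow> bool" where
  "facet_gap \<mu> \<longleftrightarrow> prob_space \<mu> \<and> sets \<mu> = sets borel \<and> null_hyperplanes \<mu> \<and> facet_moment \<mu> 2 < 1 \<and>
    (\<forall>k\<ge>1. real (CARD('d) - 1) * ((1 - facet_moment \<mu> 2) / 2) ^ k \<le>
      (real CARD('d) + real k) * facet_moment \<mu> k - real k * facet_moment \<mu> (k - 1))"

lemma (in radial_density) facet_gap_\<mu>: "facet_gap \<mu>"
  unfolding facet_gap_def using prob null_hyperplanes_\<mu> facet_moment_2_less_1 facet_moment_gap by simp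

section \<open>The classes G, H and B as radial densities\<close>

text \<open>All slices orthogonal to an axis are multiples of the central one, so no dilation
  occurs, and the slope \<open>D0\<close> is linear in h.\<close>

lemma class_G_facet_gap:
  fixes \<mu> :: "(real^'d) measure"
  assumes "\<mu> \<in> class_G" shows "facet_gap \<mu>"
proof -
  obtain \<sigma> c where \<sigma>: "\<sigma> > 0" and c: "c > 0" and p: "prob_space \<mu>"
    and \<mu>: "\<mu> = density lborel (\<lambda>x. ennreal (c * exp (- ((norm x)\<^sup>2 / (2 * \<sigma>\<^sup>2)))))"
    using assms by (auto simp: class_G_def prob_density_proportional_def)
  interpret radial_density "\<lambda>x::real^'d. exp (- ((norm x)\<^sup>2 / (2 * \<sigma>\<^sup>2)))" c "\<lambda>n. real n + 1" UNIV
    "\<lambda>h. exp (- (h\<^sup>2 / (2 * \<sigma>\<^sup>2)))" "\<lambda>_. 1" "\<lambda>h. h / \<sigma>\<^sup>2"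
  proof (rule radial_density.intro)
    show "prob_space (density lborel (\<lambda>x::real^'d. ennreal (c * exp (- ((norm x)\<^sup>2 / (2 * \<sigma>\<^sup>2))))))"
      using p \<mu> by simp
    show "UNIV = (\<Union>n. {- (real n + 1)..real n + 1})"
    proof (rule UNIV_eq_I)
      fix x :: real
      obtain n where "\<bar>x\<bar> < real n" using reals_Archimedean2 by blast
      then show "x \<in> (\<Union>n. {- (real n + 1)..real n + 1})" by (auto intro!: exI[of _ n])
    qed
    show "exp (- ((norm (rep h x))\<^sup>2 / (2 * \<sigma>\<^sup>2))) = exp (- (h\<^sup>2 / (2 * \<sigma>\<^sup>2))) * exp (- ((norm (rep 0 ((1 / 1) *\<^sub>R x)))\<^sup>2 / (2 * \<sigma>\<^sup>2)))"
      for h and x :: "real^'d"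
      unfolding norm_rep[of h x] by (simp add: add_divide_distrib exp_add[symmetric])
    show "((\<lambda>h. exp (- (h\<^sup>2 / (2 * \<sigma>\<^sup>2))) * 1 ^ CARD('d)) has_real_derivative
        - (h / \<sigma>\<^sup>2) * (exp (- (h\<^sup>2 / (2 * \<sigma>\<^sup>2))) * 1 ^ (CARD('d) - 1))) (at h)" for h
      using \<sigma> by (auto intro!: derivative_eq_intros simp: field_simps)
    show "mono_on UNIV (\<lambda>h. h / \<sigma>\<^sup>2)" by (auto simp: mono_on_def intro: divide_right_mono)
  qed (use \<sigma> c in \<open>auto simp: incseq_def orthogonal_transformation_norm intro!: continuous_intros\<close>)
  show ?thesis unfolding \<mu> by (rule facet_gap_\<mu>)
qed

text \<open>The classes H and B share the slice profile \<open>(1 + \<epsilon> h\<^sup>2 / \<sigma>\<^sup>2) powr \<gamma>\<close>, with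
  \<open>\<epsilon> = 1\<close>, \<open>\<gamma> = - \<beta>\<close> and \<open>\<epsilon> = - 1\<close>, \<open>\<gamma> = \<beta>\<close> respectively.\<close>

locale power_profile =
  fixes \<sigma> \<epsilon> \<gamma> :: real
  assumes \<sigma>_pos: "0 < \<sigma>"
begin

definition t where "t h = 1 + \<epsilon> * h\<^sup>2 / \<sigma>\<^sup>2"

lemma t_even: "t (- h) = t h" by (simp add: t_def)

lemma sqrt_t_deriv:
  assumes "0 < t h" shows "((\<lambda>h. sqrt (t h)) has_real_derivative \<epsilon> * h / \<sigma>\<^sup>2 / sqrt (t h)) (at h)"
proof -
  have "(t has_real_derivative 2 * \<epsilon> * h / \<sigma>\<^sup>2) (at h)"
    unfolding t_def[abs_def] using \<sigma>_pos by (auto intro!: derivative_eq_intros simp: field_simps)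
  then have "((\<lambda>h. sqrt (t h)) has_real_derivative inverse (sqrt (t h)) / 2 * (2 * \<epsilon> * h / \<sigma>\<^sup>2)) (at h)"
    by (rule DERIV_chain2[where f=sqrt and g=t, OF DERIV_real_sqrt[OF assms]])
  then show ?thesis by (simp add: field_simps)
qed

text \<open>The function is t^(\<gamma> + d/2); differentiating it and taking out the factor
  t^\<gamma> sqrt(t)^(d-1) leaves the slope on the right.\<close>

lemma profile_deriv:
  assumes t: "0 < t h" and d: "0 < d"
  shows "((\<lambda>h. t h powr \<gamma> * sqrt (t h) ^ d) has_real_derivative
    - (- (\<epsilon> * (2 * \<gamma> + d)) * (h / \<sigma>\<^sup>2) / sqrt (t h)) * (t h powr \<gamma> * sqrt (t h) ^ (d - 1))) (at h)"
proof -
  define s where "s = sqrt (t h)"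
  have s: "0 < s" "t h = s * s" using t by (simp_all add: s_def)
  have "(t has_real_derivative 2 * \<epsilon> * h / \<sigma>\<^sup>2) (at h)"
    unfolding t_def[abs_def] using \<sigma>_pos by (auto intro!: derivative_eq_intros simp: field_simps)
  then have dq: "((\<lambda>h. t h powr \<gamma>) has_real_derivative \<gamma> * t h powr (\<gamma> - 1) * (2 * \<epsilon> * h / \<sigma>\<^sup>2)) (at h)"
    by (rule DERIV_chain2[where f="\<lambda>z. z powr \<gamma>" and g=t, OF has_real_derivative_powr[OF t]])
  have q: "t h powr (\<gamma> - 1) = t h powr \<gamma> / (s * s)" using t s(2) by (simp add: powr_diff)
  have ds: "((\<lambda>h. sqrt (t h) ^ d) has_real_derivative real d * sqrt (t h) ^ (d - Suc 0) * (\<epsilon> * h / \<sigma>\<^sup>2 / sqrt (t h))) (at h)"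
    using DERIV_power[OF sqrt_t_deriv[OF t], of d] by (simp add: mult_ac)
  have "((\<lambda>h. t h powr \<gamma> * sqrt (t h) ^ d) has_real_derivative
      \<gamma> * t h powr (\<gamma> - 1) * (2 * \<epsilon> * h / \<sigma>\<^sup>2) * sqrt (t h) ^ d +
      real d * sqrt (t h) ^ (d - Suc 0) * (\<epsilon> * h / \<sigma>\<^sup>2 / sqrt (t h)) * t h powr \<gamma>) (at h)"
    by (rule DERIV_mult[OF dq ds])
  moreover have "\<gamma> * t h powr (\<gamma> - 1) * (2 * \<epsilon> * h / \<sigma>\<^sup>2) * sqrt (t h) ^ d +
      real d * sqrt (t h) ^ (d - Suc 0) * (\<epsilon> * h / \<sigma>\<^sup>2 / sqrt (t h)) * t h powr \<gamma>
      = - (- (\<epsilon> * (2 * \<gamma> + d)) * (h / \<sigma>\<^sup>2) / sqrt (t h)) * (t h powr \<gamma> * sqrt (t h) ^ (d - 1))"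
    unfolding q s_def[symmetric] using s(1) \<sigma>_pos d by (cases d) (simp_all add: field_simps)
  ultimately show ?thesis by simp
qed

text \<open>The derivative of h / sqrt(t) is t^(-3/2) for either sign of \<epsilon>, because t -
  \<epsilon> h^2 / \<sigma>^2 = 1. Monotonicity of the slope thus depends on the sign of
  \<open>K\<close> alone.\<close>

lemma slope_mono:
  assumes J: "\<And>x y z. x \<in> J \<Longrightarrow> y \<in> J \<Longrightarrow> x \<le> z \<Longrightarrow> z \<le> y \<Longrightarrow> z \<in> J" and t: "\<And>h. h \<in> J \<Longrightarrow> 0 < t h" and K: "0 \<le> K"
  shows "mono_on J (\<lambda>h. K * (h / \<sigma>\<^sup>2) / sqrt (t h))"
proof (rule mono_onI)
  fix x y assume xy: "x \<in> J" "y \<in> J" "x \<le> y"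
  have "x / sqrt (t x) \<le> y / sqrt (t y)"
  proof (rule DERIV_nonneg_imp_nondecreasing[OF xy(3)])
    fix h assume "x \<le> h" "h \<le> y"
    then have th: "0 < t h" using J[OF xy(1,2)] t by blast
    define s where "s = sqrt (t h)"
    have s: "0 < s" "t h = s * s" using th by (simp_all add: s_def)
    have e: "\<epsilon> * h / \<sigma>\<^sup>2 * h = s * s - 1" using s(2) by (simp add: t_def power2_eq_square)
    have "((\<lambda>h. h / sqrt (t h)) has_real_derivative (1 * sqrt (t h) - h * (\<epsilon> * h / \<sigma>\<^sup>2 / sqrt (t h))) / (sqrt (t h) * sqrt (t h))) (at h)"
      using th by (intro DERIV_divide DERIV_ident sqrt_t_deriv) auto
    moreover have "(1 * sqrt (t h) - h * (\<epsilon> * h / \<sigma>\<^sup>2 / sqrt (t h))) / (sqrt (t h) * sqrt (t h)) = 1 / (s * s * s)"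
    proof -
      have "(1 * s - h * (\<epsilon> * h / \<sigma>\<^sup>2 / s)) = (s * s - \<epsilon> * h / \<sigma>\<^sup>2 * h) / s" using s(1) by (simp add: field_simps)
      then show ?thesis unfolding s_def[symmetric] e using s(1) by simp
    qed
    ultimately show "\<exists>y. ((\<lambda>h. h / sqrt (t h)) has_real_derivative y) (at h) \<and> 0 \<le> y"
      using s(1) by (intro exI[of _ "1 / (s * s * s)"]) simp
  qed
  then have "K / \<sigma>\<^sup>2 * (x / sqrt (t x)) \<le> K / \<sigma>\<^sup>2 * (y / sqrt (t y))"
    using K by (intro mult_left_mono) auto
  then show "K * (x / \<sigma>\<^sup>2) / sqrt (t x) \<le> K * (y / \<sigma>\<^sup>2) / sqrt (t y)" by simp
qed

lemma t_cont: "continuous_on J t"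
  unfolding t_def[abs_def] using \<sigma>_pos by (intro continuous_intros) auto

lemma slice_eq:
  fixes x :: "real^'d"
  assumes t: "0 < t h"
  shows "1 + \<epsilon> * (norm (rep h x))\<^sup>2 / \<sigma>\<^sup>2 = t h * (1 + \<epsilon> * (norm (rep 0 ((1 / sqrt (t h)) *\<^sub>R x)))\<^sup>2 / \<sigma>\<^sup>2)"
proof -
  have "rep 0 ((1 / sqrt (t h)) *\<^sub>R x) = (1 / sqrt (t h)) *\<^sub>R rep 0 x"
    by (simp add: vec_eq_iff rep_nth)
  then have "(norm (rep 0 ((1 / sqrt (t h)) *\<^sub>R x)))\<^sup>2 = (norm (rep 0 x))\<^sup>2 / t h"
    using t by (simp add: power_mult_distrib power_divide)
  then show ?thesis unfolding norm_rep[of h x] using t \<sigma>_pos by (simp add: t_def field_simps)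
qed

end

lemma class_H_facet_gap:
  fixes \<mu> :: "(real^'d) measure"
  assumes "\<mu> \<in> class_H" shows "facet_gap \<mu>"
proof -
  obtain \<sigma> \<beta> c where \<sigma>: "\<sigma> > 0" and c: "c > 0" and \<beta>: "\<beta> > real CARD('d) / 2" and p: "prob_space \<mu>"
    and \<mu>: "\<mu> = density lborel (\<lambda>x. ennreal (c * (1 + (norm x)\<^sup>2 / \<sigma>\<^sup>2) powr (- \<beta>)))"
    using assms by (auto simp: class_H_def prob_density_proportional_def)
  interpret power_profile \<sigma> 1 "- \<beta>" by standard fact
  have t_pos: "0 < t h" for h by (simp add: t_def add_pos_nonneg)
  interpret radial_density "\<lambda>x::real^'d. (1 + (norm x)\<^sup>2 / \<sigma>\<^sup>2) powr (- \<beta>)" c "\<lambda>n. real n + 1" UNIV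
    "\<lambda>h. t h powr (- \<beta>)" "\<lambda>h. sqrt (t h)" "\<lambda>h. (- (1 * (2 * (- \<beta>) + CARD('d)))) * (h / \<sigma>\<^sup>2) / sqrt (t h)"
  proof (rule radial_density.intro)
    show "prob_space (density lborel (\<lambda>x::real^'d. ennreal (c * (1 + (norm x)\<^sup>2 / \<sigma>\<^sup>2) powr (- \<beta>))))"
      using p \<mu> by simp
    show "UNIV = (\<Union>n. {- (real n + 1)..real n + 1})"
    proof (rule UNIV_eq_I)
      fix x :: real
      obtain n where "\<bar>x\<bar> < real n" using reals_Archimedean2 by blast
      then show "x \<in> (\<Union>n. {- (real n + 1)..real n + 1})" by (auto intro!: exI[of _ n])
    qed
    show "(1 + (norm (rep h x))\<^sup>2 / \<sigma>\<^sup>2) powr (- \<beta>) =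
        t h powr (- \<beta>) * (1 + (norm (rep 0 ((1 / sqrt (t h)) *\<^sub>R x)))\<^sup>2 / \<sigma>\<^sup>2) powr (- \<beta>)" for h and x :: "real^'d"
      using slice_eq[OF t_pos, of h x] t_pos[of h] by (simp add: powr_mult)
    show "((\<lambda>h. t h powr (- \<beta>) * sqrt (t h) ^ CARD('d)) has_real_derivative
        - ((- (1 * (2 * (- \<beta>) + CARD('d)))) * (h / \<sigma>\<^sup>2) / sqrt (t h)) * (t h powr (- \<beta>) * sqrt (t h) ^ (CARD('d) - 1))) (at h)" for h
      by (rule profile_deriv[OF t_pos]) simp
    \<comment> \<open>Here the constant is 2 \<beta> - d, positive by the integrability condition
      \<beta> > d/2.\<close>
    show "mono_on UNIV (\<lambda>h. (- (1 * (2 * (- \<beta>) + CARD('d)))) * (h / \<sigma>\<^sup>2) / sqrt (t h))"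
      using \<beta> t_pos by (intro slope_mono) auto
    have "t h \<noteq> 0" for h using t_pos[of h] by simp
    then show "continuous_on UNIV (\<lambda>h. t h powr (- \<beta>))" "continuous_on UNIV (\<lambda>h. sqrt (t h))"
      "continuous_on UNIV (\<lambda>h. (- (1 * (2 * (- \<beta>) + CARD('d)))) * (h / \<sigma>\<^sup>2) / sqrt (t h))"
      using \<sigma> by (auto intro!: continuous_intros t_cont)
  qed (use \<sigma> c t_pos in \<open>auto simp: incseq_def orthogonal_transformation_norm t_even t_pos[THEN less_imp_neq, symmetric]\<close>)
  show ?thesis unfolding \<mu> by (rule facet_gap_\<mu>)
qed

lemma beta_facet_gap:
  fixes \<mu> :: "(real^'d) measure"
  assumes d: "CARD('d) \<ge> 2" and \<sigma>: "\<sigma> > 0" and c: "c > 0" and \<beta>: "\<beta> > -1" and p: "prob_space \<mu>"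
    and \<mu>: "\<mu> = density lborel (\<lambda>x. ennreal (c * (indicator (cball 0 \<sigma>) x * (1 - (norm x)\<^sup>2 / \<sigma>\<^sup>2) powr \<beta>)))"
  shows "facet_gap \<mu>"
proof -
  interpret power_profile \<sigma> "- 1" \<beta> by standard fact
  let ?J = "{- \<sigma><..<\<sigma>}"
  have t_iff: "0 < t h \<longleftrightarrow> h \<in> ?J" for h
  proof -
    have "0 < t h \<longleftrightarrow> h\<^sup>2 < \<sigma>\<^sup>2" using \<sigma> by (simp add: t_def)
    also have "\<dots> \<longleftrightarrow> \<bar>h\<bar> < \<sigma>" using \<sigma> abs_le_square_iff[of \<sigma> h] by (metis abs_of_pos not_le)
    also have "\<dots> \<longleftrightarrow> h \<in> ?J" by auto
    finally show ?thesis .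
  qed
  \<comment> \<open>Compact symmetric intervals exhausting the open one; the shift by 2 makes
    \<open>?a 0\<close> positive.\<close>
  let ?a = "\<lambda>n. \<sigma> * (1 - 1 / (real n + 2))"
  let ?g = "\<lambda>x::real^'d. indicator (cball 0 \<sigma>) x * (1 - (norm x)\<^sup>2 / \<sigma>\<^sup>2) powr \<beta>"
  \<comment> \<open>On the bounding sphere the base is 0 and \<open>0 powr \<beta>\<close> is 0, so
    the closed ball can be replaced by the open one with the same function.\<close>
  have g_alt: "?g x = (if 0 < 1 - (norm x)\<^sup>2 / \<sigma>\<^sup>2 then (1 - (norm x)\<^sup>2 / \<sigma>\<^sup>2) powr \<beta> else 0)" for x
  proof -
    have "\<sigma>\<^sup>2 \<le> (norm x)\<^sup>2 \<longleftrightarrow> \<sigma> \<le> norm x" using \<sigma> by (intro power_mono_iff) auto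
    then have "(norm x)\<^sup>2 < \<sigma>\<^sup>2 \<longleftrightarrow> norm x < \<sigma>" by (metis not_le)
    then have "0 < 1 - (norm x)\<^sup>2 / \<sigma>\<^sup>2 \<longleftrightarrow> norm x < \<sigma>" using \<sigma> by simp
    then show ?thesis using \<sigma> by (cases "norm x = \<sigma>") (auto simp: indicator_def)
  qed
  interpret radial_density ?g c ?a ?J
    "\<lambda>h. t h powr \<beta>" "\<lambda>h. sqrt (t h)" "\<lambda>h. (- (- 1 * (2 * \<beta> + CARD('d)))) * (h / \<sigma>\<^sup>2) / sqrt (t h)"
  proof (rule radial_density.intro)
    show "prob_space (density lborel (\<lambda>x. ennreal (c * ?g x)))"
      using p \<mu> by simp
    show "?J = (\<Union>n. {- ?a n..?a n})"
    proof (intro equalityI subsetI)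
      fix x assume "x \<in> ?J"
      then have "0 < (\<sigma> - \<bar>x\<bar>) / \<sigma>" using \<sigma> by auto
      then obtain n where n: "inverse (real (Suc n)) < (\<sigma> - \<bar>x\<bar>) / \<sigma>" using reals_Archimedean by blast
      have "1 / (real n + 2) \<le> inverse (real (Suc n))" by (simp add: field_simps)
      then have "1 / (real n + 2) \<le> (\<sigma> - \<bar>x\<bar>) / \<sigma>" using n by simp
      then have "\<sigma> * (1 / (real n + 2)) \<le> \<sigma> * ((\<sigma> - \<bar>x\<bar>) / \<sigma>)" using \<sigma> by (intro mult_left_mono) auto
      also have "\<sigma> * ((\<sigma> - \<bar>x\<bar>) / \<sigma>) = \<sigma> - \<bar>x\<bar>" using \<sigma> by simp
      finally have "\<bar>x\<bar> \<le> ?a n" by (simp add: right_diff_distrib)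
      then show "x \<in> (\<Union>n. {- ?a n..?a n})" by (auto simp: abs_le_iff intro!: exI[of _ n])
    next
      fix x assume "x \<in> (\<Union>n. {- ?a n..?a n})"
      then obtain n where "- ?a n \<le> x" "x \<le> ?a n" by auto
      moreover have "?a n < \<sigma>" using \<sigma> by simp
      ultimately show "x \<in> ?J" by simp
    qed
    show "incseq ?a" using \<sigma> by (auto simp: incseq_def frac_le)
    show "0 < ?a n" for n using \<sigma> by simp
    show "?g (rep h x) = t h powr \<beta> * ?g (rep 0 ((1 / sqrt (t h)) *\<^sub>R x))" if "h \<in> ?J" for h x
    proof -
      have th: "0 < t h" using that t_iff by blast
      define A where "A = 1 - (norm (rep 0 ((1 / sqrt (t h)) *\<^sub>R x)))\<^sup>2 / \<sigma>\<^sup>2"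
      have eq: "1 - (norm (rep h x))\<^sup>2 / \<sigma>\<^sup>2 = t h * A"
        using slice_eq[OF th, of x] by (simp add: A_def)
      have 1: "?g (rep h x) = (if 0 < t h * A then (t h * A) powr \<beta> else 0)"
        by (subst g_alt) (simp only: eq)
      have 2: "?g (rep 0 ((1 / sqrt (t h)) *\<^sub>R x)) = (if 0 < A then A powr \<beta> else 0)"
        by (subst g_alt) (simp only: A_def)
      show ?thesis unfolding 1 2 using th by (auto simp: zero_less_mult_iff powr_mult)
    qed
    show "?g (rep h x) = 0" if "h \<notin> ?J" for h x
    proof -
      have "\<sigma> \<le> \<bar>h\<bar>" using that by auto
      then have "\<sigma>\<^sup>2 \<le> (norm (rep h x))\<^sup>2"
        unfolding norm_rep[of h x] using \<sigma> abs_le_square_iff[of \<sigma> h] by (simp add: add_increasing)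
      then have "1 \<le> (norm (rep h x))\<^sup>2 / \<sigma>\<^sup>2" using \<sigma> by (subst le_divide_eq_1_pos) simp_all
      then have "\<not> 0 < 1 - (norm (rep h x))\<^sup>2 / \<sigma>\<^sup>2" by simp
      then show ?thesis by (subst g_alt) (simp only: if_False)
    qed
    show "0 < t h powr \<beta>" "0 < sqrt (t h)" if "h \<in> ?J" for h using that t_iff[of h] by auto
    show "((\<lambda>h. t h powr \<beta> * sqrt (t h) ^ CARD('d)) has_real_derivative
        - ((- (- 1 * (2 * \<beta> + CARD('d)))) * (h / \<sigma>\<^sup>2) / sqrt (t h)) * (t h powr \<beta> * sqrt (t h) ^ (CARD('d) - 1))) (at h)" if "h \<in> ?J" for h
      using that t_iff[of h] by (intro profile_deriv) simp_all
    show "mono_on ?J (\<lambda>h. (- (- 1 * (2 * \<beta> + CARD('d)))) * (h / \<sigma>\<^sup>2) / sqrt (t h))"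
    proof (rule slope_mono)
      \<comment> \<open>The constant is 2 \<beta> + d, so \<beta> > -1 suffices exactly because d is
        at least 2.\<close>
      show "0 \<le> - (- 1 * (2 * \<beta> + real CARD('d)))" using \<beta> d by simp
    qed (use t_iff in auto)
    have "t h \<noteq> 0" if "h \<in> ?J" for h using t_iff[of h] that by auto
    then show "continuous_on ?J (\<lambda>h. t h powr \<beta>)" "continuous_on ?J (\<lambda>h. sqrt (t h))"
      "continuous_on ?J (\<lambda>h. (- (- 1 * (2 * \<beta> + CARD('d)))) * (h / \<sigma>\<^sup>2) / sqrt (t h))"
      using \<sigma> by (auto intro!: continuous_intros t_cont)
  qed (use \<sigma> c in \<open>auto simp: orthogonal_transformation_norm t_even indicator_def\<close>)
  show ?thesis unfolding \<mu> by (rule facet_gap_\<mu>)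
qed

lemma class_B_facet_gap:
  fixes \<mu> :: "(real^'d) measure"
  assumes "CARD('d) \<ge> 2" "\<mu> \<in> class_B" shows "facet_gap \<mu>"
  using assms unfolding class_B_def prob_density_proportional_def by (auto intro: beta_facet_gap)

section \<open>Facets of a convex hull as sets of indices\<close>

definition rows_of :: "('i \<Rightarrow> real^'d) \<Rightarrow> ('d \<Rightarrow> 'i) \<Rightarrow> real^'d^'d" where
  "rows_of x e = (\<chi> j. x (e j))"

lemma rows_of_nth [simp]: "rows_of x e $ j = x (e j)" by (simp add: rows_of_def)

text \<open>True for empty \<open>R\<close>. This implements the convention that a hull of dimension
  d-1 is its own single facet.\<close>

definition one_sided :: "real^'d^'d \<Rightarrow> ('i \<Rightarrow> real^'d) \<Rightarrow> 'i set \<Rightarrow> bool" where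
  "one_sided X x R \<longleftrightarrow> (\<forall>j\<in>R. side X (x j) < 0) \<or> (\<forall>j\<in>R. 0 < side X (x j))"

text \<open>\<open>T\<close> is the set of indices of the points lying on some facet of the convex hull of all
  points; no general position is assumed.\<close>

definition facet_indices :: "('i \<Rightarrow> real^'d) \<Rightarrow> 'i set \<Rightarrow> 'i set \<Rightarrow> bool" where
  "facet_indices x I T \<longleftrightarrow> (\<exists>e\<in>{e. range e \<subseteq> T}. nu (rows_of x e) \<noteq> 0 \<and>
    (\<forall>i\<in>T. side (rows_of x e) (x i) = 0) \<and> one_sided (rows_of x e) x (I - T))"

lemma convex_hull_Int_hyperplane:
  fixes S :: "'a::euclidean_space set"
  assumes S: "finite S" "\<And>y. y \<in> S \<Longrightarrow> a \<bullet> y \<le> b"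
  shows "(convex hull S \<inter> {y. a \<bullet> y = b}) face_of (convex hull S)"
    "convex hull S \<inter> {y. a \<bullet> y = b} = convex hull (S \<inter> {y. a \<bullet> y = b})"
proof -
  have "convex hull S \<subseteq> {y. a \<bullet> y \<le> b}" using S(2) by (intro hull_minimal convex_halfspace_le) auto
  then show face: "(convex hull S \<inter> {y. a \<bullet> y = b}) face_of (convex hull S)"
    by (intro face_of_Int_supporting_hyperplane_le convex_convex_hull) auto
  obtain S' where S': "S' \<subseteq> S" "convex hull S \<inter> {y. a \<bullet> y = b} = convex hull S'"
    using face_of_convex_hull_subset[OF finite_imp_compact[OF S(1)] face] by blast
  have "S' \<subseteq> S \<inter> {y. a \<bullet> y = b}" using S' hull_subset[of S' convex] by blast
  then have "convex hull S' \<subseteq> convex hull (S \<inter> {y. a \<bullet> y = b})" by (rule hull_mono)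
  moreover have "convex hull (S \<inter> {y. a \<bullet> y = b}) \<subseteq> convex hull S \<inter> {y. a \<bullet> y = b}"
    by (intro Int_greatest hull_mono hull_minimal convex_hyperplane) auto
  ultimately show "convex hull S \<inter> {y. a \<bullet> y = b} = convex hull (S \<inter> {y. a \<bullet> y = b})"
    using S'(2) by blast
qed

lemma span_eq_UNIV_orthogonal:
  fixes S :: "'a::euclidean_space set"
  assumes "\<And>z. (\<And>y. y \<in> S \<Longrightarrow> z \<bullet> y = 0) \<Longrightarrow> z = 0"
  shows "span S = UNIV"
  using span_not_UNIV_orthogonal[of S] assms span_base by blast

text \<open>Together with the normal the row differences span the space, so they span at least
  dimension d-1; the hyperplane orthogonal to the normal gives the upper bound.\<close>

lemma aff_dim_rows:
  fixes X :: "real^'d^'d"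
  assumes nu: "nu X \<noteq> 0"
  shows "aff_dim (range (\<lambda>j. X $ j)) = int (CARD('d) - 1)"
proof -
  let ?D = "(\<lambda>y. y - X $ piv) ` range (\<lambda>j. X $ j)"
  have "span (insert (nu X) ?D) = UNIV"
  proof (rule span_eq_UNIV_orthogonal)
    fix z assume z: "\<And>y. y \<in> insert (nu X) ?D \<Longrightarrow> z \<bullet> y = 0"
    then have "z \<bullet> (X $ i - X $ piv) = 0" for i by auto
    from nu_parallel[OF nu this] show "z = 0" using z[of "nu X"] by simp
  qed
  then have "dim (insert (nu X) ?D) = CARD('d)" by (metis dim_UNIV DIM_cart DIM_real dim_span mult.right_neutral)
  moreover have "dim (insert (nu X) ?D) \<le> dim ?D + 1" by (simp add: dim_insert)
  moreover have "aff_dim (range (\<lambda>j. X $ j)) = int (dim ?D)"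
    by (intro aff_dim_eq_dim_subtract hull_inc) simp
  moreover have "aff_dim (range (\<lambda>j. X $ j)) \<le> aff_dim {y. nu X \<bullet> y = nu X \<bullet> X $ piv}"
    by (intro aff_dim_subset) (use nu_orthogonal[of X] in \<open>auto simp: inner_diff_right\<close>)
  moreover have "aff_dim {y. nu X \<bullet> y = nu X \<bullet> X $ piv} = int CARD('d) - 1"
    using nu by (simp add: aff_dim_hyperplane)
  ultimately show ?thesis by linarith
qed

text \<open>An affine basis of \<open>S\<close> has exactly d elements, which serve as the rows; the
  hyperplane through them contains the affine hull of \<open>S\<close>.\<close>

lemma exists_rows:
  fixes S :: "(real^'d) set"
  assumes S: "aff_dim S = int (CARD('d) - 1)"
  obtains X :: "real^'d^'d" where "\<And>j. X $ j \<in> S" "nu X \<noteq> 0" "S \<subseteq> {y. side X y = 0}"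
proof -
  obtain B where B: "B \<subseteq> S" "\<not> affine_dependent B" "affine hull S = affine hull B"
    using affine_basis_exists[of S] by blast
  have "int (card B) = aff_dim S + 1" using aff_dim_unique[of B S] B by simp
  then have card: "card B = CARD('d)" using S zero_less_card_finite[where 'a='d] by linarith
  then have "finite B" using zero_less_card_finite[where 'a='d] card_ge_0_finite by metis
  then obtain f :: "'d \<Rightarrow> real^'d" where f: "bij_betw f UNIV B"
    using finite_same_card_bij[of "UNIV::'d set" B] card by auto
  define X where "X = (\<chi> j. f j)"
  have range: "range (\<lambda>j. X $ j) = B" using f by (simp add: X_def bij_betw_def)
  let ?D = "(\<lambda>y. y - X $ piv) ` B"
  have dimD: "int (dim ?D) = aff_dim S"
    using aff_dim_eq_dim_subtract[of "X $ piv" B] range aff_dim_affine_hull[of S] aff_dim_affine_hull[of B] B(3)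
    by (metis hull_inc rangeI)
  have nu: "nu X \<noteq> 0"
  proof
    assume nu0: "nu X = 0"
    have diff: "X $ i - X $ piv \<in> ?D" for i using range by auto
    have "span ?D \<noteq> UNIV"
    proof
      assume "span ?D = UNIV"
      then have "dim ?D = CARD('d)" by (metis dim_UNIV DIM_cart DIM_real dim_span mult.right_neutral)
      then show False using dimD S zero_less_card_finite[where 'a='d] by linarith
    qed
    \<comment> \<open>The differences span dimension d-1 and y completes them to a spanning set.
      Taking y as the free vector of \<open>nu_eq_0_kernel\<close> yields a non-zero vector
      orthogonal to everything.\<close>
    then obtain y where y: "y \<noteq> 0" "\<And>z. z \<in> span ?D \<Longrightarrow> y \<bullet> z = 0" using span_not_UNIV_orthogonal by blast
    obtain z where z: "z \<noteq> 0" "y \<bullet> z = 0" "\<And>i. (X $ i - X $ piv) \<bullet> z = 0"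
      using nu_eq_0_kernel[OF nu0, of y] by blast
    have "y \<notin> span ?D" using y(1) y(2)[of y] by auto
    then have "dim (insert y ?D) = dim ?D + 1" by (simp add: dim_insert)
    then have "dim (insert y ?D) = DIM(real^'d)" using dimD S zero_less_card_finite[where 'a='d] by simp
    then have "span (insert y ?D) = UNIV" by (simp only: dim_eq_full)
    moreover have "orthogonal z w" if "w \<in> span (insert y ?D)" for w
    proof (rule orthogonal_to_span[OF that])
      fix w assume "w \<in> insert y ?D"
      then show "orthogonal z w" using z(2,3) range by (auto simp: orthogonal_def inner_commute)
    qed
    ultimately have "orthogonal z z" by blast
    then show False using z(1) by (simp add: orthogonal_def)
  qed
  have "affine {y. side X y = 0}"
  proof -
    have "{y. side X y = 0} = {y. nu X \<bullet> y = nu X \<bullet> X $ piv}" by (auto simp: side_def inner_diff_right)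
    then show ?thesis by (simp add: affine_hyperplane)
  qed
  moreover have "B \<subseteq> {y. side X y = 0}" using range by auto
  ultimately have "S \<subseteq> {y. side X y = 0}"
    using B(3) hull_subset[of S affine] hull_minimal[of B "{y. side X y = 0}" affine] by auto
  then show ?thesis using that[of X] nu range B(1) by auto
qed

lemma side_parallel:
  assumes nu: "nu X \<noteq> 0" and a: "\<And>i. a \<bullet> X $ i = b"
  obtains r where "a = r *\<^sub>R nu X" "\<And>y. a \<bullet> y - b = r * side X y"
proof -
  have "a \<bullet> (X $ i - X $ piv) = 0" for i by (simp add: inner_diff_right a)
  from nu_parallel[OF nu this] obtain r where r: "a = r *\<^sub>R nu X" by blast
  have "a \<bullet> y - b = r * side X y" for y
    using a[of piv] by (simp add: r side_def inner_diff_right right_diff_distrib)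
  then show ?thesis using r that by blast
qed

text \<open>The normal, with its sign chosen by \<open>one_sided\<close>, supports the hull exactly
  along \<open>T\<close>. The last claim recovers \<open>T\<close> from its face and makes the
  counting map injective.\<close>

lemma facet_indices_facet:
  fixes x :: "'i \<Rightarrow> real^'d"
  assumes I: "finite I" "T \<subseteq> I" and T: "facet_indices x I T"
  shows "convex hull (x ` T) face_of convex hull (x ` I)" "aff_dim (convex hull (x ` T)) = int (CARD('d) - 1)"
    "T = {i\<in>I. x i \<in> convex hull (x ` T)}"
proof -
  obtain e where e: "range e \<subseteq> T" and nu: "nu (rows_of x e) \<noteq> 0"
    and on: "\<And>i. i \<in> T \<Longrightarrow> side (rows_of x e) (x i) = 0" and one: "one_sided (rows_of x e) x (I - T)"
    using T by (auto simp: facet_indices_def)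
  let ?X = "rows_of x e"
  obtain a b where ab: "a \<noteq> 0" "\<And>i. i \<in> T \<Longrightarrow> a \<bullet> x i = b" "\<And>j. j \<in> I - T \<Longrightarrow> a \<bullet> x j < b"
  proof (cases "\<forall>j\<in>I - T. side ?X (x j) < 0")
    case True
    then show ?thesis using that[of "nu ?X" "nu ?X \<bullet> ?X $ piv"] nu on by (auto simp: side_def inner_diff_right)
  next
    case False
    then have "\<forall>j\<in>I - T. 0 < side ?X (x j)" using one by (auto simp: one_sided_def)
    then show ?thesis using that[of "- nu ?X" "- (nu ?X \<bullet> ?X $ piv)"] nu on by (auto simp: side_def inner_diff_right)
  qed
  have le: "\<And>y. y \<in> x ` I \<Longrightarrow> a \<bullet> y \<le> b" using ab(2,3) by (force intro: less_imp_le)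
  have eq: "x ` I \<inter> {y. a \<bullet> y = b} = x ` T" using ab(2,3) I(2) by force
  note hyp = convex_hull_Int_hyperplane[of "x ` I" a b, OF _ le, unfolded eq]
  show "convex hull (x ` T) face_of convex hull (x ` I)" using hyp I by simp
  have "aff_dim (x ` T) \<le> aff_dim {y. a \<bullet> y = b}" using ab(2) by (intro aff_dim_subset) auto
  moreover have "aff_dim {y. a \<bullet> y = b} = int CARD('d) - 1" using ab(1) by (simp add: aff_dim_hyperplane)
  moreover have "aff_dim (range (\<lambda>j. ?X $ j)) \<le> aff_dim (x ` T)" using e by (intro aff_dim_subset) auto
  ultimately show "aff_dim (convex hull (x ` T)) = int (CARD('d) - 1)"
    using aff_dim_rows[OF nu] zero_less_card_finite[where 'a='d] by (simp add: aff_dim_convex_hull)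
  have "convex hull (x ` T) \<subseteq> {y. a \<bullet> y = b}" using ab(2) by (intro hull_minimal convex_hyperplane) auto
  then show "T = {i\<in>I. x i \<in> convex hull (x ` T)}"
    using ab(3) I(2) hull_subset[of "x ` T" convex] by fastforce
qed

text \<open>Faces of a polyhedron are exposed. The exposing functional and \<open>nu X\<close> are
  both constant on d affinely independent points, hence proportional, so the strict inequality off
  the face turns into one-sidedness.\<close>

lemma facet_facet_indices:
  fixes x :: "'i \<Rightarrow> real^'d"
  assumes I: "finite I" and F: "F face_of convex hull (x ` I)" "aff_dim F = int (CARD('d) - 1)"
  shows "\<exists>T\<subseteq>I. facet_indices x I T \<and> F = convex hull (x ` T)"
proof -
  have "polyhedron (convex hull (x ` I))" using I by (intro polytope_imp_polyhedron polytope_convex_hull) simp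
  then have "F exposed_face_of convex hull (x ` I)" using F(1) exposed_face_of_polyhedron by blast
  then obtain a b where ab: "convex hull (x ` I) \<subseteq> {y. a \<bullet> y \<le> b}" "F = convex hull (x ` I) \<inter> {y. a \<bullet> y = b}"
    unfolding exposed_face_of_def by blast
  have le: "\<And>y. y \<in> x ` I \<Longrightarrow> a \<bullet> y \<le> b" using ab(1) hull_subset[of "x ` I" convex] by blast
  define T where "T = {i\<in>I. a \<bullet> x i = b}"
  have eq: "x ` I \<inter> {y. a \<bullet> y = b} = x ` T" by (auto simp: T_def)
  have F_eq: "F = convex hull (x ` T)"
    using convex_hull_Int_hyperplane(2)[of "x ` I" a b, OF _ le] I by (simp add: ab(2) eq)
  have "aff_dim (x ` T) = int (CARD('d) - 1)" using F(2) by (simp add: F_eq aff_dim_convex_hull)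
  then obtain X where X: "\<And>j. X $ j \<in> x ` T" "nu X \<noteq> 0" "x ` T \<subseteq> {y. side X y = 0}"
    by (rule exists_rows) blast
  have "\<forall>j. \<exists>i. i \<in> T \<and> X $ j = x i" using X(1) by blast
  then obtain e where e: "\<And>j. e j \<in> T" "\<And>j. X $ j = x (e j)" by metis
  have X_eq: "rows_of x e = X" by (simp add: vec_eq_iff e(2))
  have aX: "a \<bullet> X $ i = b" for i using e[of i] by (simp add: T_def)
  obtain r where r: "\<And>y. a \<bullet> y - b = r * side X y"
    using side_parallel[OF X(2) aX] by blast
  have "one_sided X x (I - T)"
  proof -
    have neg: "r * side X (x j) < 0" if "j \<in> I - T" for j
      using r[of "x j"] le[of "x j"] that by (auto simp: T_def)
    show ?thesis
    proof (cases "0 \<le> r")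
      case True
      then have "side X (x j) < 0" if "j \<in> I - T" for j
        using neg[OF that] by (auto simp: mult_less_0_iff)
      then show ?thesis by (auto simp: one_sided_def)
    next
      case False
      then have "0 < side X (x j)" if "j \<in> I - T" for j
        using neg[OF that] by (auto simp: mult_less_0_iff)
      then show ?thesis by (auto simp: one_sided_def)
    qed
  qed
  then have "facet_indices x I T"
    unfolding facet_indices_def using e(1) X X_eq by (intro bexI[of _ e]) auto
  then show ?thesis using F_eq by (auto simp: T_def intro!: exI[of _ T])
qed

text \<open>Valid for every configuration. The number of facets thereby becomes a finite sum of
  measurable indicators, and general position has to hold only almost surely.\<close>

theorem face_number_facets:
  fixes x :: "'i \<Rightarrow> real^'d"
  assumes I: "finite I"
  shows "face_number (CARD('d) - 1) (convex hull (x ` I)) = card {T. T \<subseteq> I \<and> facet_indices x I T}"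
proof -
  let ?f = "\<lambda>T. convex hull (x ` T)"
  have "bij_betw ?f {T. T \<subseteq> I \<and> facet_indices x I T} {F. F face_of convex hull (x ` I) \<and> aff_dim F = int (CARD('d) - 1)}"
  proof (rule bij_betw_imageI)
    show "inj_on ?f {T. T \<subseteq> I \<and> facet_indices x I T}"
    proof (rule inj_onI)
      fix S T assume S: "S \<in> {T. T \<subseteq> I \<and> facet_indices x I T}" and T: "T \<in> {T. T \<subseteq> I \<and> facet_indices x I T}"
        and eq: "?f S = ?f T"
      have "S = {i\<in>I. x i \<in> ?f S}" by (rule facet_indices_facet(3)[OF I]) (use S in simp_all)
      also have "\<dots> = {i\<in>I. x i \<in> ?f T}" by (simp only: eq)
      also have "\<dots> = T" by (rule facet_indices_facet(3)[OF I, symmetric]) (use T in simp_all)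
      finally show "S = T" .
    qed
    show "?f ` {T. T \<subseteq> I \<and> facet_indices x I T} = {F. F face_of convex hull (x ` I) \<and> aff_dim F = int (CARD('d) - 1)}"
    proof (intro equalityI subsetI)
      fix F assume "F \<in> ?f ` {T. T \<subseteq> I \<and> facet_indices x I T}"
      then obtain T where "T \<subseteq> I" "facet_indices x I T" "F = ?f T" by blast
      then show "F \<in> {F. F face_of convex hull (x ` I) \<and> aff_dim F = int (CARD('d) - 1)}"
        using facet_indices_facet(1,2)[OF I, of T x] by simp
    next
      fix F assume "F \<in> {F. F face_of convex hull (x ` I) \<and> aff_dim F = int (CARD('d) - 1)}"
      then obtain T where "T \<subseteq> I" "facet_indices x I T" "F = ?f T"
        using facet_facet_indices[OF I] by blast
      then show "F \<in> ?f ` {T. T \<subseteq> I \<and> facet_indices x I T}" by blast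
    qed
  qed
  from bij_betw_same_card[OF this] show ?thesis by (simp add: face_number_def)
qed

section \<open>General position and the expected number of facets\<close>

definition general_position :: "('i \<Rightarrow> real^'d) \<Rightarrow> 'i set \<Rightarrow> bool" where
  "general_position x I \<longleftrightarrow> (\<forall>e. inj e \<and> range e \<subseteq> I \<longrightarrow> nu (rows_of x e) \<noteq> 0 \<and>
    (\<forall>j\<in>I - range e. side (rows_of x e) (x j) \<noteq> 0))"

lemma general_positionD:
  assumes "general_position x I" "inj e" "range e \<subseteq> I"
  shows "nu (rows_of x e) \<noteq> 0" "j \<in> I \<Longrightarrow> j \<notin> range e \<Longrightarrow> side (rows_of x e) (x j) \<noteq> 0"
proof -
  have *: "nu (rows_of x e) \<noteq> 0 \<and> (\<forall>j\<in>I - range e. side (rows_of x e) (x j) \<noteq> 0)"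
    using assms(1)[unfolded general_position_def, rule_format, of e] assms(2,3) by simp
  show "nu (rows_of x e) \<noteq> 0" by (rule conjunct1[OF *])
  show "side (rows_of x e) (x j) \<noteq> 0" if "j \<in> I" "j \<notin> range e"
    using bspec[OF conjunct2[OF *], of j] that by simp
qed

definition enum :: "'i set \<Rightarrow> 'd::finite \<Rightarrow> 'i" where
  "enum T = (SOME e. bij_betw e UNIV T)"

lemma enum:
  fixes T :: "'i set"
  assumes "card T = CARD('d::finite)" shows "bij_betw (enum T :: 'd \<Rightarrow> 'i) UNIV T"
proof -
  have "finite T" using assms by (metis card_ge_0_finite zero_less_card_finite)
  then have "\<exists>e :: 'd \<Rightarrow> 'i. bij_betw e UNIV T" using assms by (intro finite_same_card_bij) auto
  then show ?thesis unfolding enum_def by (rule someI_ex)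
qed

text \<open>No further point lies on a hyperplane through d of the points, so \<open>T\<close> is
  the range of its enumeration. Any two enumerations of \<open>T\<close> give proportional normals,
  which permits the fixed choice \<open>enum T\<close>.\<close>

lemma facet_indices_general_position:
  fixes x :: "'i \<Rightarrow> real^'d"
  assumes gp: "general_position x I" and T: "T \<subseteq> I"
  shows "facet_indices x I T \<longleftrightarrow> card T = CARD('d) \<and> one_sided (rows_of x (enum T)) x (I - T)"
proof
  assume "facet_indices x I T"
  then obtain e where e: "range e \<subseteq> T" and nu: "nu (rows_of x e) \<noteq> 0"
    and on: "\<And>i. i \<in> T \<Longrightarrow> side (rows_of x e) (x i) = 0" and one: "one_sided (rows_of x e) x (I - T)"
    by (auto simp: facet_indices_def)
  have "inj e" using nu_inj[OF nu] by (auto simp: inj_def)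
  have "T = range e"
  proof (rule ccontr)
    assume "T \<noteq> range e"
    then obtain i where "i \<in> T" "i \<notin> range e" using e by auto
    then have "side (rows_of x e) (x i) \<noteq> 0"
      using e T by (intro general_positionD(2)[OF gp \<open>inj e\<close>]) auto
    then show False using on \<open>i \<in> T\<close> by simp
  qed
  then have card: "card T = CARD('d)" using \<open>inj e\<close> by (simp add: card_image)
  let ?Y = "rows_of x (enum T)" and ?X = "rows_of x e"
  have bij: "bij_betw (enum T :: 'd \<Rightarrow> 'i) UNIV T" by (rule enum[OF card])
  then have "inj (enum T :: 'd \<Rightarrow> 'i)" "range (enum T :: 'd \<Rightarrow> 'i) = T" by (auto simp: bij_betw_def)
  then have nuY: "nu ?Y \<noteq> 0" using T by (intro general_positionD(1)[OF gp]) auto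
  have "enum T i \<in> T" for i :: 'd using bij by (auto simp: bij_betw_def)
  then have "nu ?X \<bullet> ?Y $ i = nu ?X \<bullet> ?X $ piv" for i
    using on by (simp add: side_def inner_diff_right)
  then obtain r where r: "nu ?X = r *\<^sub>R nu ?Y" "\<And>y. nu ?X \<bullet> y - nu ?X \<bullet> ?X $ piv = r * side ?Y y"
    by (rule side_parallel[OF nuY]) blast
  have side: "side ?X y = r * side ?Y y" for y using r(2)[of y] by (simp add: side_def[of ?X] inner_diff_right)
  have "r \<noteq> 0" using r(1) nu by auto
  \<comment> \<open>A negative factor r exchanges the two sides, and \<open>one_sided\<close> is
    symmetric in them.\<close>
  have "one_sided ?Y x (I - T)"
  proof (cases "0 < r")
    case True
    then have "side ?X y < 0 \<longleftrightarrow> side ?Y y < 0" "0 < side ?X y \<longleftrightarrow> 0 < side ?Y y" for y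
      unfolding side by (simp_all add: mult_less_0_iff zero_less_mult_iff)
    then show ?thesis using one unfolding one_sided_def by presburger
  next
    case False
    then have "side ?X y < 0 \<longleftrightarrow> 0 < side ?Y y" "0 < side ?X y \<longleftrightarrow> side ?Y y < 0" for y
      using \<open>r \<noteq> 0\<close> unfolding side by (simp_all add: mult_less_0_iff zero_less_mult_iff)
    then show ?thesis using one unfolding one_sided_def by presburger
  qed
  then show "card T = CARD('d) \<and> one_sided ?Y x (I - T)" using card by simp
next
  assume *: "card T = CARD('d) \<and> one_sided (rows_of x (enum T)) x (I - T)"
  then have bij: "bij_betw (enum T :: 'd \<Rightarrow> 'i) UNIV T" by (intro enum) simp
  then have e: "inj (enum T :: 'd \<Rightarrow> 'i)" "range (enum T :: 'd \<Rightarrow> 'i) = T" by (auto simp: bij_betw_def)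
  have "side (rows_of x (enum T)) (x i) = 0" if "i \<in> T" for i
  proof -
    have "i \<in> range (enum T :: 'd \<Rightarrow> 'i)" using that e(2) by simp
    then obtain j :: 'd where "i = enum T j" by (rule rangeE)
    then show ?thesis using side_row[of "rows_of x (enum T)" j] by (simp only: rows_of_nth)
  qed
  moreover have "nu (rows_of x (enum T)) \<noteq> 0" using e T by (intro general_positionD(1)[OF gp]) auto
  moreover have "range (enum T :: 'd \<Rightarrow> 'i) \<subseteq> T" by (simp only: e(2) subset_refl)
  ultimately show "facet_indices x I T"
    unfolding facet_indices_def using conjunct2[OF *] by blast
qed

definition expected_facets :: "(real^'d) measure \<Rightarrow> 'i set \<Rightarrow> real" where
  "expected_facets \<mu> I = (LINT x|PiM I (\<lambda>_. \<mu>). real (face_number (CARD('d) - 1) (convex hull (x ` I))))"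

lemma finite_range_subset:
  assumes "finite T" shows "finite {e :: 'd::finite \<Rightarrow> 'i. range e \<subseteq> T}"
proof -
  have "{e :: 'd \<Rightarrow> 'i. range e \<subseteq> T} = (\<Pi>\<^sub>E j\<in>UNIV. T)" by (auto simp: PiE_def Pi_def)
  then show ?thesis using assms by (simp add: finite_PiE)
qed

lemma face_number_sum:
  fixes x :: "'i \<Rightarrow> real^'d"
  assumes "finite I"
  shows "real (face_number (CARD('d) - 1) (convex hull (x ` I))) = (\<Sum>T\<in>Pow I. of_bool (facet_indices x I T))"
proof -
  have "(\<Sum>T\<in>Pow I. of_bool (facet_indices x I T) :: real) = real (card (Pow I \<inter> {T. facet_indices x I T}))"
    using assms by (simp add: sum_of_bool_eq)
  also have "Pow I \<inter> {T. facet_indices x I T} = {T. T \<subseteq> I \<and> facet_indices x I T}" by auto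
  finally show ?thesis unfolding face_number_facets[OF assms] by (rule sym)
qed

context
  fixes \<mu> :: "(real^'d) measure" and I :: "'i set"
  assumes prob_\<mu>: "prob_space \<mu>" and sets_\<mu> [measurable_cong]: "sets \<mu> = sets borel" and null: "null_hyperplanes \<mu>"
    and I: "finite I"
begin

lemma measurable_component_\<mu>: "i \<in> K \<Longrightarrow> (\<lambda>x. x i) \<in> borel_measurable (PiM K (\<lambda>_. \<mu>))"
  using measurable_component_singleton[of i K "\<lambda>_. \<mu>"]
  unfolding measurable_cong_sets[OF refl sets_\<mu>] .

lemma measurable_rows_of:
  assumes "range e \<subseteq> K"
  shows "(\<lambda>x. rows_of x e) \<in> borel_measurable (PiM K (\<lambda>_. \<mu>))"
proof -
  have "(\<lambda>x. x (e j)) \<in> borel_measurable (PiM K (\<lambda>_. \<mu>))" for j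
    using assms by (intro measurable_component_\<mu>) auto
  then show ?thesis unfolding rows_of_def by measurable
qed

lemma measurable_one_sided:
  assumes "range e \<subseteq> I" "R \<subseteq> I"
  shows "Measurable.pred (PiM I (\<lambda>_. \<mu>)) (\<lambda>x. one_sided (rows_of x e) x R)"
proof -
  have R: "finite R" using assms I finite_subset by blast
  note [measurable] = measurable_rows_of[OF assms(1)]
  have [measurable]: "(\<lambda>x. x i) \<in> borel_measurable (PiM I (\<lambda>_. \<mu>))" if "i \<in> R" for i
    using assms(2) that by (intro measurable_component_\<mu>) auto
  have "Measurable.pred (PiM I (\<lambda>_. \<mu>)) (\<lambda>x. \<forall>i\<in>R. side (rows_of x e) (x i) < 0)"
    "Measurable.pred (PiM I (\<lambda>_. \<mu>)) (\<lambda>x. \<forall>i\<in>R. 0 < side (rows_of x e) (x i))"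
    by (intro pred_intros_finite[OF R]; measurable)+
  then show ?thesis unfolding one_sided_def by (rule pred_intros_logic)
qed

lemma measurable_facet_indices:
  assumes "T \<subseteq> I"
  shows "Measurable.pred (PiM I (\<lambda>_. \<mu>)) (\<lambda>x. facet_indices x I T)"
proof -
  have T: "finite T" using assms I finite_subset by blast
  have "Measurable.pred (PiM I (\<lambda>_. \<mu>)) (\<lambda>x. nu (rows_of x e) \<noteq> 0 \<and>
      (\<forall>i\<in>T. side (rows_of x e) (x i) = 0) \<and> one_sided (rows_of x e) x (I - T))" if e: "range e \<subseteq> T" for e
  proof -
    have eI: "range e \<subseteq> I" using e assms by auto
    note [measurable] = measurable_rows_of[OF eI]
    have [measurable]: "(\<lambda>x. x i) \<in> borel_measurable (PiM I (\<lambda>_. \<mu>))" if "i \<in> T" for i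
      using assms that by (intro measurable_component_\<mu>) auto
    have [measurable]: "Measurable.pred (PiM I (\<lambda>_. \<mu>)) (\<lambda>x. \<forall>i\<in>T. side (rows_of x e) (x i) = 0)"
      by (intro pred_intros_finite[OF T]) measurable
    have [measurable]: "Measurable.pred (PiM I (\<lambda>_. \<mu>)) (\<lambda>x. one_sided (rows_of x e) x (I - T))"
      by (rule measurable_one_sided[OF eI]) auto
    show ?thesis by measurable
  qed
  then show ?thesis unfolding facet_indices_def
    by (intro pred_intros_finite(4)[OF finite_range_subset[OF T]]) simp
qed

lemma measurable_face_number:
  "(\<lambda>x. real (face_number (CARD('d) - 1) (convex hull (x ` I)))) \<in> borel_measurable (PiM I (\<lambda>_. \<mu>))"
proof -
  have "(\<lambda>x. \<Sum>T\<in>Pow I. of_bool (facet_indices x I T) :: real) \<in> borel_measurable (PiM I (\<lambda>_. \<mu>))"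
  proof (rule borel_measurable_sum)
    fix T assume "T \<in> Pow I"
    then have [measurable]: "Measurable.pred (PiM I (\<lambda>_. \<mu>)) (\<lambda>x. facet_indices x I T)"
      by (intro measurable_facet_indices) auto
    show "(\<lambda>x. of_bool (facet_indices x I T) :: real) \<in> borel_measurable (PiM I (\<lambda>_. \<mu>))"
      unfolding of_bool_def by measurable
  qed
  then show ?thesis unfolding face_number_sum[OF I] .
qed

lemma reindex_rows:
  assumes "inj e" "range e \<subseteq> K"
  shows "distr (PiM K (\<lambda>_. \<mu>)) (PiM UNIV (\<lambda>_::'d. \<mu>)) (\<lambda>x j. x (e j)) = PiM UNIV (\<lambda>_. \<mu>)"
  using distr_PiM_reindex[of K "\<lambda>_. \<mu>" e UNIV] assms prob_\<mu> by (auto simp: restrict_def)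

lemma measurable_reindex:
  assumes "range e \<subseteq> K"
  shows "(\<lambda>x j. x (e j)) \<in> measurable (PiM K (\<lambda>_. \<mu>)) (PiM UNIV (\<lambda>_::'d. \<mu>))"
  by (rule measurable_PiM_single') (use assms in \<open>auto intro!: measurable_component_singleton simp: space_PiM\<close>)

lemma AE_nu_rows_of:
  assumes "inj e" "range e \<subseteq> K"
  shows "AE x in PiM K (\<lambda>_. \<mu>). nu (rows_of x e) \<noteq> 0"
proof -
  have "AE y in distr (PiM K (\<lambda>_. \<mu>)) (PiM UNIV (\<lambda>_::'d. \<mu>)) (\<lambda>x j. x (e j)). nu (vec_lambda y) \<noteq> 0"
    unfolding reindex_rows[OF assms] by (rule AE_nu_nonzero[OF prob_\<mu> sets_\<mu> null])
  from AE_distrD[OF measurable_reindex[OF assms(2)] this] show ?thesis by (simp add: rows_of_def)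
qed

interpretation \<mu>: prob_space \<mu> by (rule prob_\<mu>)
interpretation P: product_sigma_finite "\<lambda>_::'i. \<mu>" by standard

text \<open>Fubini in the coordinate j: with the points of e fixed, the extra point has to avoid a
  single hyperplane, which is null.\<close>

lemma AE_side_insert:
  fixes e :: "'d \<Rightarrow> 'i"
  assumes e: "inj e" "j \<notin> range e"
  shows "AE x in PiM (insert j (range e)) (\<lambda>_. \<mu>). side (rows_of x e) (x j) \<noteq> (0::real)"
proof -
  let ?K = "insert j (range e)"
  note [measurable] = measurable_rows_of[of e ?K, OF subset_insertI] measurable_component_\<mu>[of j ?K, OF insertI1]
  let ?f = "\<lambda>x. indicator {0::real} (side (rows_of x e) (x j)) :: ennreal"
  have F: "?f \<in> borel_measurable (PiM ?K (\<lambda>_. \<mu>))" by measurable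
  have "(\<integral>\<^sup>+y. ?f (x(j := y)) \<partial>\<mu>) = 0" if x: "nu (rows_of x e) \<noteq> 0" for x
  proof -
    have "rows_of (x(j := y)) e = rows_of x e" for y using e(2) by (auto simp: rows_of_def vec_eq_iff)
    moreover have "AE y in \<mu>. side (rows_of x e) y \<noteq> 0"
      using null x unfolding null_hyperplanes_def
      by (auto simp: side_def inner_diff_right dest!: spec[of _ "nu (rows_of x e)"])
    ultimately have "(\<integral>\<^sup>+y. ?f (x(j := y)) \<partial>\<mu>) = (\<integral>\<^sup>+y. 0 \<partial>\<mu>)"
      by (intro nn_integral_cong_AE) (auto elim!: eventually_mono)
    then show ?thesis by simp
  qed
  then have "(\<integral>\<^sup>+x. (\<integral>\<^sup>+y. ?f (x(j := y)) \<partial>\<mu>) \<partial>PiM (range e) (\<lambda>_. \<mu>)) = (\<integral>\<^sup>+x. 0 \<partial>PiM (range e) (\<lambda>_. \<mu>))"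
    using AE_nu_rows_of[OF e(1) subset_refl] by (intro nn_integral_cong_AE) (auto elim!: eventually_mono)
  then have "(\<integral>\<^sup>+x. ?f x \<partial>PiM ?K (\<lambda>_. \<mu>)) = 0"
    using e(2) by (subst P.product_nn_integral_insert[OF _ _ F]) simp_all
  then have "AE x in PiM ?K (\<lambda>_. \<mu>). ?f x = 0" by (subst (asm) nn_integral_0_iff_AE[OF F])
  then show ?thesis by (rule eventually_mono) (simp add: indicator_def split: if_splits)
qed

text \<open>There are finitely many conditions, each involving only the coordinates in the range of
  e and possibly one more index; the marginal law on these coordinates is again a product.\<close>

lemma AE_general_position: "AE x in PiM I (\<lambda>_. \<mu>). general_position x I"
proof -
  let ?E = "{e :: 'd \<Rightarrow> 'i. range e \<subseteq> I}"
  have "AE x in PiM I (\<lambda>_. \<mu>). inj e \<longrightarrow> nu (rows_of x e) \<noteq> 0 \<and> (\<forall>j\<in>I - range e. side (rows_of x e) (x j) \<noteq> 0)"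
    if e: "e \<in> ?E" for e
  proof (cases "inj e")
    case True
    have 1: "AE x in PiM I (\<lambda>_. \<mu>). nu (rows_of x e) \<noteq> 0" using AE_nu_rows_of[OF True] e by simp
    have "AE x in PiM I (\<lambda>_. \<mu>). side (rows_of x e) (x j) \<noteq> 0" if j: "j \<in> I - range e" for j
    proof -
      let ?K = "insert j (range e)"
      have K: "?K \<subseteq> I" using e j by auto
      have meas: "(\<lambda>x. restrict x ?K) \<in> measurable (PiM I (\<lambda>_. \<mu>)) (PiM ?K (\<lambda>_. \<mu>))"
        using K by (rule measurable_restrict_subset)
      have d: "distr (PiM I (\<lambda>_. \<mu>)) (PiM ?K (\<lambda>_. \<mu>)) (\<lambda>x. restrict x ?K) = PiM ?K (\<lambda>_. \<mu>)"
        using distr_PiM_reindex[of I "\<lambda>_. \<mu>" id ?K] K prob_\<mu> by (auto simp: restrict_def Pi_iff subset_eq)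
      have "AE x in distr (PiM I (\<lambda>_. \<mu>)) (PiM ?K (\<lambda>_. \<mu>)) (\<lambda>x. restrict x ?K). side (rows_of x e) (x j) \<noteq> 0"
        unfolding d using AE_side_insert[OF True, of j] j by simp
      from AE_distrD[OF meas this] show ?thesis by (simp add: rows_of_def)
    qed
    then have "AE x in PiM I (\<lambda>_. \<mu>). \<forall>j\<in>I - range e. side (rows_of x e) (x j) \<noteq> 0"
      using I by (intro AE_finite_allI) auto
    with 1 show ?thesis by eventually_elim simp
  qed simp
  then have "AE x in PiM I (\<lambda>_. \<mu>). \<forall>e\<in>?E. inj e \<longrightarrow> nu (rows_of x e) \<noteq> 0 \<and> (\<forall>j\<in>I - range e. side (rows_of x e) (x j) \<noteq> 0)"
    by (intro AE_finite_allI finite_range_subset[OF I]) auto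
  then show ?thesis by (rule eventually_mono) (simp add: general_position_def)
qed

lemma measurable_sides:
  "(\<lambda>X. measure \<mu> {y. side X y < 0}) \<in> borel_measurable borel"
  "(\<lambda>X. measure \<mu> {y. 0 < side X y}) \<in> borel_measurable borel"
proof -
  have sp: "space \<mu> = UNIV" using sets_eq_imp_space_eq[OF sets_\<mu>] by simp
  have "(\<lambda>X. measure \<mu> (Pair X -` {(X, y). P (side X y)})) \<in> borel_measurable borel"
    if [measurable]: "Measurable.pred borel P" for P
  proof -
    have "{(X, y). P (side X y)} \<in> sets (borel \<Otimes>\<^sub>M \<mu>)"
    proof -
      have "Measurable.pred (borel \<Otimes>\<^sub>M \<mu>) (\<lambda>(X, y). P (side X y))" by measurable
      then show ?thesis by (auto simp: pred_def space_pair_measure sp split_beta')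
    qed
    then show ?thesis unfolding measure_def by (intro measurable_compose[OF \<mu>.measurable_emeasure_Pair]) auto
  qed
  from this[of "\<lambda>t. t < 0"] this[of "\<lambda>t. 0 < t"]
  show "(\<lambda>X. measure \<mu> {y. side X y < 0}) \<in> borel_measurable borel"
    "(\<lambda>X. measure \<mu> {y. 0 < side X y}) \<in> borel_measurable borel" by (simp_all add: vimage_def)
qed

text \<open>Given the points of \<open>T\<close>, the remaining ones are independent of them and of
  each other, so each side contributes a power of its mass. The two events are disjoint because some
  point remains.\<close>

lemma prob_one_sided:
  assumes T: "T \<subseteq> I" "card T = CARD('d)" and R: "I - T \<noteq> {}"
  shows "measure (PiM I (\<lambda>_. \<mu>)) {x \<in> space (PiM I (\<lambda>_. \<mu>)). one_sided (rows_of x (enum T)) x (I - T)} = facet_moment \<mu> (card (I - T))"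
proof -
  let ?e = "enum T :: 'd \<Rightarrow> 'i" and ?R = "I - T" and ?r = "card (I - T)"
  have sp: "space \<mu> = UNIV" using sets_eq_imp_space_eq[OF sets_\<mu>] by simp
  have fin: "finite T" "finite ?R" using I T finite_subset by auto
  have bij: "bij_betw ?e UNIV T" by (rule enum[OF T(2)])
  then have inj: "inj ?e" and ran: "range ?e = T" by (simp_all add: bij_betw_def)
  have I_eq: "T \<union> ?R = I" using T by auto
  let ?f = "\<lambda>x. indicator {x. one_sided (rows_of x ?e) x ?R} x :: ennreal"
  have pred: "Measurable.pred (PiM I (\<lambda>_. \<mu>)) (\<lambda>x. one_sided (rows_of x ?e) x ?R)"
    using ran T by (intro measurable_one_sided) auto
  have F: "?f \<in> borel_measurable (PiM (T \<union> ?R) (\<lambda>_. \<mu>))"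
    unfolding I_eq using pred by measurable
  let ?p = "\<lambda>X. measure \<mu> {y. side X y < 0} ^ ?r + measure \<mu> {y. 0 < side X y} ^ ?r"
  have inner: "(\<integral>\<^sup>+y. ?f (merge T ?R (x, y)) \<partial>PiM ?R (\<lambda>_. \<mu>)) = ennreal (?p (rows_of x ?e))" for x
  proof -
    let ?X = "rows_of x ?e"
    let ?A = "\<Pi>\<^sub>E i\<in>?R. {y. side ?X y < 0}" and ?B = "\<Pi>\<^sub>E i\<in>?R. {y. 0 < side ?X y}"
    have hs: "{y. side ?X y < 0} \<in> sets \<mu>" "{y. 0 < side ?X y} \<in> sets \<mu>"
      unfolding sets_\<mu> by measurable
    have "?e j \<in> T" for j using ran by auto
    then have rows: "rows_of (merge T ?R (x, y)) ?e = ?X" for y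
      by (simp add: rows_of_def vec_eq_iff merge_def)
    have "(\<integral>\<^sup>+y. ?f (merge T ?R (x, y)) \<partial>PiM ?R (\<lambda>_. \<mu>)) = (\<integral>\<^sup>+y. indicator (?A \<union> ?B) y \<partial>PiM ?R (\<lambda>_. \<mu>))"
    proof (rule nn_integral_cong)
      fix y assume "y \<in> space (PiM ?R (\<lambda>_. \<mu>))"
      then have "y \<in> extensional ?R" by (simp add: space_PiM PiE_def)
      then have "one_sided ?X (merge T ?R (x, y)) ?R \<longleftrightarrow> y \<in> ?A \<union> ?B"
        by (auto simp: one_sided_def merge_def PiE_iff)
      then show "?f (merge T ?R (x, y)) = indicator (?A \<union> ?B) y"
        by (simp only: indicator_def rows mem_Collect_eq)
    qed
    also have "\<dots> = emeasure (PiM ?R (\<lambda>_. \<mu>)) (?A \<union> ?B)"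
      using hs fin by (intro nn_integral_indicator sets.Un sets_PiM_I_finite) auto
    also have "\<dots> = emeasure (PiM ?R (\<lambda>_. \<mu>)) ?A + emeasure (PiM ?R (\<lambda>_. \<mu>)) ?B"
    proof (rule plus_emeasure[symmetric])
      obtain i where "i \<in> ?R" using R by blast
      then have "side ?X (y i) < 0" "0 < side ?X (y i)" if "y \<in> ?A \<inter> ?B" for y
        using that by (auto simp: PiE_iff)
      then show "?A \<inter> ?B = {}" by (meson equals0I less_asym)
    qed (use hs fin in \<open>auto intro!: sets_PiM_I_finite\<close>)
    also have "\<dots> = emeasure \<mu> {y. side ?X y < 0} ^ ?r + emeasure \<mu> {y. 0 < side ?X y} ^ ?r"
      using hs by (subst (1 2) P.emeasure_PiM[OF fin(2)]) simp_all
    also have "\<dots> = ennreal (?p ?X)"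
      by (simp add: \<mu>.emeasure_eq_measure ennreal_power)
    finally show ?thesis .
  qed
  have pm [measurable]: "?p \<in> borel_measurable borel" using measurable_sides by measurable
  have vl: "(\<lambda>x. vec_lambda x) \<in> borel_measurable (PiM UNIV (\<lambda>_::'d. \<mu>))"
  proof -
    have "(\<lambda>x. rows_of x (\<lambda>j. j)) \<in> borel_measurable (PiM UNIV (\<lambda>_::'d. \<mu>))"
      unfolding rows_of_def by (intro measurable_vec_lambda)
        (rule measurable_component_singleton[of _ UNIV "\<lambda>_. \<mu>", unfolded measurable_cong_sets[OF refl sets_\<mu>], OF UNIV_I])
    then show ?thesis by (simp add: rows_of_def)
  qed
  have "emeasure (PiM I (\<lambda>_. \<mu>)) {x \<in> space (PiM I (\<lambda>_. \<mu>)). one_sided (rows_of x ?e) x ?R} = (\<integral>\<^sup>+x. ?f x \<partial>PiM I (\<lambda>_. \<mu>))"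
  proof -
    let ?U = "{x \<in> space (PiM I (\<lambda>_. \<mu>)). one_sided (rows_of x ?e) x ?R}"
    have "(\<integral>\<^sup>+x. indicator ?U x \<partial>PiM I (\<lambda>_. \<mu>)) = emeasure (PiM I (\<lambda>_. \<mu>)) ?U"
      using pred by (intro nn_integral_indicator) (simp add: pred_def)
    moreover have "(\<integral>\<^sup>+x. indicator ?U x \<partial>PiM I (\<lambda>_. \<mu>)) = (\<integral>\<^sup>+x. ?f x \<partial>PiM I (\<lambda>_. \<mu>))"
      by (rule nn_integral_cong) (simp add: indicator_def)
    ultimately show ?thesis by simp
  qed
  also have "\<dots> = (\<integral>\<^sup>+x. \<integral>\<^sup>+y. ?f (merge T ?R (x, y)) \<partial>PiM ?R (\<lambda>_. \<mu>) \<partial>PiM T (\<lambda>_. \<mu>))"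
    using P.product_nn_integral_fold[of T ?R ?f, OF _ fin F] unfolding I_eq by auto
  also have "\<dots> = (\<integral>\<^sup>+x. ennreal (?p (rows_of x ?e)) \<partial>PiM T (\<lambda>_. \<mu>))" unfolding inner ..
  also have "\<dots> = (\<integral>\<^sup>+z. ennreal (?p (vec_lambda z)) \<partial>distr (PiM T (\<lambda>_. \<mu>)) (PiM UNIV (\<lambda>_::'d. \<mu>)) (\<lambda>x j. x (?e j)))"
  proof (subst nn_integral_distr)
    show "(\<lambda>x j. x (?e j)) \<in> measurable (PiM T (\<lambda>_. \<mu>)) (PiM UNIV (\<lambda>_::'d. \<mu>))"
      by (rule measurable_reindex) (simp only: ran subset_refl)
    show "(\<lambda>x. ennreal (?p (vec_lambda x))) \<in> borel_measurable (distr (PiM T (\<lambda>_. \<mu>)) (PiM UNIV (\<lambda>_::'d. \<mu>)) (\<lambda>x j. x (?e j)))"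
      unfolding measurable_distr_eq1 by (rule measurable_compose[OF measurable_compose[OF vl pm] measurable_ennreal])
  qed (simp only: rows_of_def)
  also have "\<dots> = (\<integral>\<^sup>+z. ennreal (?p (vec_lambda z)) \<partial>PiM UNIV (\<lambda>_::'d. \<mu>))"
    using reindex_rows[OF inj, of T] ran by simp
  also have "\<dots> = ennreal (facet_moment \<mu> ?r)"
    unfolding facet_moment_def
  proof (rule nn_integral_eq_integral)
    interpret U: prob_space "PiM UNIV (\<lambda>_::'d. \<mu>)" using prob_\<mu> by (intro prob_space_PiM)
    have "\<bar>?p X\<bar> \<le> 2" for X
      using power_le_one[OF measure_nonneg \<mu>.prob_le_1, of "{y. side X y < 0}" ?r] power_le_one[OF measure_nonneg \<mu>.prob_le_1, of "{y. 0 < side X y}" ?r]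
      by simp
    then show "integrable (PiM UNIV (\<lambda>_::'d. \<mu>)) (\<lambda>z. ?p (vec_lambda z))"
      by (intro U.integrable_const_bound[where B=2] measurable_compose[OF vl pm]) auto
  qed simp
  finally show ?thesis
    by (simp add: measure_def facet_moment_def Bochner_Integration.integral_nonneg)
qed

lemma face_number_general_position:
  assumes "general_position x I"
  shows "real (face_number (CARD('d) - 1) (convex hull (x ` I))) =
    (\<Sum>T\<in>{T. T \<subseteq> I \<and> card T = CARD('d)}. of_bool (one_sided (rows_of x (enum T :: 'd \<Rightarrow> 'i)) x (I - T)))"
proof -
  have "{T. T \<subseteq> I \<and> facet_indices x I T} = {T. T \<subseteq> I \<and> card T = CARD('d)} \<inter> {T. one_sided (rows_of x (enum T :: 'd \<Rightarrow> 'i)) x (I - T)}"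
    using facet_indices_general_position[OF assms] by auto
  then show ?thesis
    unfolding face_number_facets[OF I] using I by (simp add: sum_of_bool_eq)
qed

text \<open>The strict inequality matters: for d points nothing remains to be placed, both sides of
  \<open>one_sided\<close> hold at once, and \<open>facet_moment\<close> at 0 would count the single
  facet twice.\<close>

theorem expected_facets_eq:
  assumes "CARD('d) < card I"
  shows "expected_facets \<mu> I = real (card I choose CARD('d)) * facet_moment \<mu> (card I - CARD('d))"
proof -
  let ?Q = "PiM I (\<lambda>_. \<mu>)" and ?S = "{T. T \<subseteq> I \<and> card T = CARD('d)}"
  let ?one = "\<lambda>T x. one_sided (rows_of x (enum T :: 'd \<Rightarrow> 'i)) x (I - T)"
  interpret Q: prob_space ?Q using prob_\<mu> by (intro prob_space_PiM)
  have ran: "range (enum T :: 'd \<Rightarrow> 'i) = T" if "T \<in> ?S" for T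
    using enum[where 'd='d, of T] that by (auto simp: bij_betw_def)
  have pred [measurable]: "Measurable.pred ?Q (?one T)" if "T \<in> ?S" for T
    using ran[OF that] that by (intro measurable_one_sided) auto
  have meas: "(\<lambda>x. of_bool (?one T x) :: real) \<in> borel_measurable ?Q" if "T \<in> ?S" for T
    using pred[OF that] unfolding of_bool_def by measurable
  have int: "integrable ?Q (\<lambda>x. of_bool (?one T x) :: real)" if "T \<in> ?S" for T
    using meas[OF that] by (intro Q.integrable_const_bound[where B=1]) auto
  have "expected_facets \<mu> I = (LINT x|?Q. (\<Sum>T\<in>?S. of_bool (?one T x)))"
    unfolding expected_facets_def
  proof (rule integral_cong_AE[OF measurable_face_number])
    show "(\<lambda>x. \<Sum>T\<in>?S. of_bool (?one T x) :: real) \<in> borel_measurable ?Q"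
      by (rule borel_measurable_sum[OF meas])
    show "AE x in ?Q. real (face_number (CARD('d) - 1) (convex hull (x ` I))) = (\<Sum>T\<in>?S. of_bool (?one T x))"
      using AE_general_position by (rule eventually_mono) (rule face_number_general_position)
  qed
  also have "\<dots> = (\<Sum>T\<in>?S. (LINT x|?Q. of_bool (?one T x)))"
    by (rule Bochner_Integration.integral_sum[OF int])
  also have "\<dots> = (\<Sum>T\<in>?S. facet_moment \<mu> (card I - CARD('d)))"
  proof (rule sum.cong[OF refl])
    fix T assume T: "T \<in> ?S"
    then have fT: "finite T" using I finite_subset by auto
    have cR: "card (I - T) = card I - CARD('d)" using T fT by (simp add: card_Diff_subset)
    then have "I - T \<noteq> {}" using assms by (metis card.empty diff_is_0_eq not_le)
    note prob_one_sided[OF _ _ this]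
    moreover have "(LINT x|?Q. of_bool (?one T x)) = measure ?Q {x \<in> space ?Q. ?one T x}"
    proof -
      have "(LINT x|?Q. of_bool (?one T x)) = (LINT x|?Q. indicator {x \<in> space ?Q. ?one T x} x)"
        by (rule Bochner_Integration.integral_cong) (auto simp: indicator_def)
      also have "\<dots> = measure ?Q {x \<in> space ?Q. ?one T x}" using pred[OF T] by (simp add: pred_def)
      finally show ?thesis .
    qed
    ultimately show "(LINT x|?Q. of_bool (?one T x)) = facet_moment \<mu> (card I - CARD('d))"
      using T cR by simp
  qed
  also have "\<dots> = real (card I choose CARD('d)) * facet_moment \<mu> (card I - CARD('d))"
    using n_subsets[OF I, of "CARD('d)"] by simp
  finally show ?thesis .
qed

lemma expected_facets_simplex:
  assumes "card I = CARD('d)" shows "expected_facets \<mu> I = 1"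
proof -
  interpret Q: prob_space "PiM I (\<lambda>_. \<mu>)" using prob_\<mu> by (intro prob_space_PiM)
  have "{T. T \<subseteq> I \<and> card T = CARD('d)} = {I}" using assms card_subset_eq[OF I] by auto
  then have "real (face_number (CARD('d) - 1) (convex hull (x ` I))) = 1" if "general_position x I" for x :: "'i \<Rightarrow> real^'d"
    using face_number_general_position[OF that] by (simp add: one_sided_def)
  then have "expected_facets \<mu> I = (LINT x|PiM I (\<lambda>_. \<mu>). 1)"
    unfolding expected_facets_def using AE_general_position
    by (intro integral_cong_AE[OF measurable_face_number]) (auto elim: eventually_mono)
  then show ?thesis by (simp add: Q.prob_space)
qed

end

text \<open>Almost surely the hyperplane is well defined and has mass 0, so its two sides share the
  total mass 1.\<close>

lemma facet_moment_1:
  fixes \<mu> :: "(real^'d) measure"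
  assumes p: "prob_space \<mu>" and s: "sets \<mu> = sets borel" and n: "null_hyperplanes \<mu>"
  shows "facet_moment \<mu> 1 = 1"
proof -
  interpret prob_space \<mu> by fact
  interpret U: prob_space "PiM UNIV (\<lambda>_::'d. \<mu>)" using p by (intro prob_space_PiM)
  have sp: "space \<mu> = UNIV" using sets_eq_imp_space_eq[OF s] by simp
  have one: "measure \<mu> {y. side X y < 0} ^ 1 + measure \<mu> {y. 0 < side X y} ^ 1 = 1" if X: "nu X \<noteq> 0" for X
  proof -
    have hs: "{y. side X y < 0} \<in> sets \<mu>" "{y. 0 < side X y} \<in> sets \<mu>" unfolding s by measurable
    have "AE y in \<mu>. nu X \<bullet> y \<noteq> nu X \<bullet> X $ piv" using n X by (simp add: null_hyperplanes_def)
    then have "AE y in \<mu>. y \<in> {y. side X y < 0} \<union> {y. 0 < side X y}"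
      by (rule eventually_mono) (auto simp: side_def inner_diff_right)
    then have "measure \<mu> ({y. side X y < 0} \<union> {y. 0 < side X y}) = 1"
      using hs by (subst prob_eq_1) auto
    then show ?thesis using hs by (subst (asm) finite_measure_Union) auto
  qed
  have "facet_moment \<mu> 1 = (LINT x|PiM UNIV (\<lambda>_::'d. \<mu>). 1)"
    unfolding facet_moment_def
  proof (rule integral_cong_AE)
    have vl: "(\<lambda>x. vec_lambda x) \<in> borel_measurable (PiM UNIV (\<lambda>_::'d. \<mu>))"
    proof -
      have "(\<lambda>x. \<chi> j. x j) \<in> borel_measurable (PiM UNIV (\<lambda>_::'d. \<mu>))"
        by (intro measurable_vec_lambda)
          (rule measurable_component_singleton[of _ UNIV "\<lambda>_. \<mu>", unfolded measurable_cong_sets[OF refl s], OF UNIV_I])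
      then show ?thesis by simp
    qed
    show "(\<lambda>x. measure \<mu> {y. side (vec_lambda x) y < 0} ^ 1 + measure \<mu> {y. 0 < side (vec_lambda x) y} ^ 1) \<in> borel_measurable (PiM UNIV (\<lambda>_::'d. \<mu>))"
      by (intro borel_measurable_add borel_measurable_power measurable_compose[OF vl measurable_sides(1)[OF p s n finite.emptyI]]
          measurable_compose[OF vl measurable_sides(2)[OF p s n finite.emptyI]])
    show "AE x in PiM UNIV (\<lambda>_::'d. \<mu>). measure \<mu> {y. side (vec_lambda x) y < 0} ^ 1 + measure \<mu> {y. 0 < side (vec_lambda x) y} ^ 1 = 1"
      using AE_nu_nonzero[OF p s n] by (rule eventually_mono) (rule one)
  qed simp
  then show ?thesis by (simp add: U.prob_space)
qed

section \<open>Continuity of the facet moments along a coupling\<close>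

lemma measurable_component_borel:
  assumes "sets \<mu> = sets borel"
  shows "(\<lambda>x. x i) \<in> borel_measurable (PiM UNIV (\<lambda>_. \<mu>))"
  using measurable_component_singleton[of i UNIV "\<lambda>_. \<mu>", OF UNIV_I]
  unfolding measurable_cong_sets[OF refl assms] .

lemma measurable_vec_of_fun:
  fixes \<mu> :: "(real^'d) measure"
  assumes "sets \<mu> = sets borel"
  shows "(\<lambda>x. vec_lambda x) \<in> borel_measurable (PiM UNIV (\<lambda>_::'d. \<mu>))"
proof -
  have "(\<lambda>x. \<chi> j. x j) \<in> borel_measurable (PiM UNIV (\<lambda>_::'d. \<mu>))"
    by (intro measurable_vec_lambda measurable_component_borel[OF assms])
  then show ?thesis by simp
qed

lemma PiM_distr:
  fixes T :: "'b \<Rightarrow> real^'d"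
  assumes "prob_space \<Omega>" and T: "T \<in> borel_measurable \<Omega>"
  shows "PiM UNIV (\<lambda>_::'d. distr \<Omega> borel T) = distr (PiM UNIV (\<lambda>_. \<Omega>)) (PiM UNIV (\<lambda>_. borel)) (\<lambda>\<omega> i. T (\<omega> i))"
proof -
  define M' where "M' = distr \<Omega> borel T"
  have p: "prob_space M'" unfolding M'_def using assms by (rule prob_space.prob_space_distr)
  have s: "sets M' = sets borel" by (simp add: M'_def)
  have T': "T \<in> measurable \<Omega> M'" using T unfolding measurable_cong_sets[OF refl s] .
  have a: "distr (PiM UNIV (\<lambda>_::'d. \<Omega>)) (PiM UNIV (\<lambda>_::'d. M')) (compose UNIV T) = PiM UNIV (\<lambda>_. distr \<Omega> M' T)"
    by (rule distr_PiM_finite_prob_space') (use assms p T' in auto)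
  have b: "distr \<Omega> M' T = M'" unfolding M'_def by (rule distr_cong) simp_all
  have c: "compose UNIV T = (\<lambda>\<omega> i. T (\<omega> i))" by (simp add: compose_def fun_eq_iff)
  have d: "distr (PiM UNIV (\<lambda>_::'d. \<Omega>)) (PiM UNIV (\<lambda>_::'d. M')) (\<lambda>\<omega> i. T (\<omega> i))
      = distr (PiM UNIV (\<lambda>_. \<Omega>)) (PiM UNIV (\<lambda>_. borel)) (\<lambda>\<omega> i. T (\<omega> i))"
    by (rule distr_cong) (auto intro!: sets_PiM_cong simp: s)
  show ?thesis using a unfolding b c d unfolding M'_def by (rule sym)
qed

text \<open>Moves the moment to powers of the underlying space, so that the moments of a whole
  sequence of laws become integrals over one common space, as dominated convergence demands.\<close>

lemma facet_moment_distr: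
  fixes T :: "'b \<Rightarrow> real^'d"
  assumes \<Omega>: "prob_space \<Omega>" and T [measurable]: "T \<in> borel_measurable \<Omega>" and null: "null_hyperplanes (distr \<Omega> borel T)"
  shows "facet_moment (distr \<Omega> borel T) k = (LINT \<omega>|PiM UNIV (\<lambda>_. \<Omega>).
      measure \<Omega> {z\<in>space \<Omega>. side (\<chi> i. T (\<omega> i)) (T z) < 0} ^ k + measure \<Omega> {z\<in>space \<Omega>. 0 < side (\<chi> i. T (\<omega> i)) (T z)} ^ k)"
    (is "_ = ?R")
    and "(\<lambda>\<omega>. measure \<Omega> {z\<in>space \<Omega>. side (\<chi> i. T (\<omega> i)) (T z) < 0} ^ k + measure \<Omega> {z\<in>space \<Omega>. 0 < side (\<chi> i. T (\<omega> i)) (T z)} ^ k)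
      \<in> borel_measurable (PiM UNIV (\<lambda>_. \<Omega>))"
proof -
  define \<mu> where "\<mu> = distr \<Omega> borel T"
  have p: "prob_space \<mu>" unfolding \<mu>_def using \<Omega> T by (rule prob_space.prob_space_distr)
  have s: "sets \<mu> = sets borel" by (simp add: \<mu>_def)
  have null': "null_hyperplanes \<mu>" using null by (simp add: \<mu>_def)
  have side1: "measure \<mu> {y. side X y < 0} = measure \<Omega> {z\<in>space \<Omega>. side X (T z) < 0}" for X
    unfolding \<mu>_def by (subst measure_distr) (auto intro!: arg_cong[where f="measure \<Omega>"])
  have side2: "measure \<mu> {y. 0 < side X y} = measure \<Omega> {z\<in>space \<Omega>. 0 < side X (T z)}" for X
    unfolding \<mu>_def by (subst measure_distr) (auto intro!: arg_cong[where f="measure \<Omega>"])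
  note ms = measurable_sides[OF p s null' finite.emptyI]
  let ?g = "\<lambda>X. measure \<mu> {y. side X y < 0} ^ k + measure \<mu> {y. 0 < side X y} ^ k"
  have g: "?g \<in> borel_measurable borel" by (intro borel_measurable_add borel_measurable_power ms)
  have gv: "(\<lambda>x. ?g (vec_lambda x)) \<in> borel_measurable (PiM UNIV (\<lambda>_::'d. borel))"
    by (rule measurable_compose[OF measurable_vec_of_fun[OF refl] g])
  have m: "(\<lambda>\<omega> i. T (\<omega> i)) \<in> measurable (PiM UNIV (\<lambda>_::'d. \<Omega>)) (PiM UNIV (\<lambda>_. borel))"
    by (rule measurable_PiM_single') (auto simp: space_PiM)
  have "facet_moment \<mu> k = (LINT x|distr (PiM UNIV (\<lambda>_. \<Omega>)) (PiM UNIV (\<lambda>_. borel)) (\<lambda>\<omega> i. T (\<omega> i)). ?g (vec_lambda x))"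
    unfolding facet_moment_def \<mu>_def[symmetric] by (simp only: \<mu>_def PiM_distr[OF \<Omega> T])
  also have "\<dots> = (LINT \<omega>|PiM UNIV (\<lambda>_. \<Omega>). ?g (\<chi> i. T (\<omega> i)))"
    by (rule integral_distr[OF m gv])
  finally have "facet_moment \<mu> k = ?R" unfolding side1 side2 .
  then show "facet_moment (distr \<Omega> borel T) k = ?R" unfolding \<mu>_def .
  show "(\<lambda>\<omega>. measure \<Omega> {z\<in>space \<Omega>. side (\<chi> i. T (\<omega> i)) (T z) < 0} ^ k + measure \<Omega> {z\<in>space \<Omega>. 0 < side (\<chi> i. T (\<omega> i)) (T z)} ^ k)
      \<in> borel_measurable (PiM UNIV (\<lambda>_. \<Omega>))"
    using measurable_compose[OF m gv] unfolding side1 side2 .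
qed

lemma isCont_nu: "isCont nu (X :: real^'d^'d)"
  using continuous_nu by (metis continuous_on_eq_continuous_at open_UNIV UNIV_I)

lemma tendsto_side:
  fixes X0 :: "real^'d^'d"
  assumes "X \<longlonglongrightarrow> X0" "y \<longlonglongrightarrow> y0"
  shows "(\<lambda>j. side (X j) (y j)) \<longlonglongrightarrow> side X0 y0"
  unfolding side_def
  by (intro tendsto_intros assms isCont_tendsto_compose[OF isCont_nu assms(1)])

text \<open>The sign of \<open>side\<close> is eventually constant wherever the limit is non-zero,
  and the limit law gives no mass to the limit hyperplane.\<close>

lemma tendsto_measure_side:
  fixes T :: "nat \<Rightarrow> 'b \<Rightarrow> real^'d"
  assumes \<Omega>: "prob_space \<Omega>" and Tm [measurable]: "\<And>j. T j \<in> borel_measurable \<Omega>" "T0 \<in> borel_measurable \<Omega>"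
    and lim: "\<And>z. z \<in> space \<Omega> \<Longrightarrow> (\<lambda>j. T j z) \<longlonglongrightarrow> T0 z"
    and null: "null_hyperplanes (distr \<Omega> borel T0)" and X: "X \<longlonglongrightarrow> X0" "nu X0 \<noteq> 0"
  shows "(\<lambda>j. measure \<Omega> {z\<in>space \<Omega>. side (X j) (T j z) < 0}) \<longlonglongrightarrow> measure \<Omega> {z\<in>space \<Omega>. side X0 (T0 z) < 0}"
    "(\<lambda>j. measure \<Omega> {z\<in>space \<Omega>. 0 < side (X j) (T j z)}) \<longlonglongrightarrow> measure \<Omega> {z\<in>space \<Omega>. 0 < side X0 (T0 z)}"
proof -
  interpret prob_space \<Omega> by fact
  have "AE y in distr \<Omega> borel T0. nu X0 \<bullet> y \<noteq> nu X0 \<bullet> X0 $ piv"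
    using null X(2) by (simp add: null_hyperplanes_def)
  then have ae: "AE z in \<Omega>. side X0 (T0 z) \<noteq> 0"
    by (subst (asm) AE_distr_iff) (auto simp: side_def inner_diff_right elim!: eventually_mono)
  have conv: "(\<lambda>j. side (X j) (T j z)) \<longlonglongrightarrow> side X0 (T0 z)" if "z \<in> space \<Omega>" for z
    using X(1) lim[OF that] by (rule tendsto_side)
  have main: "(\<lambda>j. LINT z|\<Omega>. of_bool (P (side (X j) (T j z)))) \<longlonglongrightarrow> (LINT z|\<Omega>. of_bool (P (side X0 (T0 z))) :: real)"
    if [measurable]: "Measurable.pred borel P" and ev: "\<And>f l. f \<longlonglongrightarrow> l \<Longrightarrow> l \<noteq> 0 \<Longrightarrow> eventually (\<lambda>j. P (f j) \<longleftrightarrow> P l) sequentially" for P :: "real \<Rightarrow> bool"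
  proof (rule integral_dominated_convergence[where w="\<lambda>_. 1"])
    show "AE z in \<Omega>. (\<lambda>j. of_bool (P (side (X j) (T j z)))) \<longlonglongrightarrow> (of_bool (P (side X0 (T0 z))) :: real)"
      using ae AE_space
    proof eventually_elim
      fix z assume "side X0 (T0 z) \<noteq> 0" "z \<in> space \<Omega>"
      then have "eventually (\<lambda>j. P (side (X j) (T j z)) \<longleftrightarrow> P (side X0 (T0 z))) sequentially"
        by (intro ev conv)
      then show "(\<lambda>j. of_bool (P (side (X j) (T j z)))) \<longlonglongrightarrow> (of_bool (P (side X0 (T0 z))) :: real)"
        by (intro tendsto_eventually) (auto elim!: eventually_mono)
    qed
  qed (auto simp: of_bool_def)
  have int: "(LINT z|\<Omega>. of_bool (P (f z))) = measure \<Omega> {z\<in>space \<Omega>. P (f z)}"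
    if [measurable]: "Measurable.pred borel P" "f \<in> borel_measurable \<Omega>" for P :: "real \<Rightarrow> bool" and f
  proof -
    have "(LINT z|\<Omega>. of_bool (P (f z))) = (LINT z|\<Omega>. indicator {z\<in>space \<Omega>. P (f z)} z)"
      by (rule Bochner_Integration.integral_cong) (auto simp: indicator_def)
    also have "\<dots> = measure \<Omega> ({z\<in>space \<Omega>. P (f z)} \<inter> space \<Omega>)" by (rule Bochner_Integration.integral_indicator)
    also have "{z\<in>space \<Omega>. P (f z)} \<inter> space \<Omega> = {z\<in>space \<Omega>. P (f z)}" by auto
    finally show ?thesis .
  qed
  have neg: "eventually (\<lambda>j. f j < 0 \<longleftrightarrow> l < 0) sequentially" and pos: "eventually (\<lambda>j. 0 < f j \<longleftrightarrow> 0 < l) sequentially"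
    if f: "f \<longlonglongrightarrow> l" "l \<noteq> 0" for f and l :: real
  proof -
    consider "l < 0" | "0 < l" using f(2) by linarith
    then have "eventually (\<lambda>j. (f j < 0 \<longleftrightarrow> l < 0) \<and> (0 < f j \<longleftrightarrow> 0 < l)) sequentially"
    proof cases
      case 1
      from order_tendstoD(2)[OF f(1) this] show ?thesis by (rule eventually_mono) (use 1 in auto)
    next
      case 2
      from order_tendstoD(1)[OF f(1) this] show ?thesis by (rule eventually_mono) (use 2 in auto)
    qed
    then show "eventually (\<lambda>j. f j < 0 \<longleftrightarrow> l < 0) sequentially" "eventually (\<lambda>j. 0 < f j \<longleftrightarrow> 0 < l) sequentially"
      by (auto elim: eventually_mono)
  qed
  have s: "(\<lambda>z. side Y (S z)) \<in> borel_measurable \<Omega>" if "S \<in> borel_measurable \<Omega>" for Y and S :: "'b \<Rightarrow> real^'d"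
    using that by measurable
  have i1: "(LINT z|\<Omega>. of_bool (side Y (S z) < 0)) = measure \<Omega> {z\<in>space \<Omega>. side Y (S z) < 0}"
    and i2: "(LINT z|\<Omega>. of_bool (0 < side Y (S z))) = measure \<Omega> {z\<in>space \<Omega>. 0 < side Y (S z)}"
    if "S \<in> borel_measurable \<Omega>" for Y and S :: "'b \<Rightarrow> real^'d"
    by (rule int[OF _ s[OF that], of "\<lambda>t. t < 0"], measurable) (rule int[OF _ s[OF that], of "\<lambda>t. 0 < t"], measurable)
  show "(\<lambda>j. measure \<Omega> {z\<in>space \<Omega>. side (X j) (T j z) < 0}) \<longlonglongrightarrow> measure \<Omega> {z\<in>space \<Omega>. side X0 (T0 z) < 0}"
    using main[of "\<lambda>t. t < 0", OF _ neg] unfolding i1[OF Tm(1)] i1[OF Tm(2)] by simp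
  show "(\<lambda>j. measure \<Omega> {z\<in>space \<Omega>. 0 < side (X j) (T j z)}) \<longlonglongrightarrow> measure \<Omega> {z\<in>space \<Omega>. 0 < side X0 (T0 z)}"
    using main[of "\<lambda>t. 0 < t", OF _ pos] unfolding i2[OF Tm(1)] i2[OF Tm(2)] by simp
qed

text \<open>Dominated convergence is used twice: in the tested point, by the preceding lemma, and in
  the d points spanning the hyperplane, which are affinely independent in the limit almost
  surely.\<close>

theorem tendsto_facet_moment:
  fixes T :: "nat \<Rightarrow> 'b \<Rightarrow> real^'d"
  assumes \<Omega>: "prob_space \<Omega>" and Tm [measurable]: "\<And>j. T j \<in> borel_measurable \<Omega>" "T0 \<in> borel_measurable \<Omega>"
    and lim: "\<And>z. z \<in> space \<Omega> \<Longrightarrow> (\<lambda>j. T j z) \<longlonglongrightarrow> T0 z"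
    and null: "\<And>j. null_hyperplanes (distr \<Omega> borel (T j))" "null_hyperplanes (distr \<Omega> borel T0)"
  shows "(\<lambda>j. facet_moment (distr \<Omega> borel (T j)) k) \<longlonglongrightarrow> facet_moment (distr \<Omega> borel T0) k"
proof -
  let ?P = "PiM UNIV (\<lambda>_::'d. \<Omega>)"
  interpret \<Omega>: prob_space \<Omega> by fact
  interpret P: prob_space ?P using \<Omega> by (intro prob_space_PiM)
  note fm = facet_moment_distr[OF \<Omega> Tm(1) null(1)] facet_moment_distr[OF \<Omega> Tm(2) null(2)]
  have p: "prob_space (distr \<Omega> borel T0)" using Tm(2) by (rule \<Omega>.prob_space_distr)
  have m: "(\<lambda>\<omega> i. T0 (\<omega> i)) \<in> measurable ?P (PiM UNIV (\<lambda>_. borel))"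
    by (rule measurable_PiM_single') (auto simp: space_PiM)
  have "AE x in PiM UNIV (\<lambda>_::'d. distr \<Omega> borel T0). nu (vec_lambda x) \<noteq> 0"
    by (rule AE_nu_nonzero[OF p _ null(2)]) simp
  then have "AE x in distr ?P (PiM UNIV (\<lambda>_. borel)) (\<lambda>\<omega> i. T0 (\<omega> i)). nu (vec_lambda x) \<noteq> 0"
    unfolding PiM_distr[OF \<Omega> Tm(2)] .
  from AE_distrD[OF m this] have nu: "AE \<omega> in ?P. nu (\<chi> i. T0 (\<omega> i)) \<noteq> 0" .
  show ?thesis
    unfolding fm(1,3)
  proof (rule integral_dominated_convergence[where w="\<lambda>_. 2", OF fm(4) fm(2)])
    show "AE \<omega> in ?P. (\<lambda>j. measure \<Omega> {z\<in>space \<Omega>. side (\<chi> i. T j (\<omega> i)) (T j z) < 0} ^ k + measure \<Omega> {z\<in>space \<Omega>. 0 < side (\<chi> i. T j (\<omega> i)) (T j z)} ^ k)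
      \<longlonglongrightarrow> measure \<Omega> {z\<in>space \<Omega>. side (\<chi> i. T0 (\<omega> i)) (T0 z) < 0} ^ k + measure \<Omega> {z\<in>space \<Omega>. 0 < side (\<chi> i. T0 (\<omega> i)) (T0 z)} ^ k"
      using nu AE_space
    proof eventually_elim
      fix \<omega> assume nu: "nu (\<chi> i. T0 (\<omega> i)) \<noteq> 0" and "\<omega> \<in> space ?P"
      then have "\<omega> i \<in> space \<Omega>" for i by (auto simp: space_PiM)
      then have X: "(\<lambda>j. \<chi> i. T j (\<omega> i)) \<longlonglongrightarrow> (\<chi> i. T0 (\<omega> i))"
        by (intro tendsto_vec_lambda lim)
      show "(\<lambda>j. measure \<Omega> {z\<in>space \<Omega>. side (\<chi> i. T j (\<omega> i)) (T j z) < 0} ^ k + measure \<Omega> {z\<in>space \<Omega>. 0 < side (\<chi> i. T j (\<omega> i)) (T j z)} ^ k)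
        \<longlonglongrightarrow> measure \<Omega> {z\<in>space \<Omega>. side (\<chi> i. T0 (\<omega> i)) (T0 z) < 0} ^ k + measure \<Omega> {z\<in>space \<Omega>. 0 < side (\<chi> i. T0 (\<omega> i)) (T0 z)} ^ k"
        by (intro tendsto_intros tendsto_measure_side[OF \<Omega> Tm lim null(2) X nu])
    qed
    show "AE \<omega> in ?P. norm (measure \<Omega> {z\<in>space \<Omega>. side (\<chi> i. T j (\<omega> i)) (T j z) < 0} ^ k + measure \<Omega> {z\<in>space \<Omega>. 0 < side (\<chi> i. T j (\<omega> i)) (T j z)} ^ k) \<le> 2" for j
    proof (rule AE_I2)
      fix \<omega>
      have "measure \<Omega> A ^ k \<le> 1" for A by (rule power_le_one) simp_all
      then have "measure \<Omega> A ^ k + measure \<Omega> B ^ k \<le> 1 + 1" for A B by (rule add_mono) fact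
      then show "norm (measure \<Omega> {z\<in>space \<Omega>. side (\<chi> i. T j (\<omega> i)) (T j z) < 0} ^ k + measure \<Omega> {z\<in>space \<Omega>. 0 < side (\<chi> i. T j (\<omega> i)) (T j z)} ^ k) \<le> 2"
        by simp
    qed
  qed simp
qed

text \<open>Only the non-strict inequalities pass to the limit. Nullity of hyperplanes and the
  strict bound on the second moment could be lost and are therefore required of the limit
  law.\<close>

lemma facet_gap_limit:
  fixes T :: "nat \<Rightarrow> 'b \<Rightarrow> real^'d"
  assumes \<Omega>: "prob_space \<Omega>" and Tm: "\<And>j. T j \<in> borel_measurable \<Omega>" "T0 \<in> borel_measurable \<Omega>"
    and lim: "\<And>z. z \<in> space \<Omega> \<Longrightarrow> (\<lambda>j. T j z) \<longlonglongrightarrow> T0 z"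
    and gap: "\<And>j. facet_gap (distr \<Omega> borel (T j))" and null: "null_hyperplanes (distr \<Omega> borel T0)"
    and less: "facet_moment (distr \<Omega> borel T0) 2 < 1"
  shows "facet_gap (distr \<Omega> borel T0)"
  unfolding facet_gap_def
proof (intro conjI allI impI)
  show "prob_space (distr \<Omega> borel T0)" using \<Omega> Tm(2) by (rule prob_space.prob_space_distr)
  fix k :: nat assume k: "1 \<le> k"
  have conv: "(\<lambda>j. facet_moment (distr \<Omega> borel (T j)) i) \<longlonglongrightarrow> facet_moment (distr \<Omega> borel T0) i" for i
    using gap by (intro tendsto_facet_moment[OF \<Omega> Tm lim _ null]) (simp_all add: facet_gap_def)
  show "real (CARD('d) - 1) * ((1 - facet_moment (distr \<Omega> borel T0) 2) / 2) ^ k \<le>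
      (real CARD('d) + real k) * facet_moment (distr \<Omega> borel T0) k - real k * facet_moment (distr \<Omega> borel T0) (k - 1)"
  proof (rule LIMSEQ_le)
    show "(\<lambda>j. real (CARD('d) - 1) * ((1 - facet_moment (distr \<Omega> borel (T j)) 2) / 2) ^ k) \<longlonglongrightarrow>
      real (CARD('d) - 1) * ((1 - facet_moment (distr \<Omega> borel T0) 2) / 2) ^ k"
      by (intro tendsto_intros conv) simp
    show "(\<lambda>j. (real CARD('d) + real k) * facet_moment (distr \<Omega> borel (T j)) k - real k * facet_moment (distr \<Omega> borel (T j)) (k - 1)) \<longlonglongrightarrow>
      (real CARD('d) + real k) * facet_moment (distr \<Omega> borel T0) k - real k * facet_moment (distr \<Omega> borel T0) (k - 1)"
      by (intro tendsto_intros conv)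
  qed (use gap k in \<open>auto simp: facet_gap_def\<close>)
qed (use null less in simp_all)

section \<open>Polar coordinates and the uniform law on the sphere\<close>

lemma nn_integral_scaleR:
  fixes f :: "'a::euclidean_space \<Rightarrow> ennreal"
  assumes [measurable]: "f \<in> borel_measurable borel" and c: "0 < c"
  shows "(\<integral>\<^sup>+x. f x \<partial>lborel) = ennreal (c ^ DIM('a)) * (\<integral>\<^sup>+x. f (c *\<^sub>R x) \<partial>lborel)"
proof -
  have "(\<integral>\<^sup>+x. f x \<partial>lborel) = (\<integral>\<^sup>+x. f x \<partial>density (distr lborel borel (\<lambda>x. 0 + c *\<^sub>R x)) (\<lambda>_. ennreal (\<bar>c\<bar> ^ DIM('a))))"
    using c by (subst lborel_affine[of c 0]) simp_all
  also have "\<dots> = ennreal (c ^ DIM('a)) * (\<integral>\<^sup>+x. f (c *\<^sub>R x) \<partial>lborel)"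
    using c by (simp add: nn_integral_density nn_integral_distr nn_integral_cmult)
  finally show ?thesis .
qed

lemma emeasure_cball_pos_finite:
  assumes "0 < \<sigma>"
  shows "emeasure lborel (cball 0 \<sigma> :: 'a::euclidean_space set) \<noteq> 0" "emeasure lborel (cball 0 \<sigma> :: 'a set) \<noteq> \<infinity>"
  using content_cball_pos[OF assms, of "0::'a"] emeasure_lborel_cball_finite[of "0::'a" \<sigma>]
  by (auto simp: measure_def)

lemma AE_nonzero: "AE x in lborel. (x :: 'a::euclidean_space) \<noteq> 0"
  by (rule AE_lborel_singleton)

text \<open>Under Lebesgue measure the norm and the direction are independent. Two rescalings and two
  applications of Fubini exchange the norms of \<open>x\<close> and \<open>y\<close>.\<close>

lemma polar_average:
  fixes f :: "'a::euclidean_space \<Rightarrow> ennreal"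
  assumes f [measurable]: "f \<in> borel_measurable borel" and \<sigma>: "0 < \<sigma>"
  shows "(\<integral>\<^sup>+x. \<integral>\<^sup>+y. indicator (cball 0 \<sigma>) y * f ((norm x / norm y) *\<^sub>R y) \<partial>lborel \<partial>(lborel :: 'a measure)) =
    emeasure lborel (cball 0 \<sigma> :: 'a set) * (\<integral>\<^sup>+x. f x \<partial>lborel)"
proof -
  let ?d = "DIM('a)"
  define \<kappa> where "\<kappa> = (\<integral>\<^sup>+w. ennreal ((\<sigma> / norm w) ^ ?d) * indicator {1..} (norm w) * ennreal (1 / norm w ^ ?d) \<partial>(lborel :: 'a measure))"
  have main: "(\<integral>\<^sup>+x. \<integral>\<^sup>+y. indicator (cball 0 \<sigma>) y * h ((norm x / norm y) *\<^sub>R y) \<partial>lborel \<partial>(lborel :: 'a measure)) = \<kappa> * (\<integral>\<^sup>+x. h x \<partial>lborel)"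
    if [measurable]: "h \<in> borel_measurable borel" for h :: "'a \<Rightarrow> ennreal"
  proof -
    have "(\<integral>\<^sup>+x. \<integral>\<^sup>+y. indicator (cball 0 \<sigma>) y * h ((norm x / norm y) *\<^sub>R y) \<partial>lborel \<partial>(lborel :: 'a measure))
        = (\<integral>\<^sup>+x. \<integral>\<^sup>+z. ennreal ((\<sigma> / norm x) ^ ?d) * (indicator {..norm x} (norm z) * h ((norm x / norm z) *\<^sub>R z)) \<partial>lborel \<partial>(lborel :: 'a measure))"
    \<comment> \<open>Scaling y by \<sigma> / |x| turns the fixed ball into the condition |z| \<le>
      |x|.\<close>
    proof (rule nn_integral_cong_AE, rule eventually_mono[OF AE_nonzero])
      fix x :: 'a assume x: "x \<noteq> 0"
      then have c: "0 < \<sigma> / norm x" using \<sigma> by simp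
      have "(\<integral>\<^sup>+y. indicator (cball 0 \<sigma>) y * h ((norm x / norm y) *\<^sub>R y) \<partial>lborel)
          = ennreal ((\<sigma> / norm x) ^ ?d) * (\<integral>\<^sup>+z. indicator (cball 0 \<sigma>) ((\<sigma> / norm x) *\<^sub>R z) * h ((norm x / norm ((\<sigma> / norm x) *\<^sub>R z)) *\<^sub>R (\<sigma> / norm x) *\<^sub>R z) \<partial>lborel)"
        by (rule nn_integral_scaleR[OF _ c]) measurable
      also have "(\<integral>\<^sup>+z. indicator (cball 0 \<sigma>) ((\<sigma> / norm x) *\<^sub>R z) * h ((norm x / norm ((\<sigma> / norm x) *\<^sub>R z)) *\<^sub>R (\<sigma> / norm x) *\<^sub>R z) \<partial>lborel)
          = (\<integral>\<^sup>+z. indicator {..norm x} (norm z) * h ((norm x / norm z) *\<^sub>R z) \<partial>lborel)"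
        using x \<sigma> by (intro nn_integral_cong) (auto simp: indicator_def field_simps)
      finally show "(\<integral>\<^sup>+y. indicator (cball 0 \<sigma>) y * h ((norm x / norm y) *\<^sub>R y) \<partial>lborel)
          = (\<integral>\<^sup>+z. ennreal ((\<sigma> / norm x) ^ ?d) * (indicator {..norm x} (norm z) * h ((norm x / norm z) *\<^sub>R z)) \<partial>lborel)"
        by (subst nn_integral_cmult) simp_all
    qed
    also have "\<dots> = (\<integral>\<^sup>+z. \<integral>\<^sup>+x. ennreal ((\<sigma> / norm x) ^ ?d) * (indicator {norm z..} (norm x) * h ((norm x / norm z) *\<^sub>R z)) \<partial>(lborel :: 'a measure) \<partial>(lborel :: 'a measure))"
    proof -
      have "(\<integral>\<^sup>+x. \<integral>\<^sup>+z. ennreal ((\<sigma> / norm x) ^ ?d) * (indicator {..norm x} (norm z) * h ((norm x / norm z) *\<^sub>R z)) \<partial>lborel \<partial>(lborel :: 'a measure))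
        = (\<integral>\<^sup>+x. \<integral>\<^sup>+z. ennreal ((\<sigma> / norm x) ^ ?d) * (indicator {0..} (norm x - norm z) * h ((norm x / norm z) *\<^sub>R z)) \<partial>lborel \<partial>(lborel :: 'a measure))"
        by (intro nn_integral_cong) (auto simp: indicator_def)
      also have "\<dots> = (\<integral>\<^sup>+z. \<integral>\<^sup>+x. ennreal ((\<sigma> / norm x) ^ ?d) * (indicator {0..} (norm x - norm z) * h ((norm x / norm z) *\<^sub>R z)) \<partial>(lborel :: 'a measure) \<partial>(lborel :: 'a measure))"
        by (rule lborel_pair.Fubini') measurable
      also have "\<dots> = (\<integral>\<^sup>+z. \<integral>\<^sup>+x. ennreal ((\<sigma> / norm x) ^ ?d) * (indicator {norm z..} (norm x) * h ((norm x / norm z) *\<^sub>R z)) \<partial>(lborel :: 'a measure) \<partial>(lborel :: 'a measure))"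
        by (intro nn_integral_cong) (auto simp: indicator_def)
      finally show ?thesis .
    qed
    also have "\<dots> = (\<integral>\<^sup>+z. \<integral>\<^sup>+w. ennreal ((\<sigma> / norm w) ^ ?d) * indicator {1..} (norm w) * h (norm w *\<^sub>R z) \<partial>(lborel :: 'a measure) \<partial>(lborel :: 'a measure))"
    \<comment> \<open>Scaling x by |z| leaves the condition |w| \<ge> 1, free of z; the powers of
      |z| cancel, and z occurs only inside h.\<close>
    proof (rule nn_integral_cong_AE, rule eventually_mono[OF AE_nonzero])
      fix z :: 'a assume z: "z \<noteq> 0"
      then have c: "0 < norm z" by simp
      have "(\<integral>\<^sup>+x. ennreal ((\<sigma> / norm x) ^ ?d) * (indicator {norm z..} (norm x) * h ((norm x / norm z) *\<^sub>R z)) \<partial>(lborel :: 'a measure))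
          = ennreal (norm z ^ ?d) * (\<integral>\<^sup>+w. ennreal ((\<sigma> / norm (norm z *\<^sub>R w)) ^ ?d) * (indicator {norm z..} (norm (norm z *\<^sub>R w)) * h ((norm (norm z *\<^sub>R w) / norm z) *\<^sub>R z)) \<partial>(lborel :: 'a measure))"
        by (rule nn_integral_scaleR[OF _ c]) measurable
      also have "\<dots> = (\<integral>\<^sup>+w. ennreal (norm z ^ ?d) * (ennreal ((\<sigma> / norm (norm z *\<^sub>R w)) ^ ?d) * (indicator {norm z..} (norm (norm z *\<^sub>R w)) * h ((norm (norm z *\<^sub>R w) / norm z) *\<^sub>R z))) \<partial>(lborel :: 'a measure))"
        by (rule nn_integral_cmult[symmetric]) measurable
      also have "\<dots> = (\<integral>\<^sup>+w. ennreal ((\<sigma> / norm w) ^ ?d) * indicator {1..} (norm w) * h (norm w *\<^sub>R z) \<partial>(lborel :: 'a measure))"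
      proof (rule nn_integral_cong)
        fix w :: 'a
        have "ennreal (norm z ^ ?d) * ennreal ((\<sigma> / norm (norm z *\<^sub>R w)) ^ ?d) = ennreal ((\<sigma> / norm w) ^ ?d)"
          using \<sigma> c by (subst ennreal_mult[symmetric]) (simp_all add: power_mult_distrib[symmetric])
        moreover have "(indicator {norm z..} (norm (norm z *\<^sub>R w)) :: ennreal) = indicator {1..} (norm w)"
          using c by (simp add: indicator_def)
        moreover have "norm (norm z *\<^sub>R w) / norm z = norm w" using c by simp
        ultimately show "ennreal (norm z ^ ?d) * (ennreal ((\<sigma> / norm (norm z *\<^sub>R w)) ^ ?d) * (indicator {norm z..} (norm (norm z *\<^sub>R w)) * h ((norm (norm z *\<^sub>R w) / norm z) *\<^sub>R z)))
          = ennreal ((\<sigma> / norm w) ^ ?d) * indicator {1..} (norm w) * h (norm w *\<^sub>R z)"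
          by (simp only: mult.assoc[symmetric])
      qed
      finally show "(\<integral>\<^sup>+x. ennreal ((\<sigma> / norm x) ^ ?d) * (indicator {norm z..} (norm x) * h ((norm x / norm z) *\<^sub>R z)) \<partial>(lborel :: 'a measure))
          = (\<integral>\<^sup>+w. ennreal ((\<sigma> / norm w) ^ ?d) * indicator {1..} (norm w) * h (norm w *\<^sub>R z) \<partial>(lborel :: 'a measure))" .
    qed
    also have "\<dots> = (\<integral>\<^sup>+w. \<integral>\<^sup>+z. ennreal ((\<sigma> / norm w) ^ ?d) * indicator {1..} (norm w) * h (norm w *\<^sub>R z) \<partial>lborel \<partial>(lborel :: 'a measure))"
      by (rule lborel_pair.Fubini') measurable
    also have "\<dots> = (\<integral>\<^sup>+w. ennreal ((\<sigma> / norm w) ^ ?d) * indicator {1..} (norm w) * ennreal (1 / norm w ^ ?d) * (\<integral>\<^sup>+z. h z \<partial>lborel) \<partial>(lborel :: 'a measure))"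
    proof (rule nn_integral_cong)
      fix w :: 'a
      show "(\<integral>\<^sup>+z. ennreal ((\<sigma> / norm w) ^ ?d) * indicator {1..} (norm w) * h (norm w *\<^sub>R z) \<partial>lborel)
        = ennreal ((\<sigma> / norm w) ^ ?d) * indicator {1..} (norm w) * ennreal (1 / norm w ^ ?d) * (\<integral>\<^sup>+z. h z \<partial>lborel)"
      proof (cases "w = 0")
        case False
        then have w: "0 < norm w" by simp
        have "ennreal (1 / norm w ^ ?d) * (\<integral>\<^sup>+z. h z \<partial>lborel) = ennreal (1 / norm w ^ ?d) * ennreal (norm w ^ ?d) * (\<integral>\<^sup>+z. h (norm w *\<^sub>R z) \<partial>lborel)"
          unfolding nn_integral_scaleR[OF that w] by (simp only: mult.assoc)
        also have "ennreal (1 / norm w ^ ?d) * ennreal (norm w ^ ?d) = 1"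
          using w by (subst ennreal_mult[symmetric]) simp_all
        finally show ?thesis by (subst nn_integral_cmult) (simp_all add: mult.assoc)
      qed (simp add: indicator_def)
    qed
    also have "\<dots> = \<kappa> * (\<integral>\<^sup>+x. h x \<partial>lborel)"
      unfolding \<kappa>_def by (rule nn_integral_multc) measurable
    finally show ?thesis .
  qed
  \<comment> \<open>The constant \<kappa> is found by testing with the indicator of the ball, for
    which the double integral is the square of the volume.\<close>
  let ?L = "emeasure lborel (cball 0 \<sigma> :: 'a set)"
  have "?L * ?L = (\<integral>\<^sup>+x. indicator (cball 0 \<sigma>) x * ?L \<partial>(lborel :: 'a measure))"
    by (subst nn_integral_multc) simp_all
  also have "\<dots> = (\<integral>\<^sup>+x. \<integral>\<^sup>+y. indicator (cball 0 \<sigma>) x * indicator (cball 0 \<sigma>) y \<partial>(lborel :: 'a measure) \<partial>(lborel :: 'a measure))"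
    by (subst nn_integral_cmult) simp_all
  also have "\<dots> = (\<integral>\<^sup>+x. \<integral>\<^sup>+y. indicator (cball 0 \<sigma>) y * indicator (cball 0 \<sigma>) ((norm x / norm y) *\<^sub>R y) \<partial>(lborel :: 'a measure) \<partial>(lborel :: 'a measure))"
    by (rule nn_integral_cong, rule nn_integral_cong_AE, rule eventually_mono[OF AE_nonzero]) (auto simp: indicator_def)
  also have "\<dots> = \<kappa> * ?L" by (subst main) (simp_all add: borel_measurable_indicator)
  finally have "?L * ?L = ?L * \<kappa>" by (simp only: mult.commute)
  then have "\<kappa> = ?L"
    using emeasure_cball_pos_finite[OF \<sigma>, where 'a='a] by (subst (asm) ennreal_mult_cancel_left) auto
  then show ?thesis using main[OF f] by simp
qed

text \<open>The uniform law is the radial projection of the uniform law on the ball; the factor d /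
  \<sigma> of the surface measure cancels in the normalisation.\<close>

lemma uniform_sphere_eq:
  fixes \<sigma> :: real assumes \<sigma>: "0 < \<sigma>"
  shows "(uniform_sphere \<sigma> :: 'a::euclidean_space measure) =
    distr (uniform_measure lborel (cball 0 \<sigma>)) borel (\<lambda>x. (\<sigma> / norm x) *\<^sub>R x)"
proof (rule measure_eqI)
  let ?f = "\<lambda>x::'a. (\<sigma> / norm x) *\<^sub>R x"
  let ?S = "sphere 0 \<sigma> :: 'a set"
  let ?c = "ennreal (real DIM('a) / \<sigma>)"
  have c: "?c \<noteq> 0" "?c \<noteq> \<infinity>" using \<sigma> by simp_all
  have ss: "sets (sphere_surface_measure \<sigma> :: 'a measure) = sets borel" by (simp add: sphere_surface_measure_def)
  show "sets (uniform_sphere \<sigma>) = sets (distr (uniform_measure lborel (cball 0 \<sigma>)) borel ?f)"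
    by (simp add: uniform_sphere_def ss)
  have surf: "emeasure (sphere_surface_measure \<sigma>) (?S \<inter> A) = ?c * emeasure lborel (cball 0 \<sigma> \<inter> ?f -` A)"
    if [measurable]: "A \<in> sets borel" for A
  proof -
    have "?f -` (?S \<inter> A) \<in> sets borel" using measurable_sets_borel[of ?f borel "?S \<inter> A"] by simp
    then have "emeasure (sphere_surface_measure \<sigma>) (?S \<inter> A) = ?c * emeasure lborel (?f -` (?S \<inter> A) \<inter> cball 0 \<sigma>)"
      unfolding sphere_surface_measure_def
      by (simp add: emeasure_distr measurable_restrict_space1 emeasure_restrict_space space_restrict_space)
    also have "emeasure lborel (?f -` (?S \<inter> A) \<inter> cball 0 \<sigma>) = emeasure lborel (cball 0 \<sigma> \<inter> ?f -` A)"
    proof (rule emeasure_eq_AE)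
      show "AE x in lborel. x \<in> ?f -` (?S \<inter> A) \<inter> cball 0 \<sigma> \<longleftrightarrow> x \<in> cball 0 \<sigma> \<inter> ?f -` A"
        using \<sigma> by (intro eventually_mono[OF AE_nonzero]) (simp add: conj_commute)
      show "?f -` (?S \<inter> A) \<inter> cball 0 \<sigma> \<in> sets lborel" "cball 0 \<sigma> \<inter> ?f -` A \<in> sets lborel"
        unfolding sets_lborel using measurable_sets_borel[of ?f borel "?S \<inter> A"] measurable_sets_borel[of ?f borel A]
        by (intro sets.Int; simp)+
    qed
    finally show ?thesis .
  qed
  fix A assume "A \<in> sets (uniform_sphere \<sigma> :: 'a measure)"
  then have A [measurable]: "A \<in> sets borel" by (simp add: uniform_sphere_def ss)
  have "emeasure (uniform_sphere \<sigma>) A = emeasure (sphere_surface_measure \<sigma>) (?S \<inter> A) / emeasure (sphere_surface_measure \<sigma>) ?S"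
    unfolding uniform_sphere_def by (rule emeasure_uniform_measure) (simp_all add: ss)
  also have "\<dots> = (?c * emeasure lborel (cball 0 \<sigma> \<inter> ?f -` A)) / (?c * emeasure lborel (cball 0 \<sigma> :: 'a set))"
    using surf[of A] surf[of UNIV] by simp
  also have "\<dots> = emeasure lborel (cball 0 \<sigma> \<inter> ?f -` A) / emeasure lborel (cball 0 \<sigma> :: 'a set)"
  proof -
    have cancel: "a * ia = 1 \<Longrightarrow> inverse (a * b) = ia * ib \<Longrightarrow> (a * e) * inverse (a * b) = e * ib" for a ia b ib e :: ennreal
    proof -
      have "(a * e) * (ia * ib) = (a * ia) * (e * ib)" by (simp only: mult_ac)
      then show "a * ia = 1 \<Longrightarrow> inverse (a * b) = ia * ib \<Longrightarrow> (a * e) * inverse (a * b) = e * ib" by simp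
    qed
    have "?c * inverse ?c = 1"
      by (rule ennreal_divide_self[unfolded divide_ennreal_def]) (use c in \<open>auto simp: less_top\<close>)
    moreover have "inverse (?c * emeasure lborel (cball 0 \<sigma> :: 'a set)) = inverse ?c * inverse (emeasure lborel (cball 0 \<sigma> :: 'a set))"
      using c emeasure_cball_pos_finite[OF \<sigma>, where 'a='a] by (intro ennreal_inverse_mult) (auto simp: less_top)
    ultimately show ?thesis
      using cancel unfolding divide_ennreal_def by blast
  qed
  also have "\<dots> = emeasure (uniform_measure lborel (cball 0 \<sigma>)) (?f -` A)"
    using measurable_sets_borel[of ?f borel A] by (subst emeasure_uniform_measure) simp_all
  also have "\<dots> = emeasure (distr (uniform_measure lborel (cball 0 \<sigma>)) borel ?f) A"
    by (subst emeasure_distr) simp_all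
  finally show "emeasure (uniform_sphere \<sigma>) A = emeasure (distr (uniform_measure lborel (cball 0 \<sigma>)) borel ?f) A" .
qed

lemma nn_integral_uniform_sphere:
  fixes f :: "'a::euclidean_space \<Rightarrow> ennreal"
  assumes [measurable]: "f \<in> borel_measurable borel" and \<sigma>: "0 < \<sigma>"
  shows "(\<integral>\<^sup>+u. f u \<partial>uniform_sphere \<sigma>) = (\<integral>\<^sup>+y. indicator (cball 0 \<sigma>) y * f ((\<sigma> / norm y) *\<^sub>R y) \<partial>lborel) / emeasure lborel (cball 0 \<sigma> :: 'a set)"
  unfolding uniform_sphere_eq[OF \<sigma>]
  by (subst nn_integral_distr) (simp_all add: nn_integral_uniform_measure mult.commute)

lemma AE_uniform_sphere:
  assumes \<sigma>: "0 < \<sigma>" and P: "AE x in lborel. P ((\<sigma> / norm x) *\<^sub>R x)" and [measurable]: "Measurable.pred borel P"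
  shows "AE u in (uniform_sphere \<sigma> :: 'a::euclidean_space measure). P u"
proof -
  have "AE x in uniform_measure lborel (cball 0 \<sigma> :: 'a set). P ((\<sigma> / norm x) *\<^sub>R x)"
    by (rule AE_uniform_measureI) (use P in \<open>auto elim: eventually_mono\<close>)
  then show ?thesis unfolding uniform_sphere_eq[OF \<sigma>] by (subst AE_distr_iff) simp_all
qed

lemma sets_uniform_sphere [simp, measurable_cong]: "sets (uniform_sphere \<sigma> :: 'a::euclidean_space measure) = sets borel"
  by (simp add: uniform_sphere_def sphere_surface_measure_def)

text \<open>A rotation invariant distribution is the law of \<open>(r / \<sigma>) *\<^sub>R u\<close>, with \<open>r\<close> its norm and \<open>u\<close>
  uniform on the sphere.\<close>

lemma nn_integral_radial_density:
  fixes f :: "'a::euclidean_space \<Rightarrow> ennreal" and \<phi> :: "real \<Rightarrow> ennreal"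
  assumes [measurable]: "f \<in> borel_measurable borel" "\<phi> \<in> borel_measurable borel" and \<sigma>: "0 < \<sigma>"
  shows "(\<integral>\<^sup>+x. f x \<partial>density lborel (\<lambda>x. \<phi> (norm x))) =
    (\<integral>\<^sup>+x. (\<integral>\<^sup>+u. f ((norm x / \<sigma>) *\<^sub>R u) \<partial>uniform_sphere \<sigma>) \<partial>density (lborel :: 'a measure) (\<lambda>x. \<phi> (norm x)))"
proof -
  let ?L = "emeasure lborel (cball 0 \<sigma> :: 'a set)"
  let ?h = "\<lambda>x::'a. \<phi> (norm x) * f x"
  have U: "(\<integral>\<^sup>+u. f ((norm x / \<sigma>) *\<^sub>R u) \<partial>uniform_sphere \<sigma>) = (\<integral>\<^sup>+y. indicator (cball 0 \<sigma>) y * f ((norm x / norm y) *\<^sub>R y) \<partial>lborel) / ?L" for x :: 'a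
  proof -
    have "(\<integral>\<^sup>+u. f ((norm x / \<sigma>) *\<^sub>R u) \<partial>uniform_sphere \<sigma>) = (\<integral>\<^sup>+y. indicator (cball 0 \<sigma>) y * f ((norm x / \<sigma>) *\<^sub>R (\<sigma> / norm y) *\<^sub>R y) \<partial>lborel) / ?L"
      by (rule nn_integral_uniform_sphere[OF _ \<sigma>]) measurable
    then show ?thesis using \<sigma> by simp
  qed
  have hm: "?h \<in> borel_measurable borel" by measurable
  have Um: "(\<lambda>x::'a. (\<integral>\<^sup>+y. indicator (cball 0 \<sigma>) y * f ((norm x / norm y) *\<^sub>R y) \<partial>lborel) / ?L) \<in> borel_measurable borel"
    by measurable
  have "(\<integral>\<^sup>+x. (\<integral>\<^sup>+u. f ((norm x / \<sigma>) *\<^sub>R u) \<partial>uniform_sphere \<sigma>) \<partial>density (lborel :: 'a measure) (\<lambda>x. \<phi> (norm x)))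
      = (\<integral>\<^sup>+x. \<phi> (norm x) * ((\<integral>\<^sup>+y. indicator (cball 0 \<sigma>) y * f ((norm x / norm y) *\<^sub>R y) \<partial>lborel) / ?L) \<partial>(lborel :: 'a measure))"
    unfolding U by (rule nn_integral_density, simp_all only: measurable_lborel2 Um) measurable
  also have "\<dots> = (\<integral>\<^sup>+x. ((\<integral>\<^sup>+y. indicator (cball 0 \<sigma>) y * ?h ((norm x / norm y) *\<^sub>R y) \<partial>lborel) / ?L) \<partial>(lborel :: 'a measure))"
  proof (rule nn_integral_cong)
    fix x :: 'a
    have "\<phi> (norm x) * (\<integral>\<^sup>+y. indicator (cball 0 \<sigma>) y * f ((norm x / norm y) *\<^sub>R y) \<partial>lborel)
        = (\<integral>\<^sup>+y. \<phi> (norm x) * (indicator (cball 0 \<sigma>) y * f ((norm x / norm y) *\<^sub>R y)) \<partial>lborel)"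
      by (rule nn_integral_cmult[symmetric]) measurable
    also have "\<dots> = (\<integral>\<^sup>+y. indicator (cball 0 \<sigma>) y * ?h ((norm x / norm y) *\<^sub>R y) \<partial>lborel)"
      by (rule nn_integral_cong_AE, rule eventually_mono[OF AE_nonzero]) (simp add: mult_ac)
    finally show "\<phi> (norm x) * ((\<integral>\<^sup>+y. indicator (cball 0 \<sigma>) y * f ((norm x / norm y) *\<^sub>R y) \<partial>lborel) / ?L)
        = (\<integral>\<^sup>+y. indicator (cball 0 \<sigma>) y * ?h ((norm x / norm y) *\<^sub>R y) \<partial>lborel) / ?L"
      by (simp only: ennreal_times_divide)
  qed
  also have "\<dots> = (\<integral>\<^sup>+x. (\<integral>\<^sup>+y. indicator (cball 0 \<sigma>) y * ?h ((norm x / norm y) *\<^sub>R y) \<partial>lborel) \<partial>(lborel :: 'a measure)) / ?L"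
    by (rule nn_integral_divide) measurable
  also have "\<dots> = (?L * (\<integral>\<^sup>+x. ?h x \<partial>lborel)) / ?L"
    using polar_average[OF hm \<sigma>] by simp
  also have "\<dots> = (\<integral>\<^sup>+x. ?h x \<partial>lborel)"
    using emeasure_cball_pos_finite[OF \<sigma>, where 'a='a] by (subst mult.commute, intro ennreal_mult_divide_eq) auto
  also have "\<dots> = (\<integral>\<^sup>+x. f x \<partial>density lborel (\<lambda>x. \<phi> (norm x)))"
    by (subst nn_integral_density) simp_all
  finally show ?thesis by (rule sym)
qed

section \<open>Hyperplane sections of the sphere and non-degeneracy of the second moment\<close>

text \<open>Rotate \<open>v\<close> to the vertical direction and integrate over the height first.
  Squaring the equation gives a quadratic in the height with at most two roots as long as the
  horizontal part is non-zero, which is almost sure when there is a second coordinate.\<close>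

lemma null_cone:
  fixes v :: "real^'d"
  assumes d: "CARD('d) \<ge> 2" and v: "v \<noteq> 0"
  shows "AE x in lborel. v \<bullet> x \<noteq> k * norm x"
proof -
  let ?e = "axis piv 1 :: real^'d"
  have "norm ?e = norm ((1 / norm v) *\<^sub>R v)" using v by simp
  from orthogonal_transformation_exists[OF this]
  obtain R :: "real^'d \<Rightarrow> real^'d" where R: "orthogonal_transformation R" "R ?e = (1 / norm v) *\<^sub>R v" by blast
  have vR: "v \<bullet> R x = norm v * x $ piv" for x
  proof -
    have "R ?e \<bullet> R x = ?e \<bullet> x" using R(1) by (simp add: orthogonal_transformation_def)
    then show ?thesis using v by (simp add: R(2) inner_axis' field_simps)
  qed
  let ?f = "\<lambda>x. indicator {0::real} (v \<bullet> x - k * norm x) :: ennreal"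
  obtain j :: 'd where j: "j \<noteq> piv"
  proof -
    have "\<exists>j::'d. j \<noteq> piv"
    proof (rule ccontr)
      assume "\<not> ?thesis"
      then have "(UNIV :: 'd set) = {piv}" by auto
      then have "CARD('d) = 1" by (metis card_1_singleton_iff One_nat_def)
      then show False using d by simp
    qed
    then show ?thesis using that by blast
  qed
  have "axis j (1::real) \<noteq> 0" by (simp add: axis_eq_0_iff)
  from null_hyperplane[OF this, of 0] have ae: "AE x in lborel. rep 0 x \<noteq> (0 :: real^'d)"
    by (rule eventually_mono) (use j in \<open>auto simp: inner_axis' vec_eq_iff rep_nth\<close>)
  have inner: "(\<integral>\<^sup>+t. ?f (R (rep t x)) \<partial>lborel) = 0" if x: "rep 0 x \<noteq> 0" for x
  proof -
    define B where "B = (norm (rep 0 x))\<^sup>2"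
    define A where "A = (norm v)\<^sup>2 - k\<^sup>2"
    have B: "B > 0" using x by (simp add: B_def)
    have sol: "t \<in> {sqrt (k\<^sup>2 * B / A), - sqrt (k\<^sup>2 * B / A)}" if "v \<bullet> R (rep t x) - k * norm (R (rep t x)) = 0" for t
    proof -
      have "norm v * t = k * norm (rep t x)"
        using that by (simp add: vR rep_nth orthogonal_transformation_norm[OF R(1)])
      then have "(norm v * t)\<^sup>2 = (k * norm (rep t x))\<^sup>2" by simp
      then have eq: "A * t\<^sup>2 = k\<^sup>2 * B"
        unfolding power_mult_distrib norm_rep[of t x] A_def B_def by (simp add: algebra_simps)
      \<comment> \<open>A degenerate quadratic would force k = 0, and then v = 0.\<close>
      have "A \<noteq> 0"
      proof
        assume "A = 0"
        then have "k = 0" using eq B by simp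
        then show False using \<open>A = 0\<close> v by (simp add: A_def)
      qed
      then have "t\<^sup>2 = k\<^sup>2 * B / A" using eq by (simp add: field_simps)
      then have "\<bar>t\<bar> = sqrt (k\<^sup>2 * B / A)" by (metis real_sqrt_abs)
      then show ?thesis by auto
    qed
    have "(\<integral>\<^sup>+t. ?f (R (rep t x)) \<partial>lborel) = (\<integral>\<^sup>+t. 0 \<partial>(lborel :: real measure))"
    proof (rule nn_integral_cong_AE)
      show "AE t in lborel. ?f (R (rep t x)) = 0"
        using AE_lborel_singleton[of "sqrt (k\<^sup>2 * B / A)"] AE_lborel_singleton[of "- sqrt (k\<^sup>2 * B / A)"]
        by eventually_elim (use sol in \<open>auto simp: indicator_def\<close>)
    qed
    then show ?thesis by simp
  qed
  have Rm [measurable]: "R \<in> borel_measurable borel"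
    using R(1) by (intro borel_measurable_linear) (simp add: orthogonal_transformation_def)
  have "(\<integral>\<^sup>+x. ?f x \<partial>lborel) = (\<integral>\<^sup>+x. ?f (R x) \<partial>lborel)"
    by (rule nn_integral_orthogonal[OF R(1), symmetric]) measurable
  also have "\<dots> = (\<integral>\<^sup>+x. indicator {0..1} (x $ piv) * (\<integral>\<^sup>+t. ?f (R (rep t x)) \<partial>lborel) \<partial>(lborel :: (real^'d) measure))"
    by (rule nn_integral_rep) measurable
  also have "\<dots> = (\<integral>\<^sup>+x. 0 \<partial>(lborel :: (real^'d) measure))"
    by (rule nn_integral_cong_AE, rule eventually_mono[OF ae]) (simp add: inner)
  finally have "(\<integral>\<^sup>+x. ?f x \<partial>lborel) = 0" by simp
  then have "AE x in lborel. ?f x = 0" by (subst (asm) nn_integral_0_iff_AE) simp_all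
  then show ?thesis by (rule eventually_mono) (auto simp: indicator_def split: if_splits)
qed

lemma null_hyperplanes_uniform_sphere:
  assumes d: "CARD('d) \<ge> 2" and \<sigma>: "0 < \<sigma>"
  shows "null_hyperplanes (uniform_sphere \<sigma> :: (real^'d) measure)"
  unfolding null_hyperplanes_def
proof (intro allI impI)
  fix v :: "real^'d" and k assume v: "v \<noteq> 0"
  show "AE u in uniform_sphere \<sigma>. v \<bullet> u \<noteq> k"
  proof (rule AE_uniform_sphere[OF \<sigma>])
    show "AE x in lborel. v \<bullet> (\<sigma> / norm x) *\<^sub>R x \<noteq> k"
      using null_cone[OF d v, of "k / \<sigma>"] AE_nonzero
      by eventually_elim (use \<sigma> in \<open>auto simp: field_simps\<close>)
  qed measurable
qed

text \<open>The smallest value of \<open>v \<bullet> u\<close> on the sphere is -\<sigma> |v|,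
  attained opposite to \<open>v\<close>. Halfway along that radius lies a point of the open set
  \<open>W\<close>, which is therefore not null.\<close>

lemma uniform_sphere_open_pos:
  fixes v :: "'a::euclidean_space"
  assumes \<sigma>: "0 < \<sigma>" and k: "- \<sigma> * norm v < k" and v: "v \<noteq> 0"
  shows "0 < measure (uniform_sphere \<sigma>) {u. v \<bullet> u < k}"
proof -
  let ?f = "\<lambda>x::'a. (\<sigma> / norm x) *\<^sub>R x"
  define W where "W = ball 0 \<sigma> \<inter> {x. \<sigma> * (v \<bullet> x) < k * norm x}"
  interpret prob_space "uniform_sphere \<sigma> :: 'a measure" by (rule prob_space_uniform_sphere[OF \<sigma>])
  have "open W" unfolding W_def by (intro open_Int open_ball open_Collect_less continuous_intros)
  moreover have "- ((\<sigma> / (2 * norm v)) *\<^sub>R v) \<in> W"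
    using \<sigma> v mult_strict_left_mono[OF k, of \<sigma>]
    by (simp add: W_def power2_norm_eq_inner[symmetric] power2_eq_square field_simps)
  ultimately have "\<not> negligible W" by (intro open_not_negligible) auto
  then have W0: "emeasure lborel W \<noteq> 0"
    using \<open>open W\<close> by (auto simp: negligible_iff_null_sets null_sets_def)
  have "W \<subseteq> cball 0 \<sigma> \<inter> ?f -` {u. v \<bullet> u < k}"
  proof
    fix x assume x: "x \<in> W"
    then have "x \<noteq> 0" by (auto simp: W_def)
    then show "x \<in> cball 0 \<sigma> \<inter> ?f -` {u. v \<bullet> u < k}" using x \<sigma> by (auto simp: W_def field_simps)
  qed
  then have "emeasure lborel W \<le> emeasure lborel (cball 0 \<sigma> \<inter> ?f -` {u. v \<bullet> u < k})"
    by (intro emeasure_mono) (use measurable_sets_borel[of ?f borel "{u. v \<bullet> u < k}"] in auto)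
  then have pos: "emeasure lborel (cball 0 \<sigma> \<inter> ?f -` {u. v \<bullet> u < k}) \<noteq> 0" using W0 by auto
  have "emeasure (uniform_sphere \<sigma>) {u. v \<bullet> u < k} = emeasure lborel (cball 0 \<sigma> \<inter> ?f -` {u. v \<bullet> u < k}) / emeasure lborel (cball 0 \<sigma> :: 'a set)"
    unfolding uniform_sphere_eq[OF \<sigma>]
    using measurable_sets_borel[of ?f borel "{u. v \<bullet> u < k}"]
    by (subst emeasure_distr) (simp_all add: emeasure_uniform_measure)
  then have "emeasure (uniform_sphere \<sigma>) {u. v \<bullet> u < k} \<noteq> 0"
    using pos emeasure_cball_pos_finite[OF \<sigma>, where 'a='a] by (simp add: ennreal_divide_eq_0_iff)
  then show ?thesis by (simp add: emeasure_eq_measure zero_less_measure_iff)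
qed

text \<open>A hyperplane through distinct points of the sphere is not tangent to it, so both caps
  have positive mass and p^2 + q^2 < (p + q)^2 \<le> 1. Approximation would only give the weak
  inequality.\<close>

lemma facet_moment_uniform_sphere_less_1:
  assumes d: "CARD('d) \<ge> 2" and \<sigma>: "0 < \<sigma>"
  shows "facet_moment (uniform_sphere \<sigma> :: (real^'d) measure) 2 < 1"
proof -
  let ?U = "uniform_sphere \<sigma> :: (real^'d) measure" and ?P = "PiM UNIV (\<lambda>_::'d. uniform_sphere \<sigma> :: (real^'d) measure)"
  have p: "prob_space ?U" by (rule prob_space_uniform_sphere[OF \<sigma>])
  interpret U: prob_space ?U by (rule p)
  interpret P: prob_space ?P using p by (intro prob_space_PiM)
  note null = null_hyperplanes_uniform_sphere[OF d \<sigma>]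
  note ms = measurable_sides[OF p sets_uniform_sphere null finite.emptyI]
  have spU: "space ?U = UNIV" using sets_eq_imp_space_eq[OF sets_uniform_sphere[of \<sigma>]] by simp
  let ?p = "\<lambda>X. measure ?U {y. side X y < 0}" and ?q = "\<lambda>X. measure ?U {y. 0 < side X y}"
  have sphere: "AE x in ?P. \<forall>i\<in>UNIV. norm (x i) = \<sigma>"
  proof (rule AE_finite_allI)
    fix i :: 'd
    have "AE u in ?U. norm u = \<sigma>"
      by (rule AE_uniform_sphere[OF \<sigma>]) (use \<sigma> in \<open>auto intro: eventually_mono[OF AE_nonzero]\<close>)
    then show "AE x in ?P. norm (x i) = \<sigma>"
      by (intro AE_PiM_component) (auto intro: p)
  qed simp
  have strict: "?p X ^ 2 + ?q X ^ 2 < 1" if nu: "nu X \<noteq> 0" and X: "\<And>i. norm (X $ i) = \<sigma>" for X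
  proof -
    let ?k = "nu X \<bullet> X $ piv"
    have ki: "nu X \<bullet> X $ i = ?k" for i using nu_orthogonal[of X i] by (simp add: inner_diff_right)
    \<comment> \<open>Otherwise equality holds in Cauchy-Schwarz for every row. All rows are then
      the same multiple of the normal, whereas \<open>nu_inj\<close> makes them distinct and there
      are at least two.\<close>
    have "\<bar>?k\<bar> < norm (nu X) * \<sigma>"
    proof (rule ccontr)
      assume "\<not> ?thesis"
      then have "norm (nu X) * norm (X $ i) \<le> \<bar>nu X \<bullet> X $ i\<bar>" for i
        unfolding X ki[of i] by (simp only: not_less)
      then have eq: "\<bar>nu X \<bullet> X $ i\<bar> = norm (nu X) * norm (X $ i)" for i
        using Cauchy_Schwarz_ineq2[of "nu X" "X $ i"] by (intro order.antisym)
      define s where "s = sgn ?k"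
      have "norm (nu X) *\<^sub>R X $ i = (s * \<sigma>) *\<^sub>R nu X" for i
      proof (cases "0 \<le> ?k")
        case True
        then have "nu X \<bullet> X $ i = norm (nu X) * norm (X $ i)" using eq[of i] ki[of i] by simp
        then have *: "norm (nu X) *\<^sub>R X $ i = \<sigma> *\<^sub>R nu X" using norm_cauchy_schwarz_eq[of "nu X" "X $ i"] X by simp
        have "0 < ?k" using eq[of piv] X nu \<sigma> True by auto
        then show ?thesis using * by (simp add: s_def)
      next
        case False
        then have "(- nu X) \<bullet> X $ i = norm (- nu X) * norm (X $ i)" using eq[of i] ki[of i] by simp
        then have "norm (- nu X) *\<^sub>R X $ i = \<sigma> *\<^sub>R (- nu X)" using norm_cauchy_schwarz_eq[of "- nu X" "X $ i"] X by simp
        then show ?thesis using False by (simp add: s_def)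
      qed
      then have "norm (nu X) *\<^sub>R X $ i = norm (nu X) *\<^sub>R X $ j" for i j by simp
      then have "X $ i = X $ j" for i j using nu by simp
      then have "i = j" for i j :: 'd using nu_inj[OF nu] by (auto dest: injD)
      then have "(UNIV :: 'd set) = {piv}" by auto
      then have "CARD('d) = 1" by (metis card_1_singleton_iff One_nat_def)
      then show False using d by simp
    qed
    then have "- \<sigma> * norm (nu X) < ?k" "- \<sigma> * norm (- nu X) < - ?k" by (auto simp: mult.commute)
    from uniform_sphere_open_pos[OF \<sigma> this(1) nu] uniform_sphere_open_pos[OF \<sigma> this(2)] nu
    have pq: "0 < ?p X" "0 < ?q X" by (simp_all add: side_def inner_diff_right)
    have hs: "{y. side X y < 0} \<in> sets ?U" "{y. 0 < side X y} \<in> sets ?U" unfolding sets_uniform_sphere by measurable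
    have "measure ?U ({y. side X y < 0} \<union> {y. 0 < side X y}) = ?p X + ?q X"
      by (rule U.finite_measure_Union[OF hs]) auto
    then have "?p X + ?q X \<le> 1" using U.prob_le_1[of "{y. side X y < 0} \<union> {y. 0 < side X y}"] by simp
    then have "(?p X + ?q X)\<^sup>2 \<le> 1" using pq by (intro power_le_one) auto
    moreover have "0 < 2 * ?p X * ?q X" using pq by simp
    ultimately show ?thesis using power2_sum[of "?p X" "?q X"] by linarith
  qed
  let ?g = "\<lambda>x. 1 - (?p (vec_lambda x) ^ 2 + ?q (vec_lambda x) ^ 2)"
  have vl: "(\<lambda>x. vec_lambda x) \<in> borel_measurable ?P" by (rule measurable_vec_of_fun[OF sets_uniform_sphere])
  have gm: "(\<lambda>x. ?p (vec_lambda x) ^ 2 + ?q (vec_lambda x) ^ 2) \<in> borel_measurable ?P"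
    by (intro borel_measurable_add borel_measurable_power measurable_compose[OF vl ms(1)] measurable_compose[OF vl ms(2)])
  have gi: "integrable ?P (\<lambda>x. ?p (vec_lambda x) ^ 2 + ?q (vec_lambda x) ^ 2)"
  proof (rule P.integrable_const_bound[where B=2, OF _ gm], rule AE_I2)
    fix x
    have "?p (vec_lambda x) ^ 2 \<le> 1" "?q (vec_lambda x) ^ 2 \<le> 1" by (rule power_le_one; simp)+
    then show "norm (?p (vec_lambda x) ^ 2 + ?q (vec_lambda x) ^ 2) \<le> 2" by simp
  qed
  have pos: "AE x in ?P. 0 < ?g x"
    using sphere AE_nu_nonzero[OF p sets_uniform_sphere null]
  proof eventually_elim
    fix x :: "'d \<Rightarrow> real^'d" assume "\<forall>i\<in>UNIV. norm (x i) = \<sigma>" "nu (vec_lambda x) \<noteq> 0"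
    then show "0 < ?g x" using strict[of "vec_lambda x"] by simp
  qed
  have int: "integrable ?P ?g" using gi by simp
  have "0 < (LINT x|?P. ?g x)"
  proof -
    have "0 \<le> (LINT x|?P. ?g x)" using pos by (intro integral_nonneg_AE) (auto elim: eventually_mono)
    moreover have "(LINT x|?P. ?g x) \<noteq> 0"
    proof
      assume "(LINT x|?P. ?g x) = 0"
      then have "AE x in ?P. ?g x = 0"
        using pos by (subst (asm) integral_nonneg_eq_0_iff_AE[OF int]) (auto elim: eventually_mono)
      with pos have "AE x in ?P. False" by eventually_elim simp
      then show False by simp
    qed
    ultimately show ?thesis by simp
  qed
  then show ?thesis using gi by (simp add: facet_moment_def P.prob_space)
qed

section \<open>Beta distributions with exponent close to -1\<close>

lemma emeasure_shell:
  assumes "0 \<le> r" "r \<le> \<sigma>"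
  shows "emeasure lborel (cball 0 \<sigma> - ball 0 r :: 'a::euclidean_space set) =
      ennreal (unit_ball_vol (real DIM('a)) * (\<sigma> ^ DIM('a) - r ^ DIM('a)))" (is ?A)
    "emeasure lborel (ball 0 \<sigma> - ball 0 r :: 'a set) =
      ennreal (unit_ball_vol (real DIM('a)) * (\<sigma> ^ DIM('a) - r ^ DIM('a)))" (is ?B)
proof -
  have fin: "emeasure lborel (ball 0 r :: 'a set) \<noteq> \<infinity>" using assms by (simp add: emeasure_ball)
  have "emeasure lborel (cball 0 \<sigma> - ball 0 r :: 'a set) = emeasure lborel (cball 0 \<sigma> :: 'a set) - emeasure lborel (ball 0 r :: 'a set)"
    using assms fin by (intro emeasure_Diff) auto
  moreover have "emeasure lborel (ball 0 \<sigma> - ball 0 r :: 'a set) = emeasure lborel (ball 0 \<sigma> :: 'a set) - emeasure lborel (ball 0 r :: 'a set)"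
    using assms fin by (intro emeasure_Diff) auto
  ultimately show ?A ?B
    using assms by (simp_all add: emeasure_ball emeasure_cball ennreal_minus right_diff_distrib)
qed

lemma measurable_beta_weight:
  "(\<lambda>x::'a::euclidean_space. indicator (cball 0 \<sigma>) x * (1 - (norm x)\<^sup>2 / \<sigma>\<^sup>2) powr \<beta> :: real) \<in> borel_measurable borel"
proof -
  have [measurable]: "cball (0::'a) \<sigma> \<in> sets borel" by simp
  show ?thesis by measurable
qed

text \<open>The case u = 0 is excluded on the right because \<open>0 powr \<beta>\<close> is 0
  rather than infinite.\<close>

lemma le_powr_iff:
  fixes \<beta> t u :: real
  assumes "\<beta> < 0" "1 \<le> t" "0 \<le> u"
  shows "t \<le> u powr \<beta> \<longleftrightarrow> 0 < u \<and> u \<le> t powr (1 / \<beta>)"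
proof (cases "u = 0")
  case False
  then have u: "0 < u" using assms by simp
  show ?thesis
  proof
    assume "t \<le> u powr \<beta>"
    then have "(u powr \<beta>) powr (1 / \<beta>) \<le> t powr (1 / \<beta>)" using assms by (intro powr_mono2') auto
    then show "0 < u \<and> u \<le> t powr (1 / \<beta>)" using assms u by (simp add: powr_powr)
  next
    assume "0 < u \<and> u \<le> t powr (1 / \<beta>)"
    then have "(t powr (1 / \<beta>)) powr \<beta> \<le> u powr \<beta>" using assms by (intro powr_mono2') auto
    then show "t \<le> u powr \<beta>" using assms by (simp add: powr_powr)
  qed
qed (use assms in simp)

text \<open>With s = t^(1/\<beta>), the level set is a shell with inner radius \<sigma> sqrt(1-s),
  of volume l (1 - (1-s)^(d/2)). As d is at least 2, this is at least l s; Bernoulli's inequality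
  bounds it above by l d s.\<close>

lemma beta_level_set:
  fixes \<sigma> \<beta> t :: real
  defines "\<phi> \<equiv> \<lambda>x::'a::euclidean_space. indicator (cball 0 \<sigma>) x * (1 - (norm x)\<^sup>2 / \<sigma>\<^sup>2) powr \<beta>"
    and "l \<equiv> unit_ball_vol (real DIM('a)) * \<sigma> ^ DIM('a)"
  assumes d: "DIM('a) \<ge> 2" and \<sigma>: "0 < \<sigma>" and \<beta>: "\<beta> < 0" and t: "1 \<le> t"
  shows "ennreal (l * t powr (1 / \<beta>)) \<le> emeasure lborel {x. t \<le> \<phi> x}"
    and "emeasure lborel {x. t \<le> \<phi> x} \<le> ennreal (l * real DIM('a) * t powr (1 / \<beta>))"
proof -
  let ?D = "DIM('a)"
  define s where "s = t powr (1 / \<beta>)"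
  define r where "r = \<sigma> * sqrt (1 - s)"
  have "s \<le> t powr 0" unfolding s_def using t \<beta> by (intro powr_mono) auto
  then have s: "0 < s" "s \<le> 1" using t by (auto simp: s_def)
  have r: "0 \<le> r" "r \<le> \<sigma>" using s \<sigma> by (auto simp: r_def)
  have l0: "0 \<le> l" using \<sigma> by (simp add: l_def)
  have mono_r: "r \<le> n \<longleftrightarrow> 1 - n\<^sup>2 / \<sigma>\<^sup>2 \<le> s" if "0 \<le> n" for n
  proof -
    have "r \<le> n \<longleftrightarrow> r\<^sup>2 \<le> n\<^sup>2" using r that by (simp add: abs_le_square_iff[symmetric])
    also have "r\<^sup>2 = \<sigma>\<^sup>2 * (1 - s)" using s by (simp add: r_def power_mult_distrib)
    finally show ?thesis using \<sigma> by (simp add: field_simps)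
  qed
  have [measurable]: "\<phi> \<in> borel_measurable borel" unfolding \<phi>_def by (rule measurable_beta_weight)
  have ms: "{x. t \<le> \<phi> x} \<in> sets lborel" by measurable
  have sub1: "ball 0 \<sigma> - ball 0 r \<subseteq> {x. t \<le> \<phi> x}"
  proof
    fix x :: 'a assume x: "x \<in> ball 0 \<sigma> - ball 0 r"
    then have n: "norm x < \<sigma>" "r \<le> norm x" by auto
    then have "(norm x)\<^sup>2 < \<sigma>\<^sup>2" by (intro power_strict_mono) auto
    then have u: "0 < 1 - (norm x)\<^sup>2 / \<sigma>\<^sup>2" using \<sigma> by simp
    then have "t \<le> (1 - (norm x)\<^sup>2 / \<sigma>\<^sup>2) powr \<beta>"
      using n mono_r[of "norm x"] by (subst le_powr_iff[OF \<beta> t]) (auto simp: s_def)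
    then show "x \<in> {x. t \<le> \<phi> x}" using n by (simp add: \<phi>_def)
  qed
  have sub2: "{x. t \<le> \<phi> x} \<subseteq> cball 0 \<sigma> - ball 0 r"
  proof
    fix x :: 'a assume "x \<in> {x. t \<le> \<phi> x}"
    then have x: "norm x \<le> \<sigma>" "t \<le> (1 - (norm x)\<^sup>2 / \<sigma>\<^sup>2) powr \<beta>"
      using t by (cases "norm x \<le> \<sigma>"; simp add: \<phi>_def)+
    then have "(norm x)\<^sup>2 \<le> \<sigma>\<^sup>2" by (intro power_mono) auto
    then have "0 \<le> 1 - (norm x)\<^sup>2 / \<sigma>\<^sup>2" using \<sigma> by simp
    then have "1 - (norm x)\<^sup>2 / \<sigma>\<^sup>2 \<le> s" using x(2) by (subst (asm) le_powr_iff[OF \<beta> t]) (auto simp: s_def)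
    then show "x \<in> cball 0 \<sigma> - ball 0 r" using mono_r[of "norm x"] x(1) by simp
  qed
  have vol: "unit_ball_vol (real ?D) * (\<sigma> ^ ?D - r ^ ?D) = l * (1 - sqrt (1 - s) ^ ?D)"
    by (simp add: l_def r_def power_mult_distrib algebra_simps)
  have "sqrt (1 - s) ^ ?D \<le> sqrt (1 - s) ^ 2" using d s by (intro power_decreasing) auto
  then have "s \<le> 1 - sqrt (1 - s) ^ ?D" using s by simp
  then have "ennreal (l * s) \<le> emeasure lborel (ball 0 \<sigma> - ball 0 r :: 'a set)"
    unfolding emeasure_shell(2)[OF r] vol using l0 by (intro ennreal_leI mult_left_mono)
  also have "\<dots> \<le> emeasure lborel {x. t \<le> \<phi> x}" by (rule emeasure_mono[OF sub1 ms])
  finally show "ennreal (l * t powr (1 / \<beta>)) \<le> emeasure lborel {x. t \<le> \<phi> x}" by (simp add: s_def)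
  have "(1 - s)\<^sup>2 \<le> 1 - s" using s by (simp add: power2_eq_square mult_left_le)
  then have "1 - s \<le> sqrt (1 - s)" by (rule real_le_rsqrt)
  then have "(1 - s) ^ ?D \<le> sqrt (1 - s) ^ ?D" using s by (intro power_mono) auto
  moreover have "1 + real ?D * (- s) \<le> (1 + (- s)) ^ ?D" using s by (intro Bernoulli_inequality) auto
  ultimately have "1 - sqrt (1 - s) ^ ?D \<le> real ?D * s" by simp
  then have "l * (1 - sqrt (1 - s) ^ ?D) \<le> l * (real ?D * s)" using l0 by (rule mult_left_mono)
  then have up: "emeasure lborel (cball 0 \<sigma> - ball 0 r :: 'a set) \<le> ennreal (l * real ?D * s)"
    unfolding emeasure_shell(1)[OF r] vol by (intro ennreal_leI) (simp add: mult.assoc)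
  have "emeasure lborel {x. t \<le> \<phi> x} \<le> emeasure lborel (cball 0 \<sigma> - ball 0 r :: 'a set)"
    by (rule emeasure_mono[OF sub2]) simp
  with up show "emeasure lborel {x. t \<le> \<phi> x} \<le> ennreal (l * real ?D * t powr (1 / \<beta>))"
    unfolding s_def by (rule order.trans[rotated])
qed

lemma nn_integral_powr_tail:
  fixes \<beta> :: real
  assumes "- 1 < \<beta>" "\<beta> < 0"
  shows "(\<integral>\<^sup>+t. ennreal (t powr (1 / \<beta>)) * indicator {1..} t \<partial>lborel) = ennreal (- \<beta> / (1 + \<beta>))"
proof -
  define a where "a = 1 / \<beta> + 1"
  have a: "a < 0" using assms by (simp add: a_def field_simps)
  have "(\<integral>\<^sup>+t. ennreal (t powr (1 / \<beta>)) * indicator {1..} t \<partial>lborel) = ennreal (0 - 1 powr a / a)"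
  proof (rule nn_integral_FTC_atLeast)
    fix t :: real assume "1 \<le> t"
    then show "((\<lambda>t. t powr a / a) has_real_derivative t powr (1 / \<beta>)) (at t)"
      using a by (auto intro!: derivative_eq_intros simp: a_def)
  next
    have "((\<lambda>t. t powr a) \<longlongrightarrow> 0) at_top" using a by (intro tendsto_neg_powr filterlim_ident)
    then show "((\<lambda>t. t powr a / a) \<longlongrightarrow> 0) at_top" using a by (auto intro: tendsto_divide_zero)
  qed auto
  also have "0 - 1 powr a / a = - \<beta> / (1 + \<beta>)" using assms a by (simp add: a_def field_simps)
  finally show ?thesis .
qed

text \<open>Layer-cake integration of the level sets. The lower bound tends to infinity as \<beta>
  tends to -1, which drives the normalised mass out of every smaller ball; the upper bound makes
  normalisation possible.\<close>

lemma beta_mass: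
  fixes \<sigma> \<beta> :: real
  defines "\<phi> \<equiv> \<lambda>x::'a::euclidean_space. indicator (cball 0 \<sigma>) x * (1 - (norm x)\<^sup>2 / \<sigma>\<^sup>2) powr \<beta>"
    and "l \<equiv> unit_ball_vol (real DIM('a)) * \<sigma> ^ DIM('a)"
  assumes d: "DIM('a) \<ge> 2" and \<sigma>: "0 < \<sigma>" and \<beta>: "- 1 < \<beta>" "\<beta> < 0"
  shows "ennreal (l * (- \<beta> / (1 + \<beta>))) \<le> (\<integral>\<^sup>+x. ennreal (\<phi> x) \<partial>lborel)"
    and "(\<integral>\<^sup>+x. ennreal (\<phi> x) \<partial>lborel) < \<infinity>"
proof -
  let ?I = "\<integral>\<^sup>+t. ennreal (t powr (1 / \<beta>)) * indicator {1..} t \<partial>(lborel :: real measure)"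
  have l0: "0 \<le> l" using \<sigma> by (simp add: l_def)
  have [measurable]: "\<phi> \<in> borel_measurable borel" unfolding \<phi>_def by (rule measurable_beta_weight)
  have \<phi>0: "0 \<le> \<phi> x" for x by (simp add: \<phi>_def)
  have "(\<integral>\<^sup>+x. ennreal (\<phi> x) \<partial>lborel) = (\<integral>\<^sup>+x. (\<integral>\<^sup>+t. indicator {0<..} t * indicator {0..} (\<phi> x - t) \<partial>lborel) \<partial>(lborel :: 'a measure))"
  proof (rule nn_integral_cong)
    fix x :: 'a
    have "(\<integral>\<^sup>+t. indicator {0<..} t * indicator {0..} (\<phi> x - t) \<partial>lborel) = (\<integral>\<^sup>+t. indicator {0<..\<phi> x} t \<partial>(lborel :: real measure))"
      by (intro nn_integral_cong) (auto simp: indicator_def)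
    then show "ennreal (\<phi> x) = (\<integral>\<^sup>+t. indicator {0<..} t * indicator {0..} (\<phi> x - t) \<partial>lborel)"
      using \<phi>0[of x] by simp
  qed
  also have "\<dots> = (\<integral>\<^sup>+t. (\<integral>\<^sup>+x. indicator {0<..} t * indicator {0..} (\<phi> x - t) \<partial>lborel) \<partial>(lborel :: real measure))"
    by (rule lborel_pair.Fubini') measurable
  also have "\<dots> = (\<integral>\<^sup>+t. indicator {0<..} t * emeasure lborel {x. t \<le> \<phi> x} \<partial>(lborel :: real measure))"
  proof (rule nn_integral_cong)
    fix t :: real
    have "(\<integral>\<^sup>+x. indicator {0<..} t * indicator {0..} (\<phi> x - t) \<partial>lborel) = (\<integral>\<^sup>+x. indicator {0<..} t * indicator {x. t \<le> \<phi> x} x \<partial>lborel)"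
      by (intro nn_integral_cong) (auto simp: indicator_def)
    also have "\<dots> = indicator {0<..} t * emeasure lborel {x. t \<le> \<phi> x}"
      by (subst nn_integral_cmult_indicator) simp_all
    finally show "(\<integral>\<^sup>+x. indicator {0<..} t * indicator {0..} (\<phi> x - t) \<partial>lborel) = indicator {0<..} t * emeasure lborel {x. t \<le> \<phi> x}" .
  qed
  finally have Z: "(\<integral>\<^sup>+x. ennreal (\<phi> x) \<partial>lborel) = (\<integral>\<^sup>+t. indicator {0<..} t * emeasure lborel {x. t \<le> \<phi> x} \<partial>(lborel :: real measure))" .
  have level: "ennreal (l * t powr (1 / \<beta>)) \<le> emeasure lborel {x. t \<le> \<phi> x}"
      "emeasure lborel {x. t \<le> \<phi> x} \<le> ennreal (l * real DIM('a) * t powr (1 / \<beta>))" if "1 \<le> t" for t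
    using beta_level_set[OF d \<sigma> \<beta>(2) that] by (simp_all only: \<phi>_def l_def)
  have I: "ennreal (c * (- \<beta> / (1 + \<beta>))) = (\<integral>\<^sup>+t. ennreal (c * t powr (1 / \<beta>)) * indicator {1..} t \<partial>lborel)" if "0 \<le> c" for c
  proof -
    have "ennreal (c * (- \<beta> / (1 + \<beta>))) = ennreal c * ?I"
      unfolding nn_integral_powr_tail[OF \<beta>] using that \<beta> by (intro ennreal_mult) (auto intro!: divide_nonpos_pos)
    also have "\<dots> = (\<integral>\<^sup>+t. ennreal c * (ennreal (t powr (1 / \<beta>)) * indicator {1..} t) \<partial>lborel)"
      by (rule nn_integral_cmult[symmetric]) measurable
    finally show ?thesis using that by (simp add: ennreal_mult mult.assoc)
  qed
  show "ennreal (l * (- \<beta> / (1 + \<beta>))) \<le> (\<integral>\<^sup>+x. ennreal (\<phi> x) \<partial>lborel)"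
    unfolding Z I[OF l0] by (intro nn_integral_mono) (use level(1) in \<open>auto simp: indicator_def\<close>)
  have "(\<integral>\<^sup>+x. ennreal (\<phi> x) \<partial>lborel) \<le> (\<integral>\<^sup>+t. (ennreal l * indicator {0..1} t + ennreal (l * real DIM('a) * t powr (1 / \<beta>)) * indicator {1..} t) \<partial>lborel)"
    unfolding Z
  proof (rule nn_integral_mono)
    fix t :: real
    consider "t \<le> 0" | "0 < t" "t < 1" | "1 \<le> t" by linarith
    then show "indicator {0<..} t * emeasure lborel {x. t \<le> \<phi> x} \<le> ennreal l * indicator {0..1} t + ennreal (l * real DIM('a) * t powr (1 / \<beta>)) * indicator {1..} t"
    proof cases
      case 2
      have "emeasure lborel {x. t \<le> \<phi> x} \<le> emeasure lborel (cball 0 \<sigma> :: 'a set)"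
        using 2 by (intro emeasure_mono) (auto simp: \<phi>_def indicator_def split: if_splits)
      then show ?thesis using 2 \<sigma> by (simp add: emeasure_cball l_def)
    next
      case 3
      then show ?thesis using level(2)[OF 3] by (simp add: add_increasing)
    qed simp
  qed
  also have "\<dots> = ennreal l + ennreal (l * real DIM('a) * (- \<beta> / (1 + \<beta>)))"
  proof -
    have "0 \<le> l * real DIM('a)" using l0 by simp
    show ?thesis unfolding I[OF \<open>0 \<le> l * real DIM('a)\<close>] by (subst nn_integral_add) (simp_all add: nn_integral_cmult_indicator)
  qed
  also have "\<dots> < \<infinity>" by simp
  finally show "(\<integral>\<^sup>+x. ennreal (\<phi> x) \<partial>lborel) < \<infinity>" .
qed

text \<open>As the exponent tends to \<open>- 1\<close>, the beta distributions concentrate near the sphere.\<close>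

lemma beta_near_sphere:
  fixes \<sigma> \<beta> :: real
  assumes d: "CARD('d) \<ge> 2" and \<sigma>: "0 < \<sigma>" and \<beta>: "- 1 < \<beta>" "\<beta> < 0"
  obtains \<mu> :: "(real^'d) measure" and \<psi> :: "real \<Rightarrow> ennreal"
  where "\<psi> \<in> borel_measurable borel" "\<mu> = density lborel (\<lambda>x. \<psi> (norm x))" "facet_gap \<mu>"
    "measure \<mu> {x. norm x \<le> \<sigma>} = 1"
    "\<And>r. 0 \<le> r \<Longrightarrow> r < \<sigma> \<Longrightarrow> measure \<mu> {x. norm x \<le> r} \<le> (1 + \<beta>) / (- \<beta>) / (1 - r\<^sup>2 / \<sigma>\<^sup>2)"
proof -
  define \<phi> where "\<phi> = (\<lambda>x::real^'d. indicator (cball 0 \<sigma>) x * (1 - (norm x)\<^sup>2 / \<sigma>\<^sup>2) powr \<beta>)"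
  define l where "l = unit_ball_vol (real DIM(real^'d)) * \<sigma> ^ DIM(real^'d)"
  define Z where "Z = (\<integral>\<^sup>+x. ennreal (\<phi> x) \<partial>lborel)"
  have d': "DIM(real^'d) \<ge> 2" using d by simp
  have l: "0 < l" using \<sigma> by (simp add: l_def)
  have [measurable]: "\<phi> \<in> borel_measurable borel" unfolding \<phi>_def by (rule measurable_beta_weight)
  have \<phi>0: "0 \<le> \<phi> x" for x by (simp add: \<phi>_def)
  have mass: "ennreal (l * (- \<beta> / (1 + \<beta>))) \<le> Z" "Z < \<infinity>"
    using beta_mass[OF d' \<sigma> \<beta>] by (simp_all only: Z_def \<phi>_def l_def)
  define z where "z = enn2real Z"
  have Zz: "Z = ennreal z" using mass(2) by (simp add: z_def)
  have zl: "l * (- \<beta> / (1 + \<beta>)) \<le> z"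
  proof -
    have "0 \<le> z" by (simp add: z_def)
    then show ?thesis using mass(1) by (simp add: Zz ennreal_le_iff)
  qed
  moreover have "0 < l * (- \<beta> / (1 + \<beta>))" using l \<beta> by (intro mult_pos_pos divide_pos_pos) auto
  ultimately have z: "0 < z" by linarith
  define \<mu> where "\<mu> = density lborel (\<lambda>x. ennreal (1 / z * \<phi> x))"
  define \<psi> where "\<psi> = (\<lambda>r. ennreal (1 / z * (indicator {..\<sigma>} r * (1 - r\<^sup>2 / \<sigma>\<^sup>2) powr \<beta>)))"
  have em: "emeasure \<mu> A = (\<integral>\<^sup>+x. ennreal (1 / z) * (ennreal (\<phi> x) * indicator A x) \<partial>lborel)" if "A \<in> sets borel" for A
  proof -
    have "emeasure \<mu> A = (\<integral>\<^sup>+x. ennreal (1 / z * \<phi> x) * indicator A x \<partial>lborel)"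
      unfolding \<mu>_def using that by (intro emeasure_density) simp_all
    also have "\<dots> = (\<integral>\<^sup>+x. ennreal (1 / z) * (ennreal (\<phi> x) * indicator A x) \<partial>lborel)"
      using z by (simp only: ennreal_mult[OF _ \<phi>0] zero_le_divide_1_iff less_imp_le mult.assoc)
    finally show ?thesis .
  qed
  have "emeasure \<mu> UNIV = ennreal (1 / z) * Z"
    unfolding Z_def em[of UNIV, simplified] by (rule nn_integral_cmult) measurable
  also have "\<dots> = 1" using z by (simp add: Zz ennreal_mult[symmetric])
  finally have p: "prob_space \<mu>" by (intro prob_spaceI) (simp add: \<mu>_def)
  interpret prob_space \<mu> by (rule p)
  show thesis
  proof (rule that)
    show "\<psi> \<in> borel_measurable borel" unfolding \<psi>_def by measurable
    show "\<mu> = density lborel (\<lambda>x. \<psi> (norm x))"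
      unfolding \<mu>_def \<psi>_def \<phi>_def by (simp add: indicator_def mem_cball_0)
    show "facet_gap \<mu>"
      by (rule beta_facet_gap[OF d \<sigma> _ \<beta>(1) p, of "1 / z"]) (use z in \<open>simp_all add: \<mu>_def \<phi>_def\<close>)
    have ae: "AE x in \<mu>. norm x \<le> \<sigma>"
      unfolding \<mu>_def by (subst AE_density) (auto simp: \<phi>_def indicator_def intro!: AE_I2)
    show "measure \<mu> {x. norm x \<le> \<sigma>} = 1"
      using prob_Collect_eq_1[of "\<lambda>x. norm x \<le> \<sigma>"] ae by (simp add: \<mu>_def)
    fix r :: real assume r: "0 \<le> r" "r < \<sigma>"
    define u where "u = 1 - r\<^sup>2 / \<sigma>\<^sup>2"
    have "r\<^sup>2 < \<sigma>\<^sup>2" using r by (intro power_strict_mono) auto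
    then have u: "0 < u" "u \<le> 1" using \<sigma> by (auto simp: u_def)
    \<comment> \<open>On a smaller ball the weight is bounded independently of \<beta>: u is at most
      1 and \<beta> > -1, so u^\<beta> is at most 1/u.\<close>
    have le: "\<phi> x \<le> 1 / u" if "norm x \<le> r" for x
    proof -
      have "(norm x)\<^sup>2 \<le> r\<^sup>2" using that by (intro power_mono) auto
      then have ux: "u \<le> 1 - (norm x)\<^sup>2 / \<sigma>\<^sup>2" using \<sigma> by (simp add: u_def divide_right_mono)
      then have "(1 - (norm x)\<^sup>2 / \<sigma>\<^sup>2) powr \<beta> \<le> u powr \<beta>" using u \<beta> by (intro powr_mono2') auto
      also have "\<dots> \<le> u powr (- 1)" using u \<beta> by (intro powr_mono') auto
      also have "\<dots> = 1 / u" using u by (simp add: powr_minus_divide)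
      finally show ?thesis using u by (simp add: \<phi>_def indicator_def)
    qed
    have "emeasure \<mu> {x. norm x \<le> r} \<le> (\<integral>\<^sup>+x. ennreal (1 / z * (1 / u)) * indicator (cball 0 \<sigma>) x \<partial>(lborel :: (real^'d) measure))"
      unfolding em[of "{x. norm x \<le> r}", simplified]
    proof (rule nn_integral_mono)
      fix x :: "real^'d"
      show "ennreal (1 / z) * (ennreal (\<phi> x) * indicator {x. norm x \<le> r} x) \<le> ennreal (1 / z * (1 / u)) * indicator (cball 0 \<sigma>) x"
      proof (cases "norm x \<le> r")
        case True
        have "ennreal (1 / z) * ennreal (\<phi> x) = ennreal (1 / z * \<phi> x)" using z by (intro ennreal_mult[symmetric] \<phi>0) simp
        also have "\<dots> \<le> ennreal (1 / z * (1 / u))" using z by (intro ennreal_leI mult_left_mono le[OF True]) simp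
        finally show ?thesis using True r by (simp add: indicator_def)
      qed simp
    qed
    also have "\<dots> = ennreal (1 / z * (1 / u)) * ennreal l"
      using \<sigma> by (subst nn_integral_cmult_indicator) (simp_all add: emeasure_cball l_def)
    also have "\<dots> = ennreal (1 / z * (1 / u) * l)" using z u l by (intro ennreal_mult[symmetric]) auto
    finally have "measure \<mu> {x. norm x \<le> r} \<le> 1 / z * (1 / u) * l"
      using z u l by (simp add: emeasure_eq_measure)
    also have "\<dots> = (l / z) / u" by simp
    also have "\<dots> \<le> ((1 + \<beta>) / (- \<beta>)) / u"
    proof (rule divide_right_mono)
      show "l / z \<le> (1 + \<beta>) / (- \<beta>)" using zl z \<beta> by (simp add: field_simps)
    qed (use u in simp)
    finally show "measure \<mu> {x. norm x \<le> r} \<le> (1 + \<beta>) / (- \<beta>) / (1 - r\<^sup>2 / \<sigma>\<^sup>2)" by (simp add: u_def)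
  qed
qed

text \<open>The uniform distribution on the sphere is the limit, along a coupling, of the beta
  distributions with exponent tending to \<open>- 1\<close>: keep the direction and let the quantile function
  of the norm converge to \<open>\<sigma>\<close>.\<close>

lemma facet_gap_uniform_sphere:
  assumes d: "CARD('d) \<ge> 2" and \<sigma>: "0 < \<sigma>"
  shows "facet_gap (uniform_sphere \<sigma> :: (real^'d) measure)"
proof -
  let ?U = "uniform_sphere \<sigma> :: (real^'d) measure" and ?\<Omega> = "restrict_space lborel {0<..<1::real}"
  let ?P = "?U \<Otimes>\<^sub>M ?\<Omega>"
  \<comment> \<open>This choice makes the bound (1 + \<beta>) / (-\<beta>) exactly 1 / (j +
    1).\<close>
  define \<beta> where "\<beta> j = - 1 + 1 / (real j + 2)" for j :: nat
  have \<beta>: "- 1 < \<beta> j" "\<beta> j < 0" "(1 + \<beta> j) / (- \<beta> j) = inverse (real (Suc j))" for j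
    by (simp_all add: \<beta>_def field_simps)
  \<comment> \<open>All properties of the j-th law in one predicate, so that a single use of choice
    selects the sequence.\<close>
  define near where "near j \<mu> \<longleftrightarrow>
      (\<exists>\<psi> :: real \<Rightarrow> ennreal. \<psi> \<in> borel_measurable borel \<and> \<mu> = density lborel (\<lambda>x. \<psi> (norm x))) \<and>
      facet_gap \<mu> \<and> measure \<mu> {x. norm x \<le> \<sigma>} = 1 \<and>
      (\<forall>r. 0 \<le> r \<longrightarrow> r < \<sigma> \<longrightarrow> measure \<mu> {x. norm x \<le> r} \<le> inverse (real (Suc j)) / (1 - r\<^sup>2 / \<sigma>\<^sup>2))"
    for j and \<mu> :: "(real^'d) measure"
  have "\<exists>\<mu>. near j \<mu>" for j
    by (rule beta_near_sphere[OF d \<sigma> \<beta>(1,2)[of j]], unfold \<beta>(3), rule exI, unfold near_def, intro conjI exI allI impI)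
  then have "\<forall>j. \<exists>\<mu>. near j \<mu>" by (rule allI)
  from choice[OF this] obtain \<mu> where near: "near j (\<mu> j)" for j by (elim exE) (rule that, erule spec)
  have radial: "\<exists>\<psi> :: real \<Rightarrow> ennreal. \<psi> \<in> borel_measurable borel \<and> \<mu> j = density lborel (\<lambda>x. \<psi> (norm x))"
    and gap: "facet_gap (\<mu> j)" and one: "measure (\<mu> j) {x. norm x \<le> \<sigma>} = 1" for j
    using near[of j] by (simp_all only: near_def)
  have small: "measure (\<mu> j) {x. norm x \<le> r} \<le> inverse (real (Suc j)) / (1 - r\<^sup>2 / \<sigma>\<^sup>2)" if "0 \<le> r" "r < \<sigma>" for j r
    using near[of j] that by (simp only: near_def)
  have \<mu>_sets [measurable_cong]: "sets (\<mu> j) = sets borel" and p: "prob_space (\<mu> j)" for j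
    using gap[of j] by (simp_all add: facet_gap_def)
  have sp: "space (\<mu> j) = UNIV" for j using sets_eq_imp_space_eq[OF \<mu>_sets[of j]] by simp
  define N where "N j = distr (\<mu> j) borel norm" for j
  have Nr: "real_distribution (N j)" for j
    unfolding N_def by (rule prob_space.real_distribution_distr[OF p]) measurable
  interpret N: cdf_distribution "N j" for j
    unfolding cdf_distribution_def by (rule Nr)
  \<comment> \<open>The quantile function of the norm, a random variable on the unit interval whose
    law is \<open>N j\<close>.\<close>
  define Y where "Y j = N.I j" for j
  have cdf_N: "cdf (N j) r = measure (\<mu> j) {x. norm x \<le> r}" for j r
  proof -
    have "norm -` {..r} = {x :: real^'d. norm x \<le> r}" by auto
    then show ?thesis unfolding cdf_def N_def by (subst measure_distr) (simp_all add: sp)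
  qed
  have Y_le: "Y j \<omega> \<le> r \<longleftrightarrow> \<omega> \<le> measure (\<mu> j) {x. norm x \<le> r}" if "\<omega> \<in> {0<..<1}" for j \<omega> r
    unfolding Y_def cdf_N[symmetric] using that by (intro N.pseudoinverse[symmetric]) auto
  have Ym [measurable]: "Y j \<in> borel_measurable ?\<Omega>" for j
    using N.measurable_CI[of j] unfolding Y_def
    by (simp cong: measurable_cong_sets add: sets_restrict_space)
  have Yd: "distr ?\<Omega> borel (Y j) = N j" for j
    unfolding Y_def by (rule N.distr_I_eq_M)
  \<comment> \<open>Every quantile is at most \<sigma>, since the ball carries all mass. It exceeds
    r < \<sigma> once the mass of the ball of radius r has dropped below \<omega>.\<close>
  have Y_lim: "(\<lambda>j. Y j \<omega>) \<longlonglongrightarrow> \<sigma>" if \<omega>: "\<omega> \<in> {0<..<1}" for \<omega>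
  proof (rule order_tendstoI)
    fix a assume "\<sigma> < a"
    moreover have "Y j \<omega> \<le> \<sigma>" for j unfolding Y_le[OF \<omega>] one using \<omega> by simp
    ultimately show "\<forall>\<^sub>F j in sequentially. Y j \<omega> < a" by (auto intro: always_eventually le_less_trans)
  next
    fix a assume a: "a < \<sigma>"
    define r where "r = max a 0"
    have r: "0 \<le> r" "r < \<sigma>" "a \<le> r" using a \<sigma> by (auto simp: r_def)
    have "(\<lambda>j. inverse (real (Suc j)) / (1 - r\<^sup>2 / \<sigma>\<^sup>2)) \<longlonglongrightarrow> 0"
      by (intro tendsto_divide_zero LIMSEQ_inverse_real_of_nat)
    then have "\<forall>\<^sub>F j in sequentially. inverse (real (Suc j)) / (1 - r\<^sup>2 / \<sigma>\<^sup>2) < \<omega>"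
      using \<omega> by (intro order_tendstoD(2)) auto
    then show "\<forall>\<^sub>F j in sequentially. a < Y j \<omega>"
    proof (rule eventually_mono)
      fix j assume "inverse (real (Suc j)) / (1 - r\<^sup>2 / \<sigma>\<^sup>2) < \<omega>"
      then have "\<not> Y j \<omega> \<le> r" unfolding Y_le[OF \<omega>] using small[OF r(1,2), of j] by linarith
      then show "a < Y j \<omega>" using r(3) by simp
    qed
  qed
  interpret U: prob_space ?U by (rule prob_space_uniform_sphere[OF \<sigma>])
  interpret \<Omega>: prob_space ?\<Omega>
    by (auto simp: space_restrict_space emeasure_restrict_space intro!: prob_spaceI)
  interpret P: pair_prob_space ?U ?\<Omega> ..
  define T where "T j z = (Y j (snd z) / \<sigma>) *\<^sub>R (fst z :: real^'d)" for j z
  have Tm [measurable]: "T j \<in> borel_measurable ?P" for j unfolding T_def by measurable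
  have law: "emeasure (distr ?P borel S) A = (\<integral>\<^sup>+\<omega>. (\<integral>\<^sup>+u. indicator A (S (u, \<omega>)) \<partial>?U) \<partial>?\<Omega>)"
    if [measurable]: "S \<in> borel_measurable ?P" "A \<in> sets borel" for S :: "(real^'d) \<times> real \<Rightarrow> real^'d" and A
  proof -
    have "emeasure (distr ?P borel S) A = (\<integral>\<^sup>+x. indicator A x \<partial>distr ?P borel S)" by simp
    also have "\<dots> = (\<integral>\<^sup>+z. indicator A (S z) \<partial>?P)" by (rule nn_integral_distr) measurable
    also have "\<dots> = (\<integral>\<^sup>+\<omega>. (\<integral>\<^sup>+u. indicator A (S (u, \<omega>)) \<partial>?U) \<partial>?\<Omega>)"
      by (rule P.nn_integral_snd[symmetric]) measurable
    finally show ?thesis .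
  qed
  \<comment> \<open>A uniform direction and an independent norm with the right law reproduce the
    radial law \<open>\<mu> j\<close>.\<close>
  have T: "distr ?P borel (T j) = \<mu> j" for j
  proof (rule measure_eqI)
    show "sets (distr ?P borel (T j)) = sets (\<mu> j)" by (simp add: \<mu>_sets)
    fix A assume "A \<in> sets (distr ?P borel (T j))"
    then have A [measurable]: "A \<in> sets borel" by simp
    define g where "g t = (\<integral>\<^sup>+u. indicator A ((t / \<sigma>) *\<^sub>R u) \<partial>?U)" for t :: real
    have gm [measurable]: "g \<in> borel_measurable borel" unfolding g_def by measurable
    obtain \<psi> :: "real \<Rightarrow> ennreal" where \<psi>: "\<psi> \<in> borel_measurable borel" "\<mu> j = density lborel (\<lambda>x. \<psi> (norm x))"
      using radial[of j] by blast
    have "emeasure (distr ?P borel (T j)) A = (\<integral>\<^sup>+\<omega>. g (Y j \<omega>) \<partial>?\<Omega>)"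
      unfolding law[OF Tm A] by (simp add: T_def g_def)
    also have "\<dots> = (\<integral>\<^sup>+t. g t \<partial>distr ?\<Omega> borel (Y j))" by (rule nn_integral_distr[symmetric]) measurable
    also have "\<dots> = (\<integral>\<^sup>+x. g (norm x) \<partial>\<mu> j)" unfolding Yd N_def by (rule nn_integral_distr) measurable
    also have "\<dots> = (\<integral>\<^sup>+x. indicator A x \<partial>\<mu> j)"
      unfolding g_def \<psi>(2) by (rule nn_integral_radial_density[symmetric, OF _ \<psi>(1) \<sigma>]) measurable
    also have "\<dots> = emeasure (\<mu> j) A" by (simp add: \<mu>_sets)
    finally show "emeasure (distr ?P borel (T j)) A = emeasure (\<mu> j) A" .
  qed
  have T0: "distr ?P borel fst = ?U"
  proof (rule measure_eqI)
    fix A assume "A \<in> sets (distr ?P borel (fst :: (real^'d) \<times> real \<Rightarrow> real^'d))"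
    then have A: "A \<in> sets borel" by simp
    have "emeasure (distr ?P borel fst) A = (\<integral>\<^sup>+\<omega>. (\<integral>\<^sup>+u. indicator A u \<partial>?U) \<partial>?\<Omega>)"
      by (subst law[OF _ A]) simp_all
    then show "emeasure (distr ?P borel fst) A = emeasure ?U A" using A \<Omega>.emeasure_space_1 by simp
  qed simp
  have "facet_gap (distr ?P borel fst)"
  proof (rule facet_gap_limit[of ?P T])
    fix z assume "z \<in> space ?P"
    then have "(\<lambda>j. (Y j (snd z) / \<sigma>) *\<^sub>R fst z) \<longlonglongrightarrow> (\<sigma> / \<sigma>) *\<^sub>R fst z"
      using \<sigma> by (intro tendsto_intros Y_lim) (auto simp: space_pair_measure space_restrict_space)
    then show "(\<lambda>j. T j z) \<longlonglongrightarrow> fst z" using \<sigma> by (simp add: T_def)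
  qed (use gap in \<open>simp_all add: T T0 Tm P.prob_space_axioms null_hyperplanes_uniform_sphere[OF d \<sigma>] facet_moment_uniform_sphere_less_1[OF d \<sigma>]\<close>)
  then show ?thesis by (simp only: T0)
qed

section \<open>Comparison of consecutive expectations\<close>

lemma expected_facets_less:
  fixes \<mu> :: "(real^'d) measure"
  assumes gap: "facet_gap \<mu>" and d: "CARD('d) \<ge> 2" and n: "n \<ge> CARD('d) + 1"
  shows "expected_facets \<mu> {1..n - 1} < expected_facets \<mu> {1..n}"
proof -
  let ?d = "CARD('d)"
  have \<mu>: "prob_space \<mu>" "sets \<mu> = sets borel" "null_hyperplanes \<mu>" using gap by (simp_all add: facet_gap_def)
  have E: "expected_facets \<mu> {1..m} = real (m choose ?d) * facet_moment \<mu> (m - ?d)" if "?d < m" for m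
    using expected_facets_eq[OF \<mu>, of "{1..m}"] that by simp
  show ?thesis
  \<comment> \<open>The smaller hull is then a simplex of dimension d-1, counted once, whereas the
    larger one has d+1 facets.\<close>
  proof (cases "n = ?d + 1")
    case True
    then have "expected_facets \<mu> {1..n - 1} = 1" by (intro expected_facets_simplex[OF \<mu>]) auto
    moreover have "expected_facets \<mu> {1..n} = real ?d + 1"
      using E[of n] True facet_moment_1[OF \<mu>] by simp
    ultimately show ?thesis using d by simp
  next
    case False
    then have n': "?d < n" "?d < n - 1" using n by auto
    define k where "k = n - ?d"
    have k: "k \<ge> 1" "n - 1 - ?d = k - 1" "real n = real ?d + real k" using n' by (auto simp: k_def)
    let ?c = "real (n - 1 choose ?d)"
    \<comment> \<open>Brings both expectations to the common factor C(n-1,d), so that the sign of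
      their difference is that of the combination bounded in \<open>facet_gap\<close>.\<close>
    have absorb: "real k * real (n choose ?d) = real n * ?c"
      using binomial_absorb_comp[of n ?d] by (simp only: k_def of_nat_mult[symmetric])
    have c: "0 < ?c" using n' by (simp add: zero_less_binomial_iff)
    have "0 < real (?d - 1) * ((1 - facet_moment \<mu> 2) / 2) ^ k"
      using gap d by (simp add: facet_gap_def)
    also have "\<dots> \<le> (real ?d + real k) * facet_moment \<mu> k - real k * facet_moment \<mu> (k - 1)"
      using gap k(1) by (simp add: facet_gap_def)
    finally have "0 < ?c * (real n * facet_moment \<mu> k - real k * facet_moment \<mu> (k - 1))"
      using c k(3) by simp
    also have "\<dots> = real n * ?c * facet_moment \<mu> k - real k * (?c * facet_moment \<mu> (k - 1))"
      by (simp add: algebra_simps)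
    also have "\<dots> = real k * (expected_facets \<mu> {1..n} - expected_facets \<mu> {1..n - 1})"
      unfolding E[OF n'(1)] E[OF n'(2)] k(2) absorb[symmetric] k_def[symmetric] by (simp add: algebra_simps)
    finally show ?thesis using k(1) by (simp add: zero_less_mult_iff)
  qed
qed

text \<open>Independence identifies the joint law with the product measure. Restricting the tuple to
  \<open>I\<close> is harmless because the hull uses only indices in \<open>I\<close>.\<close>

lemma (in prob_space) expectation_facets:
  fixes X :: "'i \<Rightarrow> 'a \<Rightarrow> real^'d"
  assumes indep: "indep_vars (\<lambda>_. borel) X I" and law: "\<And>i. i \<in> I \<Longrightarrow> distr M borel (X i) = \<mu>"
    and I: "finite I" "I \<noteq> {}" and \<mu>: "prob_space \<mu>" "sets \<mu> = sets borel" "null_hyperplanes \<mu>"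
  shows "expectation (\<lambda>\<omega>. real (face_number (CARD('d) - 1) (convex hull ((\<lambda>i. X i \<omega>) ` I)))) = expected_facets \<mu> I"
proof -
  let ?F = "\<lambda>x :: 'i \<Rightarrow> real^'d. real (face_number (CARD('d) - 1) (convex hull (x ` I)))"
  let ?X = "\<lambda>\<omega>. \<lambda>i\<in>I. X i \<omega>"
  have rv: "random_variable borel (X i)" if "i \<in> I" for i
    using indep that by (simp add: indep_vars_def)
  have "distr M (PiM I (\<lambda>_. borel)) ?X = PiM I (\<lambda>i. distr M borel (X i))"
    using indep by (subst (asm) indep_vars_iff_distr_eq_PiM'[OF I(2) rv]) auto
  also have "\<dots> = PiM I (\<lambda>_. \<mu>)" by (rule PiM_cong) (simp_all add: law)
  finally have joint: "PiM I (\<lambda>_. \<mu>) = distr M (PiM I (\<lambda>_. borel)) ?X" ..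
  have "sets (PiM I (\<lambda>_. \<mu>)) = sets (PiM I (\<lambda>_. borel :: (real^'d) measure))"
    by (rule sets_PiM_cong) (simp_all add: \<mu>(2))
  then have F: "?F \<in> borel_measurable (PiM I (\<lambda>_. borel))"
    using measurable_face_number[OF \<mu> I(1)] by (simp cong: measurable_cong_sets)
  have "expected_facets \<mu> I = (LINT \<omega>|M. ?F (?X \<omega>))"
    unfolding expected_facets_def joint by (rule integral_distr[OF _ F]) (intro measurable_restrict rv)
  then show ?thesis by (simp cong: image_cong)
qed

theorem theorem1:
  fixes M :: "'w measure"
    and X :: "nat \<Rightarrow> 'w \<Rightarrow> real ^ 'd"
    and \<mu> :: "(real ^ 'd) measure"
    and n :: nat
  assumes "CARD('d) \<ge> 2"
    and "n \<ge> CARD('d) + 1"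
    and "prob_space M"
    and "prob_space.indep_vars M (\<lambda>_. borel) X {1..n}"
    and "\<And>i. i \<in> {1..n} \<Longrightarrow> distr M borel (X i) = \<mu>"
    and "\<mu> \<in> class_G \<union> class_H \<union> class_B \<union> class_U"
  shows "prob_space.expectation M
           (\<lambda>\<omega>. real (face_number (CARD('d) - 1) (convex hull ((\<lambda>i. X i \<omega>) ` {1..n}))))
       > prob_space.expectation M
           (\<lambda>\<omega>. real (face_number (CARD('d) - 1) (convex hull ((\<lambda>i. X i \<omega>) ` {1..n - 1}))))"
proof -
  interpret prob_space M by fact
  have gap: "facet_gap \<mu>"
    using assms(6) class_G_facet_gap class_H_facet_gap class_B_facet_gap[OF assms(1)] facet_gap_uniform_sphere[OF assms(1)]
    by (auto simp: class_U_def)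
  then have \<mu>: "prob_space \<mu>" "sets \<mu> = sets borel" "null_hyperplanes \<mu>" by (simp_all add: facet_gap_def)
  have "expectation (\<lambda>\<omega>. real (face_number (CARD('d) - 1) (convex hull ((\<lambda>i. X i \<omega>) ` I)))) = expected_facets \<mu> I"
    if "I \<subseteq> {1..n}" "I \<noteq> {}" for I
    using that assms(5) by (intro expectation_facets[OF indep_vars_subset[OF assms(4)] _ _ _ \<mu>]) (auto intro: finite_subset)
  from this[of "{1..n}"] this[of "{1..n - 1}"] show ?thesis
    using expected_facets_less[OF gap assms(1,2)] assms(1,2) by (auto simp: not_le)
qed

end
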